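(* Let $X$ be the homogeneous diffusion with coefficients $a,b$ described in the context, and assume $\Phi(0,+\infty)<+\infty$ and $\Phi(0,-\infty)=-\infty$. Let $f:\mathbb{R}\to\mathbb{R}$ be a measurable function such that $f$ and $f/a^2$ are locally integrable, and assume that $$I_1(f)=\int_0^{+\infty}\frac{|f(y)|}{a(y)^2}\Phi(y,+\infty)\,dy<+\infty.$$ Let $x\in\mathbb{R}$ and assume additionally that $$\int_{-\infty}^x\frac{|f(u)|}{a(u)^2}\varphi(u,x)\,du<+\infty.$$ Then $$\mathsf{E}\left[J^x_\infty(f)\right]=2\int_x^{+\infty}\frac{f(u)}{a(u)^2}\Phi(u,+\infty)\,du+2\Phi(x,+\infty)\int_{-\infty}^x\frac{f(u)}{a(u)^2}\varphi(u,x)\,du.$$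
   Context: On a complete filtered probability space $(\Omega,\mathcal{F},\{\mathcal{F}_t\}_{t\ge0},\mathsf{P})$ with a standard $\mathcal{F}_t$-Wiener process $W$, consider the family $\{X^x_t,\,t\ge 0,\,x\in\mathbb{R}\}$ of one-dimensional homogeneous diffusion processes $$dX^x_t=b(X^x_t)\,dt+a(X^x_t)\,dW_t,\quad t\ge 0,\qquad X_0^x=x.$$ The coefficients $a,b:\mathbb{R}\to\mathbb{R}$ are continuous, $a(x)\ne 0$ for all $x\in\mathbb{R}$, and they are such that a non-explosive weak solution on $\mathbb{R}$ exists. Define $\varphi(x_0,x)=\exp\left\{-2\int_{x_0}^{x}\frac{b(u)}{a(u)^2}\,du\right\}$ and $\Phi(x_0,x)=\int_{x_0}^x\varphi(x_0,z)\,dz$ for $x_0,x\in\mathbb{R}$, and $\Phi(x_0,\pm\infty)=\lim_{x\to\pm\infty}\Phi(x_0,x)$. Integral functional: $J^x_\infty(f)=\int_0^\infty f(X^x_s)\,ds$. *)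

theory Defs
  imports "HOL-Probability.Probability"
begin

section \<open>Filtered probability spaces and Wiener processes\<close>

text \<open>Time is a real number; only the indices \<open>t \<ge> 0\<close> are relevant, and filtrations and
  processes are unconstrained at negative indices.\<close>

locale complete_filtered_prob_space = prob_space M + complete_measure M
  for M :: "'a measure" +
  fixes F :: "real \<Rightarrow> 'a measure"
  assumes subalgebra_F: "\<And>t. 0 \<le> t \<Longrightarrow> subalgebra M (F t)"
    and F_mono: "\<And>s t. 0 \<le> s \<Longrightarrow> s \<le> t \<Longrightarrow> sets (F s) \<subseteq> sets (F t)"
    and F_null: "null_sets M \<subseteq> sets (F 0)"

definition adapted :: "(real \<Rightarrow> 'a measure) \<Rightarrow> (real \<Rightarrow> 'a \<Rightarrow> real) \<Rightarrow> bool" where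
  "adapted F X \<longleftrightarrow> (\<forall>t\<ge>0. X t \<in> borel_measurable (F t))"

definition continuous_paths :: "'a measure \<Rightarrow> (real \<Rightarrow> 'a \<Rightarrow> real) \<Rightarrow> bool" where
  "continuous_paths M X \<longleftrightarrow> (AE \<omega> in M. continuous_on {0..} (\<lambda>t. X t \<omega>))"

locale wiener_process = complete_filtered_prob_space M F
  for M :: "'a measure" and F :: "real \<Rightarrow> 'a measure" +
  fixes W :: "real \<Rightarrow> 'a \<Rightarrow> real"
  assumes W_adapted: "adapted F W"
    and W_continuous: "continuous_paths M W"
    and W_zero: "AE \<omega> in M. W 0 \<omega> = 0"
    and W_indep: "\<And>s t. 0 \<le> s \<Longrightarrow> s < t \<Longrightarrow>
      indep_set (sets (F s)) (sets (vimage_algebra (space M) (\<lambda>\<omega>. W t \<omega> - W s \<omega>) borel))"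
    and W_normal: "\<And>s t. 0 \<le> s \<Longrightarrow> s < t \<Longrightarrow>
      distributed M lborel (\<lambda>\<omega>. W t \<omega> - W s \<omega>) (\<lambda>y. ennreal (normal_density 0 (sqrt (t - s)) y))"

section \<open>The It\^o integral\<close>

text \<open>A simple process is \<open>\<Sum>i<n. \<xi> i * 1{\<tau> i < s \<le> \<tau> (i+1)}\<close> with a deterministic
  partition \<open>\<tau>\<close> and bounded, \<open>F (\<tau> i)\<close>-measurable weights \<open>\<xi> i\<close>.\<close>

definition simple_process ::
    "'a measure \<Rightarrow> (real \<Rightarrow> 'a measure) \<Rightarrow> nat \<Rightarrow> (nat \<Rightarrow> real) \<Rightarrow> (nat \<Rightarrow> 'a \<Rightarrow> real) \<Rightarrow> bool" where
  "simple_process M F n \<tau> \<xi> \<longleftrightarrow>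
     0 \<le> \<tau> 0 \<and> (\<forall>i<n. \<tau> i \<le> \<tau> (Suc i)) \<and>
     (\<forall>i<n. \<xi> i \<in> borel_measurable (F (\<tau> i)) \<and> (\<exists>C. \<forall>\<omega>\<in>space M. \<bar>\<xi> i \<omega>\<bar> \<le> C))"

definition simple_value ::
    "nat \<Rightarrow> (nat \<Rightarrow> real) \<Rightarrow> (nat \<Rightarrow> 'a \<Rightarrow> real) \<Rightarrow> real \<Rightarrow> 'a \<Rightarrow> real" where
  "simple_value n \<tau> \<xi> s \<omega> = (\<Sum>i<n. \<xi> i \<omega> * indicator {\<tau> i<..\<tau> (Suc i)} s)"

definition simple_integral ::
    "(real \<Rightarrow> 'a \<Rightarrow> real) \<Rightarrow> nat \<Rightarrow> (nat \<Rightarrow> real) \<Rightarrow> (nat \<Rightarrow> 'a \<Rightarrow> real) \<Rightarrow> real \<Rightarrow> 'a \<Rightarrow> real" where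
  "simple_integral W n \<tau> \<xi> t \<omega> =
     (\<Sum>i<n. \<xi> i \<omega> * (W (min t (\<tau> (Suc i))) \<omega> - W (min t (\<tau> i)) \<omega>))"

definition vanishes_in_prob :: "'a measure \<Rightarrow> (nat \<Rightarrow> 'a \<Rightarrow> ennreal) \<Rightarrow> bool" where
  "vanishes_in_prob M Z \<longleftrightarrow>
     (\<forall>k. Z k \<in> borel_measurable M) \<and>
     (\<forall>\<epsilon>>0. (\<lambda>k. measure M {\<omega> \<in> space M. ennreal \<epsilon> < Z k \<omega>}) \<longlonglongrightarrow> 0)"

text \<open>\<open>is_ito_integral M F W H I\<close>: the process \<open>I\<close> is (a continuous version of) the stochastic
  integral \<open>\<integral>\<^sub>0\<^sup>t H dW\<close>, i.e. the limit in probability of the integrals of simple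
  processes \<open>H\<^sub>k\<close> for which \<open>\<integral>\<^sub>0\<^sup>T (H\<^sub>k - H)\<^sup>2 ds\<close> tends to \<open>0\<close> in probability for every \<open>T\<close>.
  Such a sequence exists if and only if \<open>H\<close> agrees \<open>P \<otimes> ds\<close>-almost everywhere with a progressively
  measurable process satisfying \<open>\<integral>\<^sub>0\<^sup>T H\<^sup>2 ds < \<infinity>\<close> almost surely for every \<open>T\<close>, so \<open>H\<close> needs no
  separate hypotheses; the process \<open>I\<close> is determined by \<open>H\<close> up to indistinguishability.\<close>

definition is_ito_integral ::
    "'a measure \<Rightarrow> (real \<Rightarrow> 'a measure) \<Rightarrow> (real \<Rightarrow> 'a \<Rightarrow> real) \<Rightarrow>
     (real \<Rightarrow> 'a \<Rightarrow> real) \<Rightarrow> (real \<Rightarrow> 'a \<Rightarrow> real) \<Rightarrow> bool" where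
  "is_ito_integral M F W H I \<longleftrightarrow>
     adapted F I \<and> continuous_paths M I \<and>
     (\<exists>n \<tau> \<xi>.
        (\<forall>k. simple_process M F (n k) (\<tau> k) (\<xi> k)) \<and>
        (\<forall>T\<ge>0. vanishes_in_prob M (\<lambda>k \<omega>.
           \<integral>\<^sup>+s\<in>{0..T}. ennreal ((simple_value (n k) (\<tau> k) (\<xi> k) s \<omega> - H s \<omega>)\<^sup>2) \<partial>lborel)) \<and>
        (\<forall>t\<ge>0. vanishes_in_prob M (\<lambda>k \<omega>.
           ennreal \<bar>simple_integral W (n k) (\<tau> k) (\<xi> k) t \<omega> - I t \<omega>\<bar>)))"

section \<open>Homogeneous diffusions\<close>

text \<open>\<open>dX = b(X) dt + a(X) dW\<close>, \<open>X\<^sub>0 = x\<close>. The solution is defined, real-valued and continuous on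
  all of \<open>[0, \<infinity>)\<close>, hence non-explosive; it need not be adapted to the filtration generated
  by \<open>W\<close>.\<close>

definition diffusion ::
    "'a measure \<Rightarrow> (real \<Rightarrow> 'a measure) \<Rightarrow> (real \<Rightarrow> 'a \<Rightarrow> real) \<Rightarrow> (real \<Rightarrow> real) \<Rightarrow> (real \<Rightarrow> real) \<Rightarrow>
     real \<Rightarrow> (real \<Rightarrow> 'a \<Rightarrow> real) \<Rightarrow> bool" where
  "diffusion M F W a b x X \<longleftrightarrow>
     adapted F X \<and> continuous_paths M X \<and>
     (\<exists>I. is_ito_integral M F W (\<lambda>s \<omega>. a (X s \<omega>)) I \<and>
          (AE \<omega> in M. \<forall>t\<ge>0. X t \<omega> = x + (LBINT s:{0..t}. b (X s \<omega>)) + I t \<omega>))"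

text \<open>The interval integrals are oriented, so \<open>x < x0\<close> is allowed.\<close>

definition phi :: "(real \<Rightarrow> real) \<Rightarrow> (real \<Rightarrow> real) \<Rightarrow> real \<Rightarrow> real \<Rightarrow> real" where
  "phi a b x0 x = exp (- 2 * (LBINT u=ereal x0..ereal x. b u / (a u)\<^sup>2))"

definition Phi :: "(real \<Rightarrow> real) \<Rightarrow> (real \<Rightarrow> real) \<Rightarrow> real \<Rightarrow> real \<Rightarrow> real" where
  "Phi a b x0 x = (LBINT z=ereal x0..ereal x. phi a b x0 z)"

definition Phi_pinf :: "(real \<Rightarrow> real) \<Rightarrow> (real \<Rightarrow> real) \<Rightarrow> real \<Rightarrow> ereal" where
  "Phi_pinf a b x0 = Lim at_top (\<lambda>x. ereal (Phi a b x0 x))"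

definition Phi_minf :: "(real \<Rightarrow> real) \<Rightarrow> (real \<Rightarrow> real) \<Rightarrow> real \<Rightarrow> ereal" where
  "Phi_minf a b x0 = Lim at_bot (\<lambda>x. ereal (Phi a b x0 x))"

definition locally_integrable :: "(real \<Rightarrow> real) \<Rightarrow> bool" where
  "locally_integrable f \<longleftrightarrow> (\<forall>K. compact K \<longrightarrow> set_integrable lborel K f)"

definition J_inf :: "(real \<Rightarrow> 'a \<Rightarrow> real) \<Rightarrow> (real \<Rightarrow> real) \<Rightarrow> 'a \<Rightarrow> real" where
  "J_inf X f \<omega> = (LBINT s:{0..}. f (X s \<omega>))"

end

theory Submission
  imports Defs
begin

text \<open>Let \<open>s = \<Phi>(0, \<cdot>)\<close> be the scale function and \<open>L = a\<^sup>2/2 D\<^sup>2 + b D\<close> the generator. On \<open>[c, d]\<close> the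
  equation \<open>L u = - f\<close>, \<open>u(c) = u(d) = 0\<close> is solved by integrating \<open>f\<close> against the Green function
  \<open>2 (s(min x y) - s(c)) (s(d) - s(max x y)) / ((s(d) - s(c)) a(y)\<^sup>2 s'(y))\<close>, so Dynkin's formula shows that
  the occupation measure of the diffusion killed on leaving \<open>[c, d]\<close> has this density. As
  \<open>c \<rightarrow> -\<infinity>\<close> and \<open>d \<rightarrow> \<infinity>\<close> the densities increase to \<open>2 (s(\<infinity>) - s(max x y)) / (a(y)\<^sup>2 s'(y))\<close>,
  because \<open>s(-\<infinity>) = -\<infinity>\<close>, and integrating \<open>f\<close> against the limit gives the formula.

  Dynkin's formula is obtained without a general Ito formula. The process is compared with an Euler scheme
  whose increments \<open>b(X) h + a(X) \<Delta>W\<close> are evaluated at the diffusion itself and switched off once it has left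
  \<open>[c, d]\<close>; these have bounded coefficients, so a Taylor expansion and the moments of \<open>\<Delta>W\<close> suffice.\<close>

text \<open>The obstacle is that \<open>is_ito_integral\<close> gives only convergence in
  probability along unspecified simple processes: it yields no moments of \<open>X\<close> and no
  formula for \<open>I\<close>. Killing answers the first problem, since the continuous coefficients
  are bounded on \<open>[c, d]\<close> and all test functions are bounded. For the second,
  \<open>ito_grid_sum_vanishes\<close> shows that left-endpoint sums of \<open>a (X t)\<close>
  against \<open>W\<close> approximate the increments of \<open>I\<close>, uniformly over all
  families of past events that switch summands off. The uniformity is essential: the generator sum
  involves the scheme at every grid time, each with its own stopped sum. The scheme itself may leave
  \<open>[c, d]\<close> through a Gaussian increment, so test functions must be controlled on the
  whole line. Finally, Dynkin's formula is applied to continuous nonnegative right-hand sides only;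
  the passage to a measurable \<open>f\<close> is an identity of measures on the line, so
  \<open>f\<close> itself is never approximated.\<close>

section \<open>Moments of Wiener increments\<close>

context wiener_process begin

lemma F_subalgebra_mono: "0 \<le> s \<Longrightarrow> s \<le> t \<Longrightarrow> subalgebra (F t) (F s)"
  using subalgebra_F[of s] subalgebra_F[of t] F_mono[of s t] by (auto simp: subalgebra_def)

lemma F_measurable_mono: "0 \<le> s \<Longrightarrow> s \<le> t \<Longrightarrow> g \<in> borel_measurable (F s) \<Longrightarrow> g \<in> borel_measurable (F t)"
  using F_subalgebra_mono measurable_from_subalg by blast

lemma F_measurable: "0 \<le> s \<Longrightarrow> g \<in> borel_measurable (F s) \<Longrightarrow> g \<in> borel_measurable M"
  using subalgebra_F measurable_from_subalg by blast

lemma W_F_measurable: "0 \<le> s \<Longrightarrow> s \<le> t \<Longrightarrow> W s \<in> borel_measurable (F t)"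
  using W_adapted F_measurable_mono by (auto simp: adapted_def)

text \<open>Independence of the sigma-algebras in \<open>W_indep\<close> becomes independence of
  random variables by shrinking \<open>F s\<close> to the sigma-algebra generated by
  \<open>g\<close>.\<close>

lemma increment_indep:
  assumes "0 \<le> s" "s < t" and g: "g \<in> borel_measurable (F s)"
  shows "indep_var borel g borel (\<lambda>\<omega>. W t \<omega> - W s \<omega>)"
proof -
  have sp: "space (F s) = space M" using subalgebra_F[OF assms(1)] by (simp add: subalgebra_def)
  have gM: "g \<in> borel_measurable M" using F_measurable[OF assms(1) g] .
  have WM: "(\<lambda>\<omega>. W t \<omega> - W s \<omega>) \<in> borel_measurable M"
    using W_normal[OF assms(1,2)] by (auto simp: distributed_def)
  have "indep_set (sigma_sets (space M) {g -` A \<inter> space M |A. A \<in> sets borel})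
     (sigma_sets (space M) {(\<lambda>\<omega>. W t \<omega> - W s \<omega>) -` A \<inter> space M |A. A \<in> sets borel})"
    unfolding indep_set_def
  proof (rule indep_sets_mono_sets[OF W_indep[OF assms(1,2), unfolded indep_set_def]])
    fix i :: bool
    have 1: "sigma_sets (space M) {g -` A \<inter> space M |A. A \<in> sets borel} \<subseteq> sets (F s)"
      unfolding sp[symmetric] using g by (intro sets.sigma_sets_subset) (auto intro: measurable_sets)
    have 2: "sets (vimage_algebra (space M) (\<lambda>\<omega>. W t \<omega> - W s \<omega>) borel)
      = sigma_sets (space M) {(\<lambda>\<omega>. W t \<omega> - W s \<omega>) -` A \<inter> space M |A. A \<in> sets borel}"
      by (simp add: sets_vimage_algebra)
    show "(case i of True \<Rightarrow> sigma_sets (space M) {g -` A \<inter> space M |A. A \<in> sets borel}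
         | False \<Rightarrow> sigma_sets (space M) {(\<lambda>\<omega>. W t \<omega> - W s \<omega>) -` A \<inter> space M |A. A \<in> sets borel})
        \<subseteq> (case i of True \<Rightarrow> sets (F s) | False \<Rightarrow> sets (vimage_algebra (space M) (\<lambda>\<omega>. W t \<omega> - W s \<omega>) borel))"
      using 1 2 by (auto split: bool.split)
  qed
  then show ?thesis using gM WM by (simp add: indep_var_eq)
qed

text \<open>The second and fourth moments are the ones that \<open>euler_step\<close> needs: its
  Taylor remainder is bounded by second and fourth powers of the increment.\<close>

lemma
  assumes "0 \<le> s" "s < t"
  shows increment_power_integrable: "integrable M (\<lambda>\<omega>. (W t \<omega> - W s \<omega>) ^ k)"
    and increment_expectation: "expectation (\<lambda>\<omega>. W t \<omega> - W s \<omega>) = 0"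
    and increment_expectation_2: "expectation (\<lambda>\<omega>. (W t \<omega> - W s \<omega>)\<^sup>2) = t - s"
    and increment_expectation_4: "expectation (\<lambda>\<omega>. (W t \<omega> - W s \<omega>) ^ 4) = 3 * (t - s)\<^sup>2"
proof -
  have sd: "0 < sqrt (t - s)" using assms by simp
  note D = W_normal[OF assms]
  have int: "(\<integral>y. normal_density 0 (sqrt (t - s)) y * g y \<partial>lborel) = expectation (\<lambda>\<omega>. g (W t \<omega> - W s \<omega>))"
    if "g \<in> borel_measurable borel" for g :: "real \<Rightarrow> real"
    using that by (intro distributed_integral[OF D]) auto
  show "integrable M (\<lambda>\<omega>. (W t \<omega> - W s \<omega>) ^ k)"
    using integrable_normal_moment[OF sd, of 0 k]
    by (subst distributed_integrable[OF D, symmetric]) auto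
  show "expectation (\<lambda>\<omega>. W t \<omega> - W s \<omega>) = 0"
    using int[of "\<lambda>y. y"] integral_normal_moment_odd[OF sd, of 0 0] by simp
  show "expectation (\<lambda>\<omega>. (W t \<omega> - W s \<omega>)\<^sup>2) = t - s"
    using int[of "\<lambda>y. y\<^sup>2"] integral_normal_moment_even[OF sd, of 0 1] assms by simp
  show "expectation (\<lambda>\<omega>. (W t \<omega> - W s \<omega>) ^ 4) = 3 * (t - s)\<^sup>2"
    using int[of "\<lambda>y. y ^ 4"] integral_normal_moment_even[OF sd, of 0 2] assms
    by (simp add: fact_numeral field_simps power2_eq_square)
qed

text \<open>A past weight is independent of the increment, so expectations factorize. The weight is
  only assumed integrable because \<open>isometry\<close> uses it with an unbounded partial
  sum.\<close>

lemma
  assumes "0 \<le> s" "s < t" and g: "g \<in> borel_measurable (F s)" "integrable M g"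
  shows increment_mult_integrable: "integrable M (\<lambda>\<omega>. g \<omega> * (W t \<omega> - W s \<omega>) ^ k)"
    and increment_mult_expectation: "expectation (\<lambda>\<omega>. g \<omega> * (W t \<omega> - W s \<omega>)) = 0"
    and increment_mult_expectation_2:
      "expectation (\<lambda>\<omega>. g \<omega> * (W t \<omega> - W s \<omega>)\<^sup>2) = expectation g * (t - s)"
proof -
  have ind: "indep_var borel g borel (\<lambda>\<omega>. (W t \<omega> - W s \<omega>) ^ k)" for k
    using indep_var_compose[OF increment_indep[OF assms(1-3)], of id borel "\<lambda>y. y ^ k" borel]
    by (auto simp: comp_def)
  note I = increment_power_integrable[OF assms(1,2)]
  show "integrable M (\<lambda>\<omega>. g \<omega> * (W t \<omega> - W s \<omega>) ^ k)"
    by (rule indep_var_integrable[OF ind g(2) I])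
  show "expectation (\<lambda>\<omega>. g \<omega> * (W t \<omega> - W s \<omega>)) = 0"
    using indep_var_lebesgue_integral[OF ind[of 1] g(2) I] increment_expectation[OF assms(1,2)] by simp
  show "expectation (\<lambda>\<omega>. g \<omega> * (W t \<omega> - W s \<omega>)\<^sup>2) = expectation g * (t - s)"
    using indep_var_lebesgue_integral[OF ind[of 2] g(2) I] increment_expectation_2[OF assms(1,2)] by simp
qed

end

section \<open>Simple integrals\<close>

lemma abs_le_imp_sq_le: "\<bar>y\<bar> \<le> C \<Longrightarrow> y\<^sup>2 \<le> C\<^sup>2" for y C :: real
  using power_mono[of "\<bar>y\<bar>" C 2] by simp

context wiener_process begin

text \<open>Ito isometry, adding one increment at a time: the cross term
  \<open>2 * S n * D n\<close> is known at time \<open>p n\<close>, so its product with the next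
  increment has mean zero. Measurability and square integrability of \<open>S n\<close> ride along
  because the next step needs them.\<close>

lemma isometry:
  fixes p :: "nat \<Rightarrow> real" and D :: "nat \<Rightarrow> 'a \<Rightarrow> real"
  assumes p0: "0 \<le> p 0" and p: "\<And>l. l < m \<Longrightarrow> p l < p (Suc l)"
    and D: "\<And>l. l < m \<Longrightarrow> D l \<in> borel_measurable (F (p l))"
    and bd: "\<And>l. l < m \<Longrightarrow> \<exists>C. \<forall>\<omega>\<in>space M. \<bar>D l \<omega>\<bar> \<le> C"
  defines "S \<equiv> \<lambda>n \<omega>. \<Sum>l<n. D l \<omega> * (W (p (Suc l)) \<omega> - W (p l) \<omega>)"
  shows "n \<le> m \<Longrightarrow> 0 \<le> p n \<and> S n \<in> borel_measurable (F (p n)) \<and> integrable M (\<lambda>\<omega>. (S n \<omega>)\<^sup>2) \<and>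
     expectation (\<lambda>\<omega>. (S n \<omega>)\<^sup>2) = (\<Sum>l<n. expectation (\<lambda>\<omega>. (D l \<omega>)\<^sup>2) * (p (Suc l) - p l))"
proof (induction n)
  case 0
  then show ?case using p0 by (simp add: S_def)
next
  case (Suc n)
  then have n: "n < m" and pn: "0 \<le> p n" and SF[measurable]: "S n \<in> borel_measurable (F (p n))"
    and S2: "integrable M (\<lambda>\<omega>. (S n \<omega>)\<^sup>2)"
    and IH: "expectation (\<lambda>\<omega>. (S n \<omega>)\<^sup>2) = (\<Sum>l<n. expectation (\<lambda>\<omega>. (D l \<omega>)\<^sup>2) * (p (Suc l) - p l))"
    by auto
  note pS = p[OF n]
  note DF[measurable] = D[OF n]
  have SM[measurable]: "S n \<in> borel_measurable M" using F_measurable pn SF by blast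
  have DM[measurable]: "D n \<in> borel_measurable M" using F_measurable pn DF by blast
  obtain C where C: "\<And>\<omega>. \<omega> \<in> space M \<Longrightarrow> \<bar>D n \<omega>\<bar> \<le> C" using bd[OF n] by blast
  have iD2: "integrable M (\<lambda>\<omega>. (D n \<omega>)\<^sup>2)"
    by (rule integrable_const_bound[where B="C\<^sup>2"]) (auto intro!: AE_I2 abs_le_imp_sq_le C)
  \<comment> \<open>\<open>S n\<close> need not be bounded; \<open>2 |S D| \<le> S^2 + D^2\<close>
    supplies integrability.\<close>
  have iSD: "integrable M (\<lambda>\<omega>. 2 * S n \<omega> * D n \<omega>)"
    apply (rule Bochner_Integration.integrable_bound[of M "\<lambda>\<omega>. (S n \<omega>)\<^sup>2 + (D n \<omega>)\<^sup>2"])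
    using S2 iD2 apply simp
    apply simp
    apply (intro AE_I2)
    subgoal for \<omega> using sum_squares_bound[of "S n \<omega>" "D n \<omega>"] sum_squares_bound[of "- S n \<omega>" "D n \<omega>"]
      by (simp add: abs_le_iff)
    done
  define \<Delta> where "\<Delta> = (\<lambda>\<omega>. W (p (Suc n)) \<omega> - W (p n) \<omega>)"
  have sq: "(S (Suc n) \<omega>)\<^sup>2 = (S n \<omega>)\<^sup>2 + (2 * S n \<omega> * D n \<omega>) * \<Delta> \<omega> + (D n \<omega>)\<^sup>2 * (\<Delta> \<omega>)\<^sup>2" for \<omega>
    by (simp add: S_def \<Delta>_def power2_eq_square algebra_simps)
  have m1: "(\<lambda>\<omega>. 2 * S n \<omega> * D n \<omega>) \<in> borel_measurable (F (p n))" "(\<lambda>\<omega>. (D n \<omega>)\<^sup>2) \<in> borel_measurable (F (p n))"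
    by measurable
  have e1: "expectation (\<lambda>\<omega>. (2 * S n \<omega> * D n \<omega>) * \<Delta> \<omega>) = 0" and i1: "integrable M (\<lambda>\<omega>. (2 * S n \<omega> * D n \<omega>) * \<Delta> \<omega>)"
    using increment_mult_expectation[OF pn pS m1(1) iSD] increment_mult_integrable[OF pn pS m1(1) iSD, of 1]
    by (simp_all add: \<Delta>_def)
  have e2: "expectation (\<lambda>\<omega>. (D n \<omega>)\<^sup>2 * (\<Delta> \<omega>)\<^sup>2) = expectation (\<lambda>\<omega>. (D n \<omega>)\<^sup>2) * (p (Suc n) - p n)"
    and i2: "integrable M (\<lambda>\<omega>. (D n \<omega>)\<^sup>2 * (\<Delta> \<omega>)\<^sup>2)"
    using increment_mult_expectation_2[OF pn pS m1(2) iD2] increment_mult_integrable[OF pn pS m1(2) iD2, of 2]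
    by (simp_all add: \<Delta>_def)
  have [measurable]: "S n \<in> borel_measurable (F (p (Suc n)))" "D n \<in> borel_measurable (F (p (Suc n)))"
    "W (p n) \<in> borel_measurable (F (p (Suc n)))" "W (p (Suc n)) \<in> borel_measurable (F (p (Suc n)))"
    using F_measurable_mono[OF pn less_imp_le[OF pS] SF] F_measurable_mono[OF pn less_imp_le[OF pS] DF]
      W_F_measurable[of "p n"] W_F_measurable[of "p (Suc n)"] pn pS by auto
  have "S (Suc n) = (\<lambda>\<omega>. S n \<omega> + D n \<omega> * (W (p (Suc n)) \<omega> - W (p n) \<omega>))" by (simp add: S_def fun_eq_iff)
  then have "S (Suc n) \<in> borel_measurable (F (p (Suc n)))" by simp
  moreover have "integrable M (\<lambda>\<omega>. (S (Suc n) \<omega>)\<^sup>2)"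
    unfolding sq using S2 i1 i2 by simp
  moreover have "expectation (\<lambda>\<omega>. (S (Suc n) \<omega>)\<^sup>2) = (\<Sum>l<Suc n. expectation (\<lambda>\<omega>. (D l \<omega>)\<^sup>2) * (p (Suc l) - p l))"
    unfolding sq using S2 i1 i2 e1 e2 IH by simp
  ultimately show ?case using pn pS by auto
qed

end

text \<open>If no node lies strictly between u and v, each half-open cell of the partition either
  contains all of \<open>{u<..v}\<close> or misses it. This lets two different partitions be
  compared on a common refinement.\<close>

lemma simple_value_cell:
  assumes gap: "\<And>i. i \<le> n \<Longrightarrow> \<not> (u < \<tau> i \<and> \<tau> i < v)" and "u < r" "r \<le> v"
  shows "simple_value n \<tau> \<xi> r \<omega> = simple_value n \<tau> \<xi> v \<omega>"
  unfolding simple_value_def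
proof (intro sum.cong refl)
  fix i assume "i \<in> {..<n}"
  then show "\<xi> i \<omega> * indicator {\<tau> i<..\<tau> (Suc i)} r = \<xi> i \<omega> * indicator {\<tau> i<..\<tau> (Suc i)} v"
    using gap[of i] gap[of "Suc i"] assms(2,3) by (auto simp: indicator_def)
qed

text \<open>Each summand samples \<open>w\<close> at times clipped to its own cell. Without nodes
  strictly between u and v, the clipped time either runs through the whole interval from u to v or
  stands still.\<close>

lemma simple_integral_cell:
  assumes mono: "\<And>i. i < n \<Longrightarrow> \<tau> i \<le> \<tau> (Suc i)"
    and gap: "\<And>i. i \<le> n \<Longrightarrow> \<not> (u < \<tau> i \<and> \<tau> i < v)" and "u < v"
  shows "simple_integral w n \<tau> \<xi> v \<omega> - simple_integral w n \<tau> \<xi> u \<omega>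
    = simple_value n \<tau> \<xi> v \<omega> * (w v \<omega> - w u \<omega>)"
  unfolding simple_value_def simple_integral_def sum_subtractf[symmetric] sum_distrib_right
proof (intro sum.cong refl)
  fix i assume i: "i \<in> {..<n}"
  then have "\<tau> i \<le> \<tau> (Suc i)" using mono by simp
  moreover have "\<tau> i \<le> u \<or> v \<le> \<tau> i" "\<tau> (Suc i) \<le> u \<or> v \<le> \<tau> (Suc i)"
    using gap[of i] gap[of "Suc i"] i by auto
  ultimately show "\<xi> i \<omega> * (w (min v (\<tau> (Suc i))) \<omega> - w (min v (\<tau> i)) \<omega>) -
     \<xi> i \<omega> * (w (min u (\<tau> (Suc i))) \<omega> - w (min u (\<tau> i)) \<omega>)
     = \<xi> i \<omega> * indicator {\<tau> i<..\<tau> (Suc i)} v * (w v \<omega> - w u \<omega>)"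
    using \<open>u < v\<close> by (elim disjE) (simp_all add: indicator_def min_absorb1 min_absorb2 right_diff_distrib)
qed

lemma partition_nonneg:
  fixes \<tau> :: "nat \<Rightarrow> real"
  assumes "0 \<le> \<tau> 0" "\<And>i. i < n \<Longrightarrow> \<tau> i \<le> \<tau> (Suc i)" "i \<le> n"
  shows "0 \<le> \<tau> i"
  using assms(3)
proof (induction i)
  case (Suc i)
  then show ?case using assms(2)[of i] by simp
qed (rule assms(1))

lemma simple_process_nonneg: "simple_process M F n \<tau> \<xi> \<Longrightarrow> i \<le> n \<Longrightarrow> 0 \<le> \<tau> i"
  using partition_nonneg[of \<tau> n i] by (auto simp: simple_process_def)

text \<open>A weight active at v was fixed at a node before v, and the gap pushes that node back to
  u or earlier. So the value used over the step from u to v is already known at u, as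
  \<open>simple_integral_tail\<close> demands of its weights.\<close>

lemma (in wiener_process) simple_value_measurable:
  assumes nn: "0 \<le> \<tau> 0" and mono: "\<And>i. i < n \<Longrightarrow> \<tau> i \<le> \<tau> (Suc i)"
    and gap: "\<And>i. i \<le> n \<Longrightarrow> \<not> (u < \<tau> i \<and> \<tau> i < v)" and "u < v"
    and \<xi>: "\<And>i. i < n \<Longrightarrow> \<xi> i \<in> borel_measurable (F (\<tau> i))"
  shows "simple_value n \<tau> \<xi> v \<in> borel_measurable (F u)"
  unfolding simple_value_def
proof (rule borel_measurable_sum)
  fix i assume i: "i \<in> {..<n}"
  have "0 \<le> \<tau> i" by (rule partition_nonneg[OF nn mono]) (use i in auto)
  show "(\<lambda>\<omega>. \<xi> i \<omega> * indicator {\<tau> i<..\<tau> (Suc i)} v) \<in> borel_measurable (F u)"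
  proof (cases "\<tau> i < v")
    case True
    then have "\<tau> i \<le> u" using gap[of i] i by auto
    then have "\<xi> i \<in> borel_measurable (F u)"
      using F_measurable_mono[OF \<open>0 \<le> \<tau> i\<close> _ \<xi>, of u] i by blast
    then show ?thesis by simp
  next
    case False
    then have "(\<lambda>\<omega>. \<xi> i \<omega> * indicator {\<tau> i<..\<tau> (Suc i)} v) = (\<lambda>\<omega>. 0)" by (simp add: indicator_def fun_eq_iff)
    then show ?thesis by simp
  qed
qed

context wiener_process begin

text \<open>A weight is switched off once the running sum of squares has exceeded \<open>\<delta>\<close>; this leaves the
  integral unchanged on the event that the total stays below \<open>\<delta>\<close>, and Chebyshev's inequality applies.\<close>

lemma simple_integral_tail:
  fixes p :: "nat \<Rightarrow> real" and D :: "nat \<Rightarrow> 'a \<Rightarrow> real"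
  assumes p0: "0 \<le> p 0" and p: "\<And>l. l < m \<Longrightarrow> p l < p (Suc l)"
    and D: "\<And>l. l < m \<Longrightarrow> D l \<in> borel_measurable (F (p l))"
    and \<epsilon>: "0 < \<epsilon>" and \<delta>: "0 < \<delta>"
  shows "prob {\<omega>\<in>space M. \<epsilon> < \<bar>\<Sum>l<m. D l \<omega> * (W (p (Suc l)) \<omega> - W (p l) \<omega>)\<bar>}
    \<le> prob {\<omega>\<in>space M. \<delta> < (\<Sum>l<m. (D l \<omega>)\<^sup>2 * (p (Suc l) - p l))} + \<delta> / \<epsilon>\<^sup>2"
proof -
  define V where "V = (\<lambda>n \<omega>. \<Sum>l<n. (D l \<omega>)\<^sup>2 * (p (Suc l) - p l))"
  \<comment> \<open>\<open>V (Suc l)\<close> already contains the l-th square, which is known at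
    time \<open>p l\<close>. Testing it rather than \<open>V l\<close> keeps \<open>E\<close>
    adapted and prevents an overshoot beyond \<delta>.\<close>
  define E where "E = (\<lambda>l \<omega>. if V (Suc l) \<omega> \<le> \<delta> then D l \<omega> else 0)"
  have pmono: "p k \<le> p l" if "k \<le> l" "l \<le> m" for k l
    using that(1,2)
  proof (induction l rule: dec_induct)
    case (step n) then show ?case using p[of n] by simp
  qed simp
  have pge: "0 \<le> p l" if "l \<le> m" for l using pmono[of 0 l] p0 that by simp
  have [measurable]: "D k \<in> borel_measurable (F (p l))" if "k \<le> l" "l < m" for k l
    using F_measurable_mono[of "p k" "p l" "D k"] D[of k] pge[of k] pmono[of k l] that by auto
  have Emeas: "E l \<in> borel_measurable (F (p l))" if "l < m" for l
    unfolding E_def V_def using that by measurable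
  have DM[measurable]: "D l \<in> borel_measurable M" if "l < m" for l using F_measurable[OF pge D] that by simp
  have EM[measurable]: "E l \<in> borel_measurable M" if "l < m" for l using F_measurable[OF pge Emeas] that by simp
  have WM[measurable]: "W (p l) \<in> borel_measurable M" if "l \<le> m" for l
    using F_measurable[OF pge] W_F_measurable[OF pge] that by blast
  have V_mono: "V k \<omega> \<le> V l \<omega>" if "k \<le> l" "l \<le> m" for k l \<omega>
    using that(1,2)
  proof (induction l rule: dec_induct)
    case (step n)
    moreover have "0 \<le> (D n \<omega>)\<^sup>2 * (p (Suc n) - p n)" using step p[of n] by simp
    ultimately show ?case by (simp add: V_def)
  qed simp
  \<comment> \<open>Since \<open>V\<close> increases, the surviving weights form an initial segment,
    and the truncated sum is the value of \<open>V\<close> at its end.\<close>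
  have E2: "(\<Sum>l<n. (E l \<omega>)\<^sup>2 * (p (Suc l) - p l)) \<le> \<delta>" if "n \<le> m" for n \<omega>
  proof (cases "V n \<omega> \<le> \<delta>")
    case True
    then have "V (Suc l) \<omega> \<le> \<delta>" if "l < n" for l using V_mono[of "Suc l" n \<omega>] that \<open>n \<le> m\<close> by linarith
    then have "(\<Sum>l<n. (E l \<omega>)\<^sup>2 * (p (Suc l) - p l)) = V n \<omega>" by (simp add: E_def V_def)
    then show ?thesis using True by simp
  next
    case False
    then show ?thesis using that
    proof (induction n)
      case (Suc n)
      then have En: "E n \<omega> = 0" by (simp add: E_def)
      show ?case
      proof (cases "V n \<omega> \<le> \<delta>")
        case True
        then have "V (Suc l) \<omega> \<le> \<delta>" if "l < n" for l using V_mono[of "Suc l" n \<omega>] that \<open>Suc n \<le> m\<close> by linarith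
        then have "(\<Sum>l<n. (E l \<omega>)\<^sup>2 * (p (Suc l) - p l)) = V n \<omega>" by (simp add: E_def V_def)
        then show ?thesis using True En by simp
      qed (use Suc En in simp)
    qed (use \<delta> in simp)
  qed
  \<comment> \<open>\<open>D\<close> is not assumed bounded. A bound for \<open>E l\<close> is read
    off from a single term of the truncated sum, divided by the positive step length.\<close>
  have bd: "\<exists>C. \<forall>\<omega>\<in>space M. \<bar>E l \<omega>\<bar> \<le> C" if l: "l < m" for l
  proof (intro exI ballI)
    fix \<omega>
    have "(E l \<omega>)\<^sup>2 * (p (Suc l) - p l) \<le> (\<Sum>l<Suc l. (E l \<omega>)\<^sup>2 * (p (Suc l) - p l))"
      by (rule member_le_sum) (use p l in \<open>auto intro!: mult_nonneg_nonneg simp: less_imp_le\<close>)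
    also have "\<dots> \<le> \<delta>" using E2[of "Suc l" \<omega>] l by simp
    finally have "(E l \<omega>)\<^sup>2 \<le> \<delta> / (p (Suc l) - p l)" using p[OF l] by (simp add: field_simps)
    then show "\<bar>E l \<omega>\<bar> \<le> sqrt (\<delta> / (p (Suc l) - p l))" by (simp add: real_le_rsqrt)
  qed
  define S where "S = (\<lambda>\<omega>. \<Sum>l<m. E l \<omega> * (W (p (Suc l)) \<omega> - W (p l) \<omega>))"
  note iso = isometry[where m=m and n=m and D=E and p=p, OF p0 p Emeas bd order_refl]
  have [measurable]: "S \<in> borel_measurable M" unfolding S_def by measurable
  have iE2: "integrable M (\<lambda>\<omega>. (E l \<omega>)\<^sup>2)" if l: "l < m" for l
  proof -
    obtain C where C: "\<And>\<omega>. \<omega> \<in> space M \<Longrightarrow> \<bar>E l \<omega>\<bar> \<le> C" using bd[OF l] by blast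
    show ?thesis using l
      by (intro integrable_const_bound[where B="C\<^sup>2"]) (auto intro!: AE_I2 abs_le_imp_sq_le C)
  qed
  have "expectation (\<lambda>\<omega>. (S \<omega>)\<^sup>2) = (\<Sum>l<m. expectation (\<lambda>\<omega>. (E l \<omega>)\<^sup>2) * (p (Suc l) - p l))"
    using iso by (simp add: S_def)
  also have "\<dots> = expectation (\<lambda>\<omega>. \<Sum>l<m. (E l \<omega>)\<^sup>2 * (p (Suc l) - p l))"
    using iE2 by simp
  also have "\<dots> \<le> expectation (\<lambda>\<omega>. \<delta>)"
    by (intro integral_mono E2 Bochner_Integration.integrable_sum integrable_mult_left iE2) auto
  finally have ES: "expectation (\<lambda>\<omega>. (S \<omega>)\<^sup>2) \<le> \<delta>" by (simp add: prob_space)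
  have "prob {\<omega>\<in>space M. \<epsilon>\<^sup>2 \<le> (S \<omega>)\<^sup>2} \<le> expectation (\<lambda>\<omega>. (S \<omega>)\<^sup>2) / \<epsilon>\<^sup>2"
    by (rule integral_Markov_inequality_measure[where A="{}"]) (use iso \<epsilon> in \<open>auto simp: S_def\<close>)
  also have "\<dots> \<le> \<delta> / \<epsilon>\<^sup>2" using ES by (simp add: divide_right_mono)
  finally have P: "prob {\<omega>\<in>space M. \<epsilon>\<^sup>2 \<le> (S \<omega>)\<^sup>2} \<le> \<delta> / \<epsilon>\<^sup>2" .
  have VM[measurable]: "V m \<in> borel_measurable M" unfolding V_def by measurable
  have "{\<omega>\<in>space M. \<epsilon> < \<bar>\<Sum>l<m. D l \<omega> * (W (p (Suc l)) \<omega> - W (p l) \<omega>)\<bar>}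
     \<subseteq> {\<omega>\<in>space M. \<delta> < V m \<omega>} \<union> {\<omega>\<in>space M. \<epsilon>\<^sup>2 \<le> (S \<omega>)\<^sup>2}"
  proof (rule subsetI, rule ccontr)
    fix \<omega> assume 1: "\<omega> \<in> {\<omega>\<in>space M. \<epsilon> < \<bar>\<Sum>l<m. D l \<omega> * (W (p (Suc l)) \<omega> - W (p l) \<omega>)\<bar>}"
      and 2: "\<omega> \<notin> {\<omega>\<in>space M. \<delta> < V m \<omega>} \<union> {\<omega>\<in>space M. \<epsilon>\<^sup>2 \<le> (S \<omega>)\<^sup>2}"
    from 1 2 have "V m \<omega> \<le> \<delta>" by auto
    then have "V (Suc l) \<omega> \<le> \<delta>" if "l < m" for l using V_mono[of "Suc l" m \<omega>] that by linarith
    then have "S \<omega> = (\<Sum>l<m. D l \<omega> * (W (p (Suc l)) \<omega> - W (p l) \<omega>))" by (simp add: S_def E_def)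
    then have "\<epsilon> < \<bar>S \<omega>\<bar>" using 1 by simp
    then have "\<epsilon>\<^sup>2 \<le> (S \<omega>)\<^sup>2" using \<epsilon> by (simp add: abs_le_square_iff[symmetric])
    then show False using 1 2 by simp
  qed
  then have "prob {\<omega>\<in>space M. \<epsilon> < \<bar>\<Sum>l<m. D l \<omega> * (W (p (Suc l)) \<omega> - W (p l) \<omega>)\<bar>}
     \<le> prob ({\<omega>\<in>space M. \<delta> < V m \<omega>} \<union> {\<omega>\<in>space M. \<epsilon>\<^sup>2 \<le> (S \<omega>)\<^sup>2})"
    by (intro finite_measure_mono) auto
  also have "\<dots> \<le> prob {\<omega>\<in>space M. \<delta> < V m \<omega>} + prob {\<omega>\<in>space M. \<epsilon>\<^sup>2 \<le> (S \<omega>)\<^sup>2}"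
    by (intro measure_Un_le) auto
  finally show ?thesis using P by (simp add: V_def)
qed

end

section \<open>Approximation of the stochastic integral on a grid\<close>

text \<open>Sorted enumeration of a finite node set. That no node lies strictly inside a cell is the
  form in which \<open>simple_value_cell\<close> and \<open>simple_integral_cell\<close> consume
  it.\<close>

lemma finite_partition:
  fixes P :: "real set"
  assumes P: "finite P" "0 \<in> P" "T \<in> P" "P \<subseteq> {0..T}"
  obtains p :: "nat \<Rightarrow> real" and m :: nat where "p 0 = 0" "p m = T" "\<And>l. l < m \<Longrightarrow> p l < p (Suc l)"
    "\<And>l r. l < m \<Longrightarrow> r \<in> P \<Longrightarrow> \<not> (p l < r \<and> r < p (Suc l))" "\<And>l. l \<le> m \<Longrightarrow> p l \<in> {0..T}"
proof -
  define xs where "xs = sorted_list_of_set P"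
  have len: "length xs = card P" and sx: "set xs = P" and st: "sorted_wrt (<) xs"
    using P by (simp_all add: xs_def)
  have cP: "0 < card P" using P by (auto simp: card_gt_0_iff)
  have less: "xs ! k < xs ! l \<longleftrightarrow> k < l" if "k < card P" "l < card P" for k l
    using sorted_wrt_nth_less[OF st, of k l] sorted_wrt_nth_less[OF st, of l k] that len
    by (metis less_asym linorder_neqE_nat order_less_irrefl)
  have ex: "\<exists>k<card P. r = xs ! k" if "r \<in> P" for r
    using that sx len by (metis in_set_conv_nth)
  have inP: "xs ! k \<in> P" if "k < card P" for k using that sx len nth_mem by metis
  show ?thesis
  proof (rule that[of "\<lambda>l. xs ! l" "card P - 1"])
    obtain k where k: "k < card P" "0 = xs ! k" using ex[OF P(2)] by metis
    have "0 \<le> xs ! 0" using inP[of 0] cP P(4) by auto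
    then have "k = 0" using less[of 0 k] k cP by auto
    then show "xs ! 0 = 0" using k by simp
    obtain k where k: "k < card P" "T = xs ! k" using ex[OF P(3)] by metis
    have "xs ! (card P - 1) \<le> T" using inP[of "card P - 1"] cP P(4) by auto
    then have "k = card P - 1" using less[of k "card P - 1"] k cP by (cases "k < card P - 1") auto
    then show "xs ! (card P - 1) = T" using k by simp
    fix l
    show "xs ! l < xs ! Suc l" if "l < card P - 1" using less[of l "Suc l"] that by simp
    show "\<not> (xs ! l < r \<and> r < xs ! Suc l)" if l: "l < card P - 1" and r: "r \<in> P" for r
    proof -
      obtain k where k: "k < card P" "r = xs ! k" using ex r by auto
      show ?thesis using less[of l k] less[of k "Suc l"] k l by auto
    qed
    show "xs ! l \<in> {0..T}" if "l \<le> card P - 1"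
    proof -
      have "l < card P" using that cP by linarith
      then show ?thesis using inP P(4) by blast
    qed
  qed
qed

section \<open>Uniform grids, left-endpoint step functions and joint measurability\<close>

definition grid :: "real \<Rightarrow> nat \<Rightarrow> nat \<Rightarrow> real" where
  "grid T N j = real j * (T / real N)"

lemma grid_0: "grid T N 0 = 0" by (simp add: grid_def)
lemma grid_N: "0 < N \<Longrightarrow> grid T N N = T" by (simp add: grid_def)
lemma grid_Suc: "grid T N (Suc j) = grid T N j + T / N" by (simp add: grid_def add_divide_distrib distrib_right)
lemma grid_mono: "0 < T \<Longrightarrow> i \<le> j \<Longrightarrow> grid T N i \<le> grid T N j"
  unfolding grid_def by (intro mult_right_mono) auto
lemma grid_nonneg: "0 < T \<Longrightarrow> 0 \<le> grid T N j" by (simp add: grid_def)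
lemma grid_less_Suc: "0 < T \<Longrightarrow> 0 < N \<Longrightarrow> grid T N j < grid T N (Suc j)" by (simp add: grid_Suc)
lemma grid_le: "0 < T \<Longrightarrow> 0 < N \<Longrightarrow> j \<le> N \<Longrightarrow> grid T N j \<le> T"
  using grid_mono[of T j N N] by (simp add: grid_N)

lemma grid_oscillation:
  fixes \<phi> :: "real \<Rightarrow> real"
  assumes T: "0 < T" and \<phi>: "continuous_on {0..T} \<phi>" and e: "0 < e"
  shows "\<forall>\<^sub>F N in sequentially. 0 < N \<and>
    (\<forall>s\<in>{0..T}. \<forall>t\<in>{0..T}. \<bar>t - s\<bar> \<le> T / real N \<longrightarrow> \<bar>\<phi> t - \<phi> s\<bar> < e)"
proof -
  have "uniformly_continuous_on {0..T} \<phi>" using \<phi> by (intro compact_uniformly_continuous) auto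
  then obtain d where d: "0 < d" "\<And>s t. s \<in> {0..T} \<Longrightarrow> t \<in> {0..T} \<Longrightarrow> dist t s < d \<Longrightarrow> dist (\<phi> t) (\<phi> s) < e"
    unfolding uniformly_continuous_on_def using e by metis
  obtain n :: nat where n: "T / d < real n" using reals_Archimedean2 by blast
  show ?thesis
    using eventually_ge_at_top[of "Suc n"]
  proof eventually_elim
    case (elim N)
    then have "T / d < real N" using n by linarith
    then have "T / real N < d" using d elim by (simp add: field_simps)
    then show ?case using d(2) elim by (force simp: dist_real_def)
  qed
qed

text \<open>The cells are disjoint, so at r exactly one weight survives in the sum. They are open on
  the left, hence 0 belongs to none of them; later it is discarded as a null set.\<close>

lemma grid_cell:
  assumes T: "0 < T" and N: "0 < N" and r: "0 < r" "r \<le> T"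
  obtains j where "j < N" "grid T N j < r" "r \<le> grid T N (Suc j)"
    "\<And>\<xi> \<omega>. simple_value N (grid T N) \<xi> r \<omega> = \<xi> j \<omega>"
proof -
  define j where "j = (LEAST k. r \<le> grid T N (Suc k))"
  have ex: "r \<le> grid T N (Suc (N - 1))" using r N grid_N[OF N, of T] by simp
  have 1: "r \<le> grid T N (Suc j)" unfolding j_def by (rule LeastI[of "\<lambda>k. r \<le> grid T N (Suc k)", OF ex])
  have 2: "j < N" using Least_le[of "\<lambda>k. r \<le> grid T N (Suc k)", OF ex] N by (simp add: j_def)
  have 3: "grid T N j < r"
  proof (cases j)
    case (Suc k)
    then have "\<not> r \<le> grid T N (Suc k)" using not_less_Least[of k "\<lambda>k. r \<le> grid T N (Suc k)"] by (simp add: j_def)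
    then show ?thesis using Suc by simp
  qed (use r in \<open>simp add: grid_0\<close>)
  have "simple_value N (grid T N) \<xi> r \<omega> = \<xi> j \<omega>" for \<xi> \<omega>
  proof -
    have "indicator {grid T N i<..grid T N (Suc i)} r = (if i = j then 1 else 0 :: real)" for i
    proof (cases "i = j")
      case False
      then consider "Suc i \<le> j" | "Suc j \<le> i" by linarith
      then show ?thesis
        using grid_mono[OF T, of "Suc i" j N] grid_mono[OF T, of "Suc j" i N] 1 3
        by cases (auto simp: indicator_def)
    qed (use 1 3 in simp)
    then have "simple_value N (grid T N) \<xi> r \<omega> = (\<Sum>i<N. if i = j then \<xi> i \<omega> else 0)"
      unfolding simple_value_def by (intro sum.cong refl) (simp only:, simp)
    then show ?thesis using 2 by simp
  qed
  then show ?thesis using that 1 2 3 by blast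
qed

text \<open>Approximation from below matters: when a path is tested up to time t, the rational test
  times must not exceed t. The denominator \<open>Suc n\<close> avoids a division by 0.\<close>

lemma floor_approx_le: "real_of_int \<lfloor>real (Suc n) * t\<rfloor> / real (Suc n) \<le> t"
proof -
  have "real_of_int \<lfloor>real (Suc n) * t\<rfloor> \<le> real (Suc n) * t" by linarith
  then have "real_of_int \<lfloor>real (Suc n) * t\<rfloor> / real (Suc n) \<le> real (Suc n) * t / real (Suc n)"
    by (rule divide_right_mono) simp
  then show ?thesis by simp
qed

lemma floor_approx_tendsto: "(\<lambda>n. real_of_int \<lfloor>real (Suc n) * t\<rfloor> / real (Suc n)) \<longlonglongrightarrow> t"
proof (rule tendsto_sandwich[of "\<lambda>n. t - 1 / real (Suc n)" _ _ "\<lambda>n. t"])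
  show "\<forall>\<^sub>F n in sequentially. t - 1 / real (Suc n) \<le> real_of_int \<lfloor>real (Suc n) * t\<rfloor> / real (Suc n)"
  proof (rule always_eventually, rule allI)
    fix n
    have "real (Suc n) * t - 1 \<le> real_of_int \<lfloor>real (Suc n) * t\<rfloor>" by linarith
    then have "(real (Suc n) * t - 1) / real (Suc n) \<le> real_of_int \<lfloor>real (Suc n) * t\<rfloor> / real (Suc n)" by (rule divide_right_mono) simp
    then show "t - 1 / real (Suc n) \<le> real_of_int \<lfloor>real (Suc n) * t\<rfloor> / real (Suc n)" by (simp add: diff_divide_distrib)
  qed
  show "\<forall>\<^sub>F n in sequentially. real_of_int \<lfloor>real (Suc n) * t\<rfloor> / real (Suc n) \<le> t"
    using floor_approx_le by (intro always_eventually allI)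
  have "(\<lambda>n. t - 1 / real (Suc n)) \<longlonglongrightarrow> t - 0"
    by (intro tendsto_intros LIMSEQ_Suc[OF lim_1_over_n])
  then show "(\<lambda>n. t - 1 / real (Suc n)) \<longlonglongrightarrow> t" by simp
qed simp

text \<open>Sampling at the floor approximations of t involves only countably many times, so the
  sampled process is jointly measurable, and continuity of the paths carries this to the limit.
  Processes are unconstrained at negative times, hence the \<open>max 0\<close>.\<close>

lemma joint_measurable:
  fixes X :: "real \<Rightarrow> 'a \<Rightarrow> real"
  assumes X: "\<And>t. 0 \<le> t \<Longrightarrow> X t \<in> borel_measurable M"
    and cont: "\<And>\<omega>. \<omega> \<in> space M \<Longrightarrow> continuous_on {0..} (\<lambda>t. X t \<omega>)"
  shows "(\<lambda>(t, \<omega>). X (max 0 t) \<omega>) \<in> borel_measurable (borel \<Otimes>\<^sub>M M)"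
proof (rule borel_measurable_LIMSEQ_real)
  define q where "q = (\<lambda>n t. real_of_int \<lfloor>real (Suc n) * t\<rfloor> / real (Suc n))"
  show "(\<lambda>z. (\<lambda>(t, \<omega>). X (max 0 (q n t)) \<omega>) z) \<in> borel_measurable (borel \<Otimes>\<^sub>M M)" for n
  proof -
    have m: "(\<lambda>z. X (max 0 (real_of_int i / real (Suc n))) (snd z)) \<in> borel_measurable (borel \<Otimes>\<^sub>M M)" for i
      by (rule measurable_compose[OF measurable_snd X]) simp
    show ?thesis unfolding q_def case_prod_beta
      by (rule measurable_compose_countable[OF m]) measurable
  qed
  fix z :: "real \<times> 'a" assume "z \<in> space (borel \<Otimes>\<^sub>M M)"
  then obtain t \<omega> where z: "z = (t, \<omega>)" "\<omega> \<in> space M" by (auto simp: space_pair_measure)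
  have "(\<lambda>n. q n t) \<longlonglongrightarrow> t" unfolding q_def by (rule floor_approx_tendsto)
  then have "(\<lambda>n. max 0 (q n t)) \<longlonglongrightarrow> max 0 t" by (intro tendsto_intros)
  then have "(\<lambda>n. X (max 0 (q n t)) \<omega>) \<longlonglongrightarrow> X (max 0 t) \<omega>"
    by (rule continuous_on_tendsto_compose[OF cont[OF z(2)]]) auto
  then show "(\<lambda>n. (\<lambda>(t, \<omega>). X (max 0 (q n t)) \<omega>) z) \<longlonglongrightarrow> (\<lambda>(t, \<omega>). X (max 0 t) \<omega>) z" by (simp add: z)
qed

definition grid_error :: "(real \<Rightarrow> 'a \<Rightarrow> real) \<Rightarrow> real \<Rightarrow> nat \<Rightarrow> 'a \<Rightarrow> ennreal" where
  "grid_error H T N \<omega> = (\<integral>\<^sup>+s\<in>{0..T}.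
     ennreal ((simple_value N (grid T N) (\<lambda>j. H (grid T N j)) s \<omega> - H s \<omega>)\<^sup>2) \<partial>lborel)"

lemma grid_error_measurable:
  assumes X: "\<And>t. 0 \<le> t \<Longrightarrow> H t \<in> borel_measurable M"
    and cont: "\<And>\<omega>. \<omega> \<in> space M \<Longrightarrow> continuous_on {0..} (\<lambda>t. H t \<omega>)" and T: "0 < T"
  shows "grid_error H T N \<in> borel_measurable M"
proof -
  note [measurable] = joint_measurable[OF X cont]
  have [measurable]: "H (grid T N j) \<in> borel_measurable M" for j using X grid_nonneg[OF T] .
  have [measurable]: "(\<lambda>(\<omega>, s). H (max 0 s) \<omega>) \<in> borel_measurable (M \<Otimes>\<^sub>M lborel)"
    using measurable_compose[OF measurable_pair_swap' joint_measurable[OF X cont]]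
    by (simp add: case_prod_beta' cong: measurable_cong_sets)
  have "grid_error H T N = (\<lambda>\<omega>. (\<integral>\<^sup>+s. ennreal ((simple_value N (grid T N) (\<lambda>j. H (grid T N j)) s \<omega> - H (max 0 s) \<omega>)\<^sup>2) * indicator {0..T} s \<partial>lborel))"
    unfolding grid_error_def by (intro ext nn_integral_cong) (auto simp: indicator_def max_def)
  also have "\<dots> \<in> borel_measurable M"
    unfolding simple_value_def by measurable
  finally show ?thesis .
qed

lemma grid_error_tendsto:
  fixes H :: "real \<Rightarrow> 'a \<Rightarrow> real"
  assumes cont: "continuous_on {0..} (\<lambda>t. H t \<omega>)" and T: "0 < T"
  shows "(\<lambda>N. grid_error H T N \<omega>) \<longlonglongrightarrow> 0"
proof (rule order_tendstoI)
  fix e :: ennreal assume "0 < e"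
  \<comment> \<open>The target may be infinite; a finite z below it gives a real tolerance. Then
    \<eta> is chosen so that a uniform error \<eta> over a time span T integrates to
    \<open>\<eta>\<^sup>2 * T = e'\<close>.\<close>
  then obtain z where z: "0 < z" "z < e" using dense by blast
  then have zt: "z \<noteq> \<top>" by auto
  define e' where "e' = enn2real z"
  have e': "0 < e'" "ennreal e' < e" using z zt by (auto simp: e'_def enn2real_positive_iff less_top)
  define \<eta> where "\<eta> = sqrt (e' / T)"
  have \<eta>: "0 < \<eta>" "\<eta>\<^sup>2 * T = e'" using e' T by (auto simp: \<eta>_def)
  have H: "continuous_on {0..T} (\<lambda>t. H t \<omega>)" by (rule continuous_on_subset[OF cont]) auto
  show "\<forall>\<^sub>F N in sequentially. grid_error H T N \<omega> < e"
    using grid_oscillation[OF T H \<eta>(1)]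
  proof eventually_elim
    case (elim N)
    then have N0: "0 < N" and d: "\<And>s t. s \<in> {0..T} \<Longrightarrow> t \<in> {0..T} \<Longrightarrow> \<bar>t - s\<bar> \<le> T / real N \<Longrightarrow> \<bar>H t \<omega> - H s \<omega>\<bar> < \<eta>"
      by auto
    have "grid_error H T N \<omega> \<le> (\<integral>\<^sup>+s\<in>{0..T}. ennreal (\<eta>\<^sup>2) \<partial>lborel)"
      unfolding grid_error_def
    proof (rule nn_integral_mono_AE)
      show "AE s in lborel. ennreal ((simple_value N (grid T N) (\<lambda>j. H (grid T N j)) s \<omega> - H s \<omega>)\<^sup>2) * indicator {0..T} s
        \<le> ennreal (\<eta>\<^sup>2) * indicator {0..T} s"
        using AE_lborel_singleton[of 0]
      proof eventually_elim
        fix s :: real assume s: "s \<noteq> 0"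
        show "ennreal ((simple_value N (grid T N) (\<lambda>j. H (grid T N j)) s \<omega> - H s \<omega>)\<^sup>2) * indicator {0..T} s
        \<le> ennreal (\<eta>\<^sup>2) * indicator {0..T} s"
        proof (cases "s \<in> {0..T}")
          case True
          then obtain j where j: "j < N" "grid T N j < s" "s \<le> grid T N (Suc j)"
            "\<And>(\<xi> :: nat \<Rightarrow> 'a \<Rightarrow> real) \<omega>. simple_value N (grid T N) \<xi> s \<omega> = \<xi> j \<omega>"
            using grid_cell[OF T N0, of s] s by (auto simp: less_le)
          have "\<bar>H (grid T N j) \<omega> - H s \<omega>\<bar> < \<eta>"
            using j True grid_nonneg[OF T, of N j] by (intro d) (auto simp: grid_Suc)
          then show ?thesis using True j(4)[of "\<lambda>j. H (grid T N j)" \<omega>]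
            by (auto intro!: ennreal_leI abs_le_imp_sq_le)
        qed simp
      qed
    qed
    also have "\<dots> = ennreal (\<eta>\<^sup>2) * ennreal T" using T by (simp add: nn_integral_cmult_indicator)
    also have "\<dots> = ennreal e'" using \<eta> T by (simp add: ennreal_mult'[symmetric])
    finally show "grid_error H T N \<omega> < e" using e' by simp
  qed
qed simp

text \<open>For each outcome the indicator of the exceedance is eventually 0, and dominated
  convergence with bound 1 applies.\<close>

lemma (in prob_space) prob_tendsto_0:
  fixes Z :: "nat \<Rightarrow> 'a \<Rightarrow> ennreal"
  assumes [measurable]: "\<And>N. Z N \<in> borel_measurable M"
    and lim: "\<And>\<omega>. \<omega> \<in> space M \<Longrightarrow> (\<lambda>N. Z N \<omega>) \<longlonglongrightarrow> 0" and e: "0 < e"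
  shows "(\<lambda>N. prob {\<omega>\<in>space M. ennreal e < Z N \<omega>}) \<longlonglongrightarrow> 0"
proof -
  have "(\<lambda>N. expectation (indicator {\<omega>\<in>space M. ennreal e < Z N \<omega>} :: 'a \<Rightarrow> real)) \<longlonglongrightarrow> expectation (\<lambda>\<omega>. 0)"
  proof (rule integral_dominated_convergence[where w="\<lambda>_. 1"])
    show "AE \<omega> in M. (\<lambda>N. indicator {\<omega>\<in>space M. ennreal e < Z N \<omega>} \<omega> :: real) \<longlonglongrightarrow> 0"
    proof (rule AE_I2)
      fix \<omega> assume "\<omega> \<in> space M"
      from order_tendstoD(2)[OF lim[OF this], of "ennreal e"] e
      have "\<forall>\<^sub>F N in sequentially. Z N \<omega> < ennreal e" by simp
      then have "\<forall>\<^sub>F N in sequentially. indicator {\<omega>\<in>space M. ennreal e < Z N \<omega>} \<omega> = (0::real)"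
        by eventually_elim (auto simp: indicator_def)
      then show "(\<lambda>N. indicator {\<omega>\<in>space M. ennreal e < Z N \<omega>} \<omega> :: real) \<longlonglongrightarrow> 0"
        by (rule tendsto_eventually)
    qed
  qed (auto simp: indicator_def)
  then show ?thesis by simp
qed

text \<open>Over a refinement of the grid the increments of the simple integral telescope, so
  refining does not change its value. The integrator \<open>w\<close> is arbitrary because it will
  be \<open>W\<close> in one application and another simple integral in the next.\<close>

lemma simple_integral_partition:
  assumes T: "0 < T" and N: "0 < N" and p: "p 0 = 0" "p m = T" "\<And>l. l < m \<Longrightarrow> p l < p (Suc l)"
    and gap: "\<And>l i. l < m \<Longrightarrow> i \<le> N \<Longrightarrow> \<not> (p l < grid T N i \<and> grid T N i < p (Suc l))"
  shows "(\<Sum>l<m. simple_value N (grid T N) \<zeta> (p (Suc l)) \<omega> * (w (p (Suc l)) \<omega> - w (p l) \<omega>))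
    = (\<Sum>j<N. \<zeta> j \<omega> * (w (grid T N (Suc j)) \<omega> - w (grid T N j) \<omega>))"
proof -
  have "(\<Sum>l<m. simple_value N (grid T N) \<zeta> (p (Suc l)) \<omega> * (w (p (Suc l)) \<omega> - w (p l) \<omega>))
    = (\<Sum>l<m. simple_integral w N (grid T N) \<zeta> (p (Suc l)) \<omega> - simple_integral w N (grid T N) \<zeta> (p l) \<omega>)"
    using p gap grid_less_Suc[OF T N]
    by (intro sum.cong refl simple_integral_cell[symmetric]) (auto intro: less_imp_le)
  also have "\<dots> = simple_integral w N (grid T N) \<zeta> T \<omega> - simple_integral w N (grid T N) \<zeta> 0 \<omega>"
    using sum_lessThan_telescope[of "\<lambda>l. simple_integral w N (grid T N) \<zeta> (p l) \<omega>" m] p(1,2) by simp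
  also have "simple_integral w N (grid T N) \<zeta> 0 \<omega> = 0"
    using grid_nonneg[OF T, of N] by (simp add: simple_integral_def min_absorb1)
  also have "simple_integral w N (grid T N) \<zeta> T \<omega> = (\<Sum>j<N. \<zeta> j \<omega> * (w (grid T N (Suc j)) \<omega> - w (grid T N j) \<omega>))"
    unfolding simple_integral_def
  proof (intro sum.cong refl)
    fix j assume "j \<in> {..<N}"
    then have "grid T N (Suc j) \<le> T" "grid T N j \<le> T" using grid_le[OF T N] by auto
    then show "\<zeta> j \<omega> * (w (min T (grid T N (Suc j))) \<omega> - w (min T (grid T N j)) \<omega>) =
         \<zeta> j \<omega> * (w (grid T N (Suc j)) \<omega> - w (grid T N j) \<omega>)"
      by (simp add: min_absorb2)
  qed
  finally show ?thesis by simp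
qed

section \<open>Switched-off grid sums against the stochastic integral\<close>

context wiener_process begin

lemma simple_integral_measurable:
  assumes sp: "simple_process M F n \<tau> \<xi>" and t: "0 \<le> t"
  shows "simple_integral W n \<tau> \<xi> t \<in> borel_measurable M"
proof -
  note \<tau> = simple_process_nonneg[OF sp]
  have [measurable]: "\<xi> i \<in> borel_measurable M" if "i < n" for i
    by (rule F_measurable[OF \<tau>, of i]) (use sp that in \<open>auto simp: simple_process_def\<close>)
  have WM: "W s \<in> borel_measurable M" if "0 \<le> s" for s
    using F_measurable[OF that W_F_measurable[OF that order_refl]] .
  have [measurable]: "W (min t (\<tau> i)) \<in> borel_measurable M" if "i \<le> n" for i using WM \<tau>[OF that] t by simp
  show ?thesis unfolding simple_integral_def by measurable
qed

text \<open>On the common refinement of the grid and the nodes \<tau> the difference is one discrete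
  integral, whose weight is the indicator of \<open>B j\<close> times
  \<open>H (grid T N j) - v\<close>. Its energy is at most \<open>2 * grid_error + 2 * R\<close>
  whatever the events are, so \<open>simple_integral_tail\<close> gives a bound free of
  \<open>B\<close>.\<close>

lemma stopped_grid_sum_tail:
  fixes H :: "real \<Rightarrow> 'a \<Rightarrow> real"
  assumes T: "0 < T" and N: "0 < N"
    and H: "\<And>t. 0 \<le> t \<Longrightarrow> H t \<in> borel_measurable (F t)"
    and cont: "\<And>\<omega>. \<omega> \<in> space M \<Longrightarrow> continuous_on {0..} (\<lambda>t. H t \<omega>)"
    and sp: "simple_process M F n \<tau> \<xi>"
    and B: "\<And>j. j < N \<Longrightarrow> B j \<in> sets (F (grid T N j))" and \<epsilon>: "0 < \<epsilon>" and \<delta>: "0 < \<delta>"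
  defines "R \<equiv> \<lambda>\<omega>. \<integral>\<^sup>+s\<in>{0..T}. ennreal ((simple_value n \<tau> \<xi> s \<omega> - H s \<omega>)\<^sup>2) \<partial>lborel"
    and "S \<equiv> simple_integral W n \<tau> \<xi>"
  assumes Rm: "R \<in> borel_measurable M"
  shows "prob {\<omega>\<in>space M. \<epsilon> < \<bar>\<Sum>j<N. indicator (B j) \<omega> *
      (H (grid T N j) \<omega> * (W (grid T N (Suc j)) \<omega> - W (grid T N j) \<omega>)
        - (S (grid T N (Suc j)) \<omega> - S (grid T N j) \<omega>))\<bar>}
    \<le> prob {\<omega>\<in>space M. ennreal (\<delta> / 4) < grid_error H T N \<omega>} + prob {\<omega>\<in>space M. ennreal (\<delta> / 4) < R \<omega>}
      + \<delta> / \<epsilon>\<^sup>2"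
proof -
  have \<tau>0: "0 \<le> \<tau> 0" and \<tau>m: "\<And>i. i < n \<Longrightarrow> \<tau> i \<le> \<tau> (Suc i)" and \<xi>: "\<And>i. i < n \<Longrightarrow> \<xi> i \<in> borel_measurable (F (\<tau> i))"
    using sp by (auto simp: simple_process_def)
  let ?t = "grid T N"
  \<comment> \<open>Nodes outside \<open>{0..T}\<close> are dropped: every refined cell lies inside,
    so they cannot cut one.\<close>
  define P where "P = ?t ` {..N} \<union> (\<tau> ` {..n} \<inter> {0..T})"
  have P: "finite P" "P \<subseteq> {0..T}"
    using grid_nonneg[OF T, of N] grid_le[OF T N] by (auto simp: P_def)
  have "?t 0 \<in> P" "?t N \<in> P" by (auto simp: P_def)
  then have P': "0 \<in> P" "T \<in> P" by (simp_all add: grid_0 grid_N[OF N])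
  obtain p m where p: "p 0 = 0" "p m = T" and pl: "\<And>l. l < m \<Longrightarrow> p l < p (Suc l)"
    and gap: "\<And>l r. l < m \<Longrightarrow> r \<in> P \<Longrightarrow> \<not> (p l < r \<and> r < p (Suc l))" and pT: "\<And>l. l \<le> m \<Longrightarrow> p l \<in> {0..T}"
    using finite_partition[OF P(1) P' P(2)] by blast
  have gapg: "\<not> (p l < ?t i \<and> ?t i < p (Suc l))" if "l < m" "i \<le> N" for l i
    using gap[OF that(1), of "?t i"] that(2) by (auto simp: P_def)
  have gap\<tau>: "\<not> (p l < \<tau> i \<and> \<tau> i < p (Suc l))" if "l < m" "i \<le> n" for l i
    using gap[OF that(1), of "\<tau> i"] that(2) pT[of l] pT[of "Suc l"] that(1) by (auto simp: P_def)
  have tm: "?t j \<le> ?t (Suc j)" for j using grid_less_Suc[OF T N] less_imp_le by blast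
  \<comment> \<open>The indicators form a step process \<alpha> of their own, constant on each grid
    cell, because \<open>v\<close> may change its value inside such a cell.\<close>
  define h where "h = simple_value N ?t (\<lambda>j \<omega>. indicator (B j) \<omega> * H (?t j) \<omega>)"
  define \<alpha> where "\<alpha> = simple_value N ?t (\<lambda>j \<omega>. indicator (B j) \<omega>)"
  define v where "v = simple_value n \<tau> \<xi>"
  define D where "D = (\<lambda>r \<omega>. h r \<omega> - \<alpha> r \<omega> * v r \<omega>)"
  have Dm: "D (p (Suc l)) \<in> borel_measurable (F (p l))" if l: "l < m" for l
  proof -
    have "h (p (Suc l)) \<in> borel_measurable (F (p l))"
      unfolding h_def
      by (rule simple_value_measurable[where \<tau>="?t" and n=N, OF _ tm gapg[OF l] pl[OF l]])
        (use H[OF grid_nonneg[OF T]] B in \<open>auto simp: grid_0\<close>)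
    moreover have "\<alpha> (p (Suc l)) \<in> borel_measurable (F (p l))"
      unfolding \<alpha>_def
      by (rule simple_value_measurable[where \<tau>="?t" and n=N, OF _ tm gapg[OF l] pl[OF l]]) (use B in \<open>auto simp: grid_0\<close>)
    moreover have "v (p (Suc l)) \<in> borel_measurable (F (p l))"
      unfolding v_def by (rule simple_value_measurable[OF \<tau>0 \<tau>m gap\<tau>[OF l] pl[OF l] \<xi>])
    ultimately show ?thesis unfolding D_def by measurable
  qed
  have sum_eq: "(\<Sum>l<m. D (p (Suc l)) \<omega> * (W (p (Suc l)) \<omega> - W (p l) \<omega>))
    = (\<Sum>j<N. indicator (B j) \<omega> * (H (?t j) \<omega> * (W (?t (Suc j)) \<omega> - W (?t j) \<omega>) - (S (?t (Suc j)) \<omega> - S (?t j) \<omega>)))" for \<omega>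
  proof -
    have "(\<Sum>l<m. D (p (Suc l)) \<omega> * (W (p (Suc l)) \<omega> - W (p l) \<omega>))
      = (\<Sum>l<m. h (p (Suc l)) \<omega> * (W (p (Suc l)) \<omega> - W (p l) \<omega>))
       - (\<Sum>l<m. \<alpha> (p (Suc l)) \<omega> * (v (p (Suc l)) \<omega> * (W (p (Suc l)) \<omega> - W (p l) \<omega>)))"
      by (simp add: D_def sum_subtractf[symmetric] algebra_simps)
    also have "(\<Sum>l<m. \<alpha> (p (Suc l)) \<omega> * (v (p (Suc l)) \<omega> * (W (p (Suc l)) \<omega> - W (p l) \<omega>)))
      = (\<Sum>l<m. \<alpha> (p (Suc l)) \<omega> * (S (p (Suc l)) \<omega> - S (p l) \<omega>))"
      unfolding v_def S_def
      by (intro sum.cong refl, subst simple_integral_cell[where \<tau>=\<tau> and n=n, OF \<tau>m gap\<tau> pl]) auto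
    also have "\<dots> = (\<Sum>j<N. indicator (B j) \<omega> * (S (?t (Suc j)) \<omega> - S (?t j) \<omega>))"
      unfolding \<alpha>_def by (rule simple_integral_partition[OF T N p pl gapg])
    also have "(\<Sum>l<m. h (p (Suc l)) \<omega> * (W (p (Suc l)) \<omega> - W (p l) \<omega>))
      = (\<Sum>j<N. indicator (B j) \<omega> * H (?t j) \<omega> * (W (?t (Suc j)) \<omega> - W (?t j) \<omega>))"
      unfolding h_def by (rule simple_integral_partition[OF T N p pl gapg])
    finally show ?thesis by (simp add: sum_subtractf[symmetric] algebra_simps)
  qed
  have ind: "(\<Sum>l<k. indicator {p l<..p (Suc l)} r) = (indicator {p 0<..p k} r :: ennreal)" if "k \<le> m" for k r
    using that
  proof (induction k)
    case (Suc k)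
    have "p 0 \<le> p k" using pT[of k] p Suc by simp
    then show ?case using Suc pl[of k] by (auto simp: indicator_def)
  qed simp
  \<comment> \<open>\<open>D\<close> is constant on each refined cell and the cells tile
    \<open>{0<..T}\<close>, so the sum is the time integral of \<open>D^2\<close>. Dropping the
    indicator and inserting \<open>H\<close> between the two step processes produces the factors
    2.\<close>
  have Dsq: "ennreal (\<Sum>l<m. (D (p (Suc l)) \<omega>)\<^sup>2 * (p (Suc l) - p l)) \<le> 2 * grid_error H T N \<omega> + 2 * R \<omega>"
    if \<omega>: "\<omega> \<in> space M" for \<omega>
  proof -
    define H' where "H' = (\<lambda>s. H (max 0 s) \<omega>)"
    have "continuous_on UNIV H'" unfolding H'_def
      by (rule continuous_on_compose2[OF cont[OF \<omega>]]) (auto intro!: continuous_intros)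
    then have [measurable]: "H' \<in> borel_measurable borel" by (rule borel_measurable_continuous_onI)
    define hH where "hH = (\<lambda>s. simple_value N ?t (\<lambda>j. H (?t j)) s \<omega>)"
    have [measurable]: "hH \<in> borel_measurable borel" "(\<lambda>s. v s \<omega>) \<in> borel_measurable borel"
      unfolding hH_def v_def simple_value_def by measurable
    have "ennreal (\<Sum>l<m. (D (p (Suc l)) \<omega>)\<^sup>2 * (p (Suc l) - p l))
      = (\<Sum>l<m. ennreal ((D (p (Suc l)) \<omega>)\<^sup>2) * ennreal (p (Suc l) - p l))"
      using pl by (subst sum_ennreal[symmetric]) (auto intro!: sum.cong mult_nonneg_nonneg simp: ennreal_mult less_imp_le)
    also have "\<dots> = (\<integral>\<^sup>+r. (\<Sum>l<m. ennreal ((D (p (Suc l)) \<omega>)\<^sup>2) * indicator {p l<..p (Suc l)} r) \<partial>lborel)"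
      using pl by (subst nn_integral_sum) (auto intro!: sum.cong simp: nn_integral_cmult_indicator less_imp_le)
    also have "\<dots> = (\<integral>\<^sup>+r. ennreal ((D r \<omega>)\<^sup>2) * indicator {0<..T} r \<partial>lborel)"
    proof (rule nn_integral_cong)
      fix r :: real
      have "(\<Sum>l<m. ennreal ((D (p (Suc l)) \<omega>)\<^sup>2) * indicator {p l<..p (Suc l)} r)
        = (\<Sum>l<m. ennreal ((D r \<omega>)\<^sup>2) * indicator {p l<..p (Suc l)} r)"
      proof (intro sum.cong refl)
        fix l assume l: "l \<in> {..<m}"
        have "D r \<omega> = D (p (Suc l)) \<omega>" if r: "r \<in> {p l<..p (Suc l)}"
        proof -
          have "simple_value N ?t \<zeta> r \<omega> = simple_value N ?t \<zeta> (p (Suc l)) \<omega>" for \<zeta> :: "nat \<Rightarrow> 'a \<Rightarrow> real"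
            by (rule simple_value_cell[where u="p l" and \<tau>="?t" and n=N, OF gapg]) (use r l in auto)
          moreover have "v r \<omega> = v (p (Suc l)) \<omega>"
            unfolding v_def by (rule simple_value_cell[where u="p l" and \<tau>=\<tau> and n=n, OF gap\<tau>]) (use r l in auto)
          ultimately show ?thesis by (simp add: D_def h_def \<alpha>_def)
        qed
        then show "ennreal ((D (p (Suc l)) \<omega>)\<^sup>2) * indicator {p l<..p (Suc l)} r
          = ennreal ((D r \<omega>)\<^sup>2) * indicator {p l<..p (Suc l)} r" by (auto simp: indicator_def)
      qed
      then show "(\<Sum>l<m. ennreal ((D (p (Suc l)) \<omega>)\<^sup>2) * indicator {p l<..p (Suc l)} r)
        = ennreal ((D r \<omega>)\<^sup>2) * indicator {0<..T} r"
        using ind[OF order_refl, of r] p by (simp add: sum_distrib_left[symmetric])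
    qed
    also have "\<dots> \<le> (\<integral>\<^sup>+r. 2 * (ennreal ((hH r - H' r)\<^sup>2) * indicator {0..T} r) + 2 * (ennreal ((v r \<omega> - H' r)\<^sup>2) * indicator {0..T} r) \<partial>lborel)"
    proof (rule nn_integral_mono)
      fix r :: real
      show "ennreal ((D r \<omega>)\<^sup>2) * indicator {0<..T} r
        \<le> 2 * (ennreal ((hH r - H' r)\<^sup>2) * indicator {0..T} r) + 2 * (ennreal ((v r \<omega> - H' r)\<^sup>2) * indicator {0..T} r)"
      proof (cases "r \<in> {0<..T}")
        case True
        then have "0 < r" "r \<le> T" by auto
        then obtain j where "j < N" "?t j < r" "r \<le> ?t (Suc j)"
          and j: "\<And>(\<xi> :: nat \<Rightarrow> 'a \<Rightarrow> real) \<omega>. simple_value N ?t \<xi> r \<omega> = \<xi> j \<omega>"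
          by (rule grid_cell[OF T N]) blast
        have "D r \<omega> = indicator (B j) \<omega> * (hH r - v r \<omega>)"
          unfolding D_def h_def \<alpha>_def hH_def j by (simp add: algebra_simps)
        then have "(D r \<omega>)\<^sup>2 \<le> (hH r - v r \<omega>)\<^sup>2" by (simp add: indicator_def)
        also have "\<dots> \<le> 2 * (hH r - H' r)\<^sup>2 + 2 * (v r \<omega> - H' r)\<^sup>2"
          using zero_le_power2[of "(hH r - H' r) + (v r \<omega> - H' r)"] by (simp add: power2_eq_square algebra_simps)
        finally have "ennreal ((D r \<omega>)\<^sup>2) \<le> ennreal (2 * (hH r - H' r)\<^sup>2 + 2 * (v r \<omega> - H' r)\<^sup>2)" by (rule ennreal_leI)
        also have "\<dots> = 2 * ennreal ((hH r - H' r)\<^sup>2) + 2 * ennreal ((v r \<omega> - H' r)\<^sup>2)"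
          by (simp add: ennreal_plus ennreal_mult)
        finally show ?thesis using True by simp
      qed simp
    qed
    also have "\<dots> = 2 * (\<integral>\<^sup>+r. ennreal ((hH r - H' r)\<^sup>2) * indicator {0..T} r \<partial>lborel)
       + 2 * (\<integral>\<^sup>+r. ennreal ((v r \<omega> - H' r)\<^sup>2) * indicator {0..T} r \<partial>lborel)"
      by (subst nn_integral_add) (auto simp: nn_integral_cmult)
    also have "(\<integral>\<^sup>+r. ennreal ((hH r - H' r)\<^sup>2) * indicator {0..T} r \<partial>lborel) = grid_error H T N \<omega>"
      unfolding grid_error_def hH_def H'_def by (intro nn_integral_cong) (auto simp: indicator_def max_def)
    also have "(\<integral>\<^sup>+r. ennreal ((v r \<omega> - H' r)\<^sup>2) * indicator {0..T} r \<partial>lborel) = R \<omega>"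
      unfolding R_def v_def H'_def by (intro nn_integral_cong) (auto simp: indicator_def max_def)
    finally show ?thesis .
  qed
  have [measurable]: "R \<in> borel_measurable M" by (rule Rm)
  have [measurable]: "grid_error H T N \<in> borel_measurable M"
    by (rule grid_error_measurable[OF F_measurable[OF _ H] cont T])
  have p0: "0 \<le> p 0" using p by simp
  have "prob {\<omega>\<in>space M. \<epsilon> < \<bar>\<Sum>l<m. D (p (Suc l)) \<omega> * (W (p (Suc l)) \<omega> - W (p l) \<omega>)\<bar>}
    \<le> prob {\<omega>\<in>space M. \<delta> < (\<Sum>l<m. (D (p (Suc l)) \<omega>)\<^sup>2 * (p (Suc l) - p l))} + \<delta> / \<epsilon>\<^sup>2"
    by (rule simple_integral_tail[where D="\<lambda>l. D (p (Suc l))", OF p0 pl Dm \<epsilon> \<delta>])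
  \<comment> \<open>With thresholds \<delta>/4 the two doubled errors add up to at most \<delta>, so
    exceeding \<delta> forces one of the two events.\<close>
  also have "prob {\<omega>\<in>space M. \<delta> < (\<Sum>l<m. (D (p (Suc l)) \<omega>)\<^sup>2 * (p (Suc l) - p l))}
    \<le> prob ({\<omega>\<in>space M. ennreal (\<delta> / 4) < grid_error H T N \<omega>} \<union> {\<omega>\<in>space M. ennreal (\<delta> / 4) < R \<omega>})"
  proof (rule finite_measure_mono)
    show "{\<omega>\<in>space M. \<delta> < (\<Sum>l<m. (D (p (Suc l)) \<omega>)\<^sup>2 * (p (Suc l) - p l))}
      \<subseteq> {\<omega>\<in>space M. ennreal (\<delta> / 4) < grid_error H T N \<omega>} \<union> {\<omega>\<in>space M. ennreal (\<delta> / 4) < R \<omega>}"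
    proof (rule subsetI, rule ccontr)
      fix \<omega> assume 1: "\<omega> \<in> {\<omega>\<in>space M. \<delta> < (\<Sum>l<m. (D (p (Suc l)) \<omega>)\<^sup>2 * (p (Suc l) - p l))}"
        and 2: "\<omega> \<notin> {\<omega>\<in>space M. ennreal (\<delta> / 4) < grid_error H T N \<omega>} \<union> {\<omega>\<in>space M. ennreal (\<delta> / 4) < R \<omega>}"
      then have "grid_error H T N \<omega> \<le> ennreal (\<delta> / 4)" "R \<omega> \<le> ennreal (\<delta> / 4)" by auto
      then have "2 * grid_error H T N \<omega> + 2 * R \<omega> \<le> 2 * ennreal (\<delta> / 4) + 2 * ennreal (\<delta> / 4)"
        by (intro add_mono mult_left_mono) auto
      also have "2 * ennreal (\<delta> / 4) = ennreal (\<delta> / 2)"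
        using \<delta> by (subst ennreal_numeral[symmetric], subst ennreal_mult[symmetric]) auto
      also have "ennreal (\<delta> / 2) + ennreal (\<delta> / 2) = ennreal \<delta>" using \<delta> by (subst ennreal_plus[symmetric]) auto
      finally have "ennreal (\<Sum>l<m. (D (p (Suc l)) \<omega>)\<^sup>2 * (p (Suc l) - p l)) \<le> ennreal \<delta>"
        using Dsq[of \<omega>] 1 by simp
      then show False using 1 \<delta> by (simp add: ennreal_le_iff)
    qed
  qed measurable
  also have "\<dots> \<le> prob {\<omega>\<in>space M. ennreal (\<delta> / 4) < grid_error H T N \<omega>} + prob {\<omega>\<in>space M. ennreal (\<delta> / 4) < R \<omega>}"
    by (rule measure_Un_le) measurable
  finally show ?thesis unfolding sum_eq by simp
qed

end

context wiener_process begin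

text \<open>For fixed N only N + 1 times occur. At each of them the simple integrals converge in
  probability to \<open>I\<close>, and the exceedance probability of \<open>R k\<close> vanishes as
  well, so letting k tend to infinity leaves only the grid error.\<close>

lemma ito_grid_sum_tail:
  fixes H :: "real \<Rightarrow> 'a \<Rightarrow> real"
  assumes T: "0 < T" and N: "0 < N"
    and H: "\<And>t. 0 \<le> t \<Longrightarrow> H t \<in> borel_measurable (F t)"
    and cont: "\<And>\<omega>. \<omega> \<in> space M \<Longrightarrow> continuous_on {0..} (\<lambda>t. H t \<omega>)"
    and ito: "is_ito_integral M F W H I"
    and B: "\<And>j. j < N \<Longrightarrow> B j \<in> sets (F (grid T N j))" and \<epsilon>: "0 < \<epsilon>" and \<delta>: "0 < \<delta>"
  shows "prob {\<omega>\<in>space M. 2 * \<epsilon> < \<bar>\<Sum>j<N. indicator (B j) \<omega> *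
      (H (grid T N j) \<omega> * (W (grid T N (Suc j)) \<omega> - W (grid T N j) \<omega>)
        - (I (grid T N (Suc j)) \<omega> - I (grid T N j) \<omega>))\<bar>}
    \<le> prob {\<omega>\<in>space M. ennreal (\<delta> / 4) < grid_error H T N \<omega>} + \<delta> / \<epsilon>\<^sup>2"
proof -
  obtain n \<tau> \<xi> where sp: "\<And>k. simple_process M F (n k) (\<tau> k) (\<xi> k)"
    and v1: "vanishes_in_prob M (\<lambda>k \<omega>.
           \<integral>\<^sup>+s\<in>{0..T}. ennreal ((simple_value (n k) (\<tau> k) (\<xi> k) s \<omega> - H s \<omega>)\<^sup>2) \<partial>lborel)"
    and v2: "\<And>t. 0 \<le> t \<Longrightarrow> vanishes_in_prob M (\<lambda>k \<omega>.
           ennreal \<bar>simple_integral W (n k) (\<tau> k) (\<xi> k) t \<omega> - I t \<omega>\<bar>)"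
    using ito less_imp_le[OF T] unfolding is_ito_integral_def by blast
  let ?t = "grid T N"
  define S where "S = (\<lambda>k. simple_integral W (n k) (\<tau> k) (\<xi> k))"
  define R where "R = (\<lambda>k \<omega>. \<integral>\<^sup>+s\<in>{0..T}. ennreal ((simple_value (n k) (\<tau> k) (\<xi> k) s \<omega> - H s \<omega>)\<^sup>2) \<partial>lborel)"
  define U where "U = (\<lambda>k \<omega>. \<Sum>j<N. indicator (B j) \<omega> *
      (H (?t j) \<omega> * (W (?t (Suc j)) \<omega> - W (?t j) \<omega>) - (S k (?t (Suc j)) \<omega> - S k (?t j) \<omega>)))"
  define Z where "Z = (\<lambda>\<omega>. \<Sum>j<N. indicator (B j) \<omega> *
      (H (?t j) \<omega> * (W (?t (Suc j)) \<omega> - W (?t j) \<omega>) - (I (?t (Suc j)) \<omega> - I (?t j) \<omega>)))"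
  \<comment> \<open>Each of the N summands contains two values of \<open>I\<close>, so an error
    \<rho> at every grid time costs at most \<open>2 * N * \<rho> = \<epsilon>\<close>.\<close>
  define \<rho> where "\<rho> = \<epsilon> / (2 * real N)"
  have \<rho>: "0 < \<rho>" using \<epsilon> N by (simp add: \<rho>_def)
  define e where "e = (\<lambda>k. prob {\<omega>\<in>space M. ennreal (\<delta> / 4) < R k \<omega>}
    + (\<Sum>j\<le>N. prob {\<omega>\<in>space M. ennreal \<rho> < ennreal \<bar>S k (?t j) \<omega> - I (?t j) \<omega>\<bar>}))"
  have Rm[measurable]: "R k \<in> borel_measurable M" for k using v1 by (simp add: vanishes_in_prob_def R_def)
  have Rlim: "(\<lambda>k. prob {\<omega>\<in>space M. ennreal (\<delta> / 4) < R k \<omega>}) \<longlonglongrightarrow> 0"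
    using v1 \<delta> by (simp add: vanishes_in_prob_def R_def)
  have Slim: "(\<lambda>k. prob {\<omega>\<in>space M. ennreal \<rho> < ennreal \<bar>S k (?t j) \<omega> - I (?t j) \<omega>\<bar>}) \<longlonglongrightarrow> 0" for j
    using v2[OF grid_nonneg[OF T, of N j]] \<rho> by (simp add: vanishes_in_prob_def S_def)
  have elim: "e \<longlonglongrightarrow> 0"
  proof -
    have "e \<longlonglongrightarrow> 0 + (\<Sum>j\<le>N. 0)" unfolding e_def by (intro tendsto_add tendsto_sum Rlim Slim)
    then show ?thesis by simp
  qed
  have tn: "0 \<le> ?t j" for j using grid_nonneg[OF T] .
  have [measurable]: "S k (?t j) \<in> borel_measurable M" for k j
    unfolding S_def by (rule simple_integral_measurable[OF sp tn])
  have [measurable]: "H (?t j) \<in> borel_measurable M" for j using F_measurable[OF tn H[OF tn]] .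
  have [measurable]: "W (?t j) \<in> borel_measurable M" for j
    using F_measurable[OF tn W_F_measurable[OF tn order_refl]] .
  have [measurable]: "I (?t j) \<in> borel_measurable M" for j
    using ito F_measurable[OF tn] tn by (auto simp: is_ito_integral_def adapted_def)
  have BM[measurable]: "B j \<in> sets M" if "j < N" for j
    using B[OF that] subalgebra_F[OF tn] by (auto simp: subalgebra_def)
  have [measurable]: "U k \<in> borel_measurable M" "Z \<in> borel_measurable M" for k
    unfolding U_def Z_def by measurable
  have main: "prob {\<omega>\<in>space M. 2 * \<epsilon> < \<bar>Z \<omega>\<bar>}
    \<le> (prob {\<omega>\<in>space M. ennreal (\<delta> / 4) < grid_error H T N \<omega>} + \<delta> / \<epsilon>\<^sup>2) + e k" for k
  proof -
    have tail: "prob {\<omega>\<in>space M. \<epsilon> < \<bar>U k \<omega>\<bar>}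
      \<le> prob {\<omega>\<in>space M. ennreal (\<delta> / 4) < grid_error H T N \<omega>} + prob {\<omega>\<in>space M. ennreal (\<delta> / 4) < R k \<omega>} + \<delta> / \<epsilon>\<^sup>2"
      unfolding U_def S_def R_def
      using stopped_grid_sum_tail[OF T N H cont sp B \<epsilon> \<delta> Rm[unfolded R_def]] by simp
    have diff: "\<bar>Z \<omega> - U k \<omega>\<bar> \<le> \<epsilon>" if "\<And>j. j \<le> N \<Longrightarrow> \<bar>S k (?t j) \<omega> - I (?t j) \<omega>\<bar> \<le> \<rho>" for \<omega>
    proof -
      have "Z \<omega> - U k \<omega> = (\<Sum>j<N. indicator (B j) \<omega> *
        ((S k (?t (Suc j)) \<omega> - I (?t (Suc j)) \<omega>) - (S k (?t j) \<omega> - I (?t j) \<omega>)))"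
        unfolding Z_def U_def sum_subtractf[symmetric] by (intro sum.cong refl) (simp add: algebra_simps)
      also have "\<bar>\<dots>\<bar> \<le> (\<Sum>j<N. 2 * \<rho>)"
      proof (rule order_trans[OF sum_abs], rule sum_mono)
        fix j assume "j \<in> {..<N}"
        then have "\<bar>S k (?t (Suc j)) \<omega> - I (?t (Suc j)) \<omega>\<bar> \<le> \<rho>" "\<bar>S k (?t j) \<omega> - I (?t j) \<omega>\<bar> \<le> \<rho>"
          using that[of j] that[of "Suc j"] by auto
        then show "\<bar>indicator (B j) \<omega> * ((S k (?t (Suc j)) \<omega> - I (?t (Suc j)) \<omega>) - (S k (?t j) \<omega> - I (?t j) \<omega>))\<bar> \<le> 2 * \<rho>"
          using \<rho> by (auto simp: indicator_def abs_mult)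
      qed
      also have "\<dots> = \<epsilon>" using N by (simp add: \<rho>_def)
      finally show ?thesis .
    qed
    have "{\<omega>\<in>space M. 2 * \<epsilon> < \<bar>Z \<omega>\<bar>} \<subseteq> {\<omega>\<in>space M. \<epsilon> < \<bar>U k \<omega>\<bar>} \<union>
       (\<Union>j\<in>{..N}. {\<omega>\<in>space M. ennreal \<rho> < ennreal \<bar>S k (?t j) \<omega> - I (?t j) \<omega>\<bar>})"
    proof (rule subsetI, rule ccontr)
      fix \<omega> assume 1: "\<omega> \<in> {\<omega>\<in>space M. 2 * \<epsilon> < \<bar>Z \<omega>\<bar>}" and 2: "\<omega> \<notin> {\<omega>\<in>space M. \<epsilon> < \<bar>U k \<omega>\<bar>} \<union>
       (\<Union>j\<in>{..N}. {\<omega>\<in>space M. ennreal \<rho> < ennreal \<bar>S k (?t j) \<omega> - I (?t j) \<omega>\<bar>})"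
      then have "\<bar>S k (?t j) \<omega> - I (?t j) \<omega>\<bar> \<le> \<rho>" if "j \<le> N" for j
        using \<rho> that by (auto simp: ennreal_less_iff not_less)
      from diff[OF this] 1 2 show False by auto
    qed
    then have "prob {\<omega>\<in>space M. 2 * \<epsilon> < \<bar>Z \<omega>\<bar>} \<le> prob ({\<omega>\<in>space M. \<epsilon> < \<bar>U k \<omega>\<bar>} \<union>
       (\<Union>j\<in>{..N}. {\<omega>\<in>space M. ennreal \<rho> < ennreal \<bar>S k (?t j) \<omega> - I (?t j) \<omega>\<bar>}))"
      by (rule finite_measure_mono) measurable
    also have "\<dots> \<le> prob {\<omega>\<in>space M. \<epsilon> < \<bar>U k \<omega>\<bar>} +
       prob (\<Union>j\<in>{..N}. {\<omega>\<in>space M. ennreal \<rho> < ennreal \<bar>S k (?t j) \<omega> - I (?t j) \<omega>\<bar>})"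
      by (rule measure_Un_le) measurable
    also have "prob (\<Union>j\<in>{..N}. {\<omega>\<in>space M. ennreal \<rho> < ennreal \<bar>S k (?t j) \<omega> - I (?t j) \<omega>\<bar>})
      \<le> (\<Sum>j\<le>N. prob {\<omega>\<in>space M. ennreal \<rho> < ennreal \<bar>S k (?t j) \<omega> - I (?t j) \<omega>\<bar>})"
      by (rule measure_UNION_le) auto
    finally show ?thesis using tail by (simp add: e_def)
  qed
  have "prob {\<omega>\<in>space M. 2 * \<epsilon> < \<bar>Z \<omega>\<bar>}
    \<le> (prob {\<omega>\<in>space M. ennreal (\<delta> / 4) < grid_error H T N \<omega>} + \<delta> / \<epsilon>\<^sup>2) + 0"
    by (rule LIMSEQ_le_const[OF tendsto_add[OF tendsto_const elim]]) (use main in blast)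
  then show ?thesis by (simp add: Z_def)
qed

text \<open>The quantifier over \<open>B\<close> stands inside the eventuality: one threshold for N
  serves all families of events. \<open>killed_euler_tendsto\<close> relies on this for the sums
  stopped at each \<open>i \<le> N\<close>.\<close>

lemma ito_grid_sum_vanishes:
  fixes H :: "real \<Rightarrow> 'a \<Rightarrow> real"
  assumes T: "0 < T"
    and H: "\<And>t. 0 \<le> t \<Longrightarrow> H t \<in> borel_measurable (F t)"
    and cont: "\<And>\<omega>. \<omega> \<in> space M \<Longrightarrow> continuous_on {0..} (\<lambda>t. H t \<omega>)"
    and ito: "is_ito_integral M F W H I" and \<epsilon>: "0 < \<epsilon>" and \<eta>: "0 < \<eta>"
  shows "\<forall>\<^sub>F N in sequentially. \<forall>B. (\<forall>j<N. B j \<in> sets (F (grid T N j))) \<longrightarrow>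
    prob {\<omega>\<in>space M. \<epsilon> < \<bar>\<Sum>j<N. indicator (B j) \<omega> *
      (H (grid T N j) \<omega> * (W (grid T N (Suc j)) \<omega> - W (grid T N j) \<omega>)
        - (I (grid T N (Suc j)) \<omega> - I (grid T N j) \<omega>))\<bar>} < \<eta>"
proof -
  \<comment> \<open>Chosen so that the Chebyshev term equals \<eta>/2.\<close>
  define \<delta> where "\<delta> = \<eta> / 2 * (\<epsilon> / 2)\<^sup>2"
  have \<delta>: "0 < \<delta>" "\<delta> / (\<epsilon> / 2)\<^sup>2 = \<eta> / 2" using \<epsilon> \<eta> by (auto simp: \<delta>_def)
  have "(\<lambda>N. prob {\<omega>\<in>space M. ennreal (\<delta> / 4) < grid_error H T N \<omega>}) \<longlonglongrightarrow> 0"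
    using \<delta> by (intro prob_tendsto_0 grid_error_measurable[OF F_measurable[OF _ H] cont T] grid_error_tendsto[OF cont T]) auto
  then have "\<forall>\<^sub>F N in sequentially. prob {\<omega>\<in>space M. ennreal (\<delta> / 4) < grid_error H T N \<omega>} < \<eta> / 2"
    using \<eta> by (intro order_tendstoD) auto
  then show ?thesis using eventually_gt_at_top[of 0]
  proof eventually_elim
    case (elim N)
    show ?case
    proof (intro allI impI)
      fix B assume B: "\<forall>j<N. B j \<in> sets (F (grid T N j))"
      have "prob {\<omega>\<in>space M. 2 * (\<epsilon> / 2) < \<bar>\<Sum>j<N. indicator (B j) \<omega> *
        (H (grid T N j) \<omega> * (W (grid T N (Suc j)) \<omega> - W (grid T N j) \<omega>)
          - (I (grid T N (Suc j)) \<omega> - I (grid T N j) \<omega>))\<bar>}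
        \<le> prob {\<omega>\<in>space M. ennreal (\<delta> / 4) < grid_error H T N \<omega>} + \<delta> / (\<epsilon> / 2)\<^sup>2"
        by (rule ito_grid_sum_tail[OF T elim(2) H cont ito _ _ \<delta>(1)]) (use B \<epsilon> in auto)
      then show "prob {\<omega>\<in>space M. \<epsilon> < \<bar>\<Sum>j<N. indicator (B j) \<omega> *
        (H (grid T N j) \<omega> * (W (grid T N (Suc j)) \<omega> - W (grid T N j) \<omega>)
          - (I (grid T N (Suc j)) \<omega> - I (grid T N j) \<omega>))\<bar>} < \<eta>"
        using elim(1) \<delta>(2) by simp
    qed
  qed
qed

end

section \<open>Euler schemes and test functions\<close>

text \<open>The bounds and the uniform continuity of \<open>u2\<close> are global because the Euler
  scheme has Gaussian increments and can land arbitrarily far outside the interval.\<close>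

locale test_function =
  fixes u u1 u2 :: "real \<Rightarrow> real" and C :: real
  assumes deriv: "\<And>y. (u has_real_derivative u1 y) (at y)"
    and deriv1: "\<And>y. (u1 has_real_derivative u2 y) (at y)"
    and u_bound: "\<And>y. \<bar>u y\<bar> \<le> C" and u1_bound: "\<And>y. \<bar>u1 y\<bar> \<le> C" and u2_bound: "\<And>y. \<bar>u2 y\<bar> \<le> C"
    and u2_uniform: "uniformly_continuous_on UNIV u2"
begin

lemma C_nonneg: "0 \<le> C" using u_bound[of 0] by linarith

lemma u_measurable [measurable]:
  "u \<in> borel_measurable borel" "u1 \<in> borel_measurable borel" "u2 \<in> borel_measurable borel"
proof -
  have "continuous_on UNIV u" "continuous_on UNIV u1"
    using deriv deriv1 by (meson DERIV_isCont continuous_at_imp_continuous_on)+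
  then show "u \<in> borel_measurable borel" "u1 \<in> borel_measurable borel" "u2 \<in> borel_measurable borel"
    using uniformly_continuous_imp_continuous[OF u2_uniform] by (simp_all add: borel_measurable_continuous_onI)
qed

lemma Lipschitz: "\<bar>u y - u z\<bar> \<le> C * \<bar>y - z\<bar>" "\<bar>u1 y - u1 z\<bar> \<le> C * \<bar>y - z\<bar>"
  using field_differentiable_bound[of UNIV u u1 C y z] field_differentiable_bound[of UNIV u1 u2 C y z]
    deriv deriv1 u1_bound u2_bound by (auto simp: has_field_derivative_at_within)

text \<open>For \<open>|d| < \<rho>\<close> the modulus of continuity of \<open>u2\<close> controls
  the remainder. Otherwise the bound \<open>C\<close> is used, and \<open>\<rho> \<le> |d|\<close>
  turns \<open>d^2\<close> into \<open>d^4 / \<rho>^2\<close>, which makes rare large steps cost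
  only order h^2 in expectation.\<close>

lemma taylor_error:
  assumes \<epsilon>: "0 \<le> \<epsilon>" and \<rho>: "0 < \<rho>" and uc: "\<And>y z. \<bar>y - z\<bar> < \<rho> \<Longrightarrow> \<bar>u2 y - u2 z\<bar> \<le> \<epsilon>"
  shows "\<bar>u (y + d) - u y - u1 y * d - u2 y * d\<^sup>2 / 2\<bar> \<le> \<epsilon> * d\<^sup>2 + C / \<rho>\<^sup>2 * d ^ 4"
proof (cases "d = 0")
  case False
  \<comment> \<open>\<open>Taylor\<close> expects a whole sequence of derivatives; an expansion to
    order 2 looks at the entries 0, 1 and 2.\<close>
  define D where "D = (\<lambda>n::nat. if n = 0 then u else if n = 1 then u1 else u2)"
  have "\<exists>t. (if y + d < y then y + d < t \<and> t < y else y < t \<and> t < y + d) \<and>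
    u (y + d) = (\<Sum>m<2. (D m y / fact m) * (y + d - y)^m) + (D 2 t / fact 2) * (y + d - y)^2"
    by (rule Taylor[where a="min y (y + d)" and b="max y (y + d)"])
      (use False deriv deriv1 in \<open>auto simp: D_def less_2_cases_iff\<close>)
  then obtain t where t': "if y + d < y then y + d < t \<and> t < y else y < t \<and> t < y + d"
    and "u (y + d) = (\<Sum>m<2. (D m y / fact m) * (y + d - y)^m) + (D 2 t / fact 2) * (y + d - y)^2" by blast
  then have e: "u (y + d) = u y + u1 y * d + u2 t * d\<^sup>2 / 2"
    by (simp add: D_def numeral_2_eq_2)
  have t: "\<bar>t - y\<bar> \<le> \<bar>d\<bar>" using t' by (auto split: if_splits)
  have eq: "\<bar>u (y + d) - u y - u1 y * d - u2 y * d\<^sup>2 / 2\<bar> = \<bar>u2 t - u2 y\<bar> / 2 * d\<^sup>2"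
  proof -
    have "u (y + d) - u y - u1 y * d - u2 y * d\<^sup>2 / 2 = (u2 t - u2 y) / 2 * d\<^sup>2" unfolding e by (simp add: field_simps)
    then show ?thesis by (simp only: abs_mult abs_divide abs_numeral abs_power2)
  qed
  show ?thesis
  proof (cases "\<bar>d\<bar> < \<rho>")
    case True
    then have "\<bar>u2 t - u2 y\<bar> \<le> \<epsilon>" using uc t by simp
    moreover have "\<bar>u2 t - u2 y\<bar> / 2 \<le> \<bar>u2 t - u2 y\<bar>" by simp
    ultimately have "\<bar>u2 t - u2 y\<bar> / 2 \<le> \<epsilon>" by (blast intro: order_trans)
    then have "\<bar>u2 t - u2 y\<bar> / 2 * d\<^sup>2 \<le> \<epsilon> * d\<^sup>2" by (rule mult_right_mono) simp
    moreover have "0 \<le> C / \<rho>\<^sup>2 * d ^ 4" using C_nonneg by simp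
    ultimately show ?thesis unfolding eq by (rule add_increasing2[rotated])
  next
    case False
    have "\<bar>u2 t - u2 y\<bar> \<le> C + C"
      using abs_triangle_ineq4[of "u2 t" "u2 y"] u2_bound[of t] u2_bound[of y] by (rule order_trans[OF _ add_mono])
    then have "\<bar>u2 t - u2 y\<bar> / 2 \<le> C" by simp
    then have "\<bar>u2 t - u2 y\<bar> / 2 * d\<^sup>2 \<le> C * d\<^sup>2" by (rule mult_right_mono) simp
    also have "\<dots> \<le> C / \<rho>\<^sup>2 * d ^ 4"
    proof -
      have "\<rho>\<^sup>2 \<le> d\<^sup>2" using False \<rho> by (simp add: abs_le_square_iff[symmetric])
      then have "\<rho>\<^sup>2 * d\<^sup>2 \<le> d\<^sup>2 * d\<^sup>2" by (rule mult_right_mono) simp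
      then have "d\<^sup>2 \<le> d ^ 4 / \<rho>\<^sup>2" using \<rho> by (simp add: field_simps power4_eq_xxxx power2_eq_square)
      then have "C * d\<^sup>2 \<le> C * (d ^ 4 / \<rho>\<^sup>2)" using C_nonneg by (rule mult_left_mono)
      then show ?thesis by simp
    qed
    finally have "\<bar>u2 t - u2 y\<bar> / 2 * d\<^sup>2 \<le> C / \<rho>\<^sup>2 * d ^ 4" .
    moreover have "0 \<le> \<epsilon> * d\<^sup>2" using \<epsilon> by simp
    ultimately show ?thesis unfolding eq by (rule add_increasing[rotated])
  qed
qed simp

end

lemma (in prob_space) bounded_integrable:
  fixes g :: "'a \<Rightarrow> real"
  assumes "g \<in> borel_measurable M" "\<And>\<omega>. \<omega> \<in> space M \<Longrightarrow> \<bar>g \<omega>\<bar> \<le> B"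
  shows "integrable M g"
  by (rule integrable_const_bound[where B=B]) (use assms in auto)

lemma (in prob_space) bounded_expectation:
  fixes g :: "'a \<Rightarrow> real"
  assumes "g \<in> borel_measurable M" "\<And>\<omega>. \<omega> \<in> space M \<Longrightarrow> \<bar>g \<omega>\<bar> \<le> B"
  shows "\<bar>expectation g\<bar> \<le> B"
proof -
  have "\<bar>expectation g\<bar> \<le> expectation (\<lambda>\<omega>. \<bar>g \<omega>\<bar>)" by (rule integral_abs_bound)
  also have "\<dots> \<le> expectation (\<lambda>\<omega>. B)"
    using bounded_integrable[OF assms] assms(2) by (intro integral_mono) auto
  finally show ?thesis by (simp add: prob_space)
qed

section \<open>Weak error of the Euler scheme\<close>

locale wiener_test = wiener_process M F W + test_function u u1 u2 C
  for M :: "'a measure" and F W u u1 u2 C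
begin

text \<open>Expand \<open>u (Y + d)\<close> to second order with
  \<open>d = \<beta> h + \<sigma> \<Delta>\<close>. Terms linear in \<Delta> have mean zero and
  \<open>\<Delta>^2\<close> averages to h, which leaves the generator term. The rest is of order
  h^2, from \<open>\<beta>^2 h^2\<close> and the fourth powers, or is h times the modulus
  \<epsilon>.\<close>

lemma euler_step:
  assumes s: "0 \<le> s" and h: "0 < h" "h \<le> 1"
    and Y: "Y \<in> borel_measurable (F s)" and \<beta>: "\<beta> \<in> borel_measurable (F s)" and \<sigma>: "\<sigma> \<in> borel_measurable (F s)"
    and \<beta>K: "\<And>\<omega>. \<omega> \<in> space M \<Longrightarrow> \<bar>\<beta> \<omega>\<bar> \<le> K" and \<sigma>K: "\<And>\<omega>. \<omega> \<in> space M \<Longrightarrow> \<bar>\<sigma> \<omega>\<bar> \<le> K"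
    and \<epsilon>: "0 \<le> \<epsilon>" and \<rho>: "0 < \<rho>" and uc: "\<And>y z. \<bar>y - z\<bar> < \<rho> \<Longrightarrow> \<bar>u2 y - u2 z\<bar> \<le> \<epsilon>"
  shows "\<bar>expectation (\<lambda>\<omega>. u (Y \<omega> + (\<beta> \<omega> * h + \<sigma> \<omega> * (W (s + h) \<omega> - W s \<omega>)))) - expectation (\<lambda>\<omega>. u (Y \<omega>))
     - h * expectation (\<lambda>\<omega>. u1 (Y \<omega>) * \<beta> \<omega> + u2 (Y \<omega>) * (\<sigma> \<omega>)\<^sup>2 / 2)\<bar>
    \<le> h * (4 * \<epsilon> * K\<^sup>2 + h * (32 * C / \<rho>\<^sup>2 * K ^ 4 + C * K\<^sup>2))"
proof -
  have sh: "s < s + h" using h by simp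
  define \<Delta> where "\<Delta> = (\<lambda>\<omega>. W (s + h) \<omega> - W s \<omega>)"
  obtain \<omega>0 where "\<omega>0 \<in> space M" using not_empty by blast
  then have K: "0 \<le> K" using \<beta>K[of \<omega>0] by linarith
  note [measurable] = Y \<beta> \<sigma>
  have [measurable]: "Y \<in> borel_measurable M" "\<beta> \<in> borel_measurable M" "\<sigma> \<in> borel_measurable M"
    using Y \<beta> \<sigma> by (blast intro: F_measurable[OF s])+
  have [measurable]: "\<Delta> \<in> borel_measurable M"
    using W_normal[OF s sh] by (auto simp: distributed_def \<Delta>_def)
  have i\<Delta>: "integrable M (\<lambda>\<omega>. \<Delta> \<omega> ^ k)" for k
    using increment_power_integrable[OF s sh] by (simp add: \<Delta>_def)
  have E2: "expectation (\<lambda>\<omega>. (\<Delta> \<omega>)\<^sup>2) = h" and E4: "expectation (\<lambda>\<omega>. \<Delta> \<omega> ^ 4) = 3 * h\<^sup>2"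
    using increment_expectation_2[OF s sh] increment_expectation_4[OF s sh] by (simp_all add: \<Delta>_def)
  have mult: "integrable M (\<lambda>\<omega>. g \<omega> * \<Delta> \<omega>)" "expectation (\<lambda>\<omega>. g \<omega> * \<Delta> \<omega>) = 0"
     "integrable M (\<lambda>\<omega>. g \<omega> * (\<Delta> \<omega>)\<^sup>2)" "expectation (\<lambda>\<omega>. g \<omega> * (\<Delta> \<omega>)\<^sup>2) = h * expectation g"
     "integrable M g"
    if g: "g \<in> borel_measurable (F s)" and gb: "\<And>\<omega>. \<omega> \<in> space M \<Longrightarrow> \<bar>g \<omega>\<bar> \<le> B" for g B
  proof -
    show gi: "integrable M g" using bounded_integrable[OF F_measurable[OF s g] gb] .
    show "integrable M (\<lambda>\<omega>. g \<omega> * \<Delta> \<omega>)" "expectation (\<lambda>\<omega>. g \<omega> * \<Delta> \<omega>) = 0"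
     "integrable M (\<lambda>\<omega>. g \<omega> * (\<Delta> \<omega>)\<^sup>2)" "expectation (\<lambda>\<omega>. g \<omega> * (\<Delta> \<omega>)\<^sup>2) = h * expectation g"
      using increment_mult_integrable[OF s sh g gi, of 1] increment_mult_integrable[OF s sh g gi, of 2]
        increment_mult_expectation[OF s sh g gi] increment_mult_expectation_2[OF s sh g gi] by (simp_all add: \<Delta>_def)
  qed
  have sq: "(\<beta> \<omega>)\<^sup>2 \<le> K\<^sup>2" "(\<sigma> \<omega>)\<^sup>2 \<le> K\<^sup>2" "\<bar>\<beta> \<omega> * \<sigma> \<omega>\<bar> \<le> K\<^sup>2" if "\<omega> \<in> space M" for \<omega>
    using abs_le_imp_sq_le[OF \<beta>K[OF that]] abs_le_imp_sq_le[OF \<sigma>K[OF that]]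
      mult_mono[OF \<beta>K[OF that] \<sigma>K[OF that]] K by (auto simp: abs_mult power2_eq_square)
  \<comment> \<open>\<open>g1\<close> to \<open>g5\<close> are the coefficients of
    \<open>\<Delta>\<close>, \<open>h \<Delta>\<close>, \<open>\<Delta>^2 / 2\<close>,
    \<open>h^2 / 2\<close> and \<open>h\<close> in the expansion. All are bounded and known at time
    s.\<close>
  define g1 where "g1 = (\<lambda>\<omega>. u1 (Y \<omega>) * \<sigma> \<omega>)"
  define g2 where "g2 = (\<lambda>\<omega>. u2 (Y \<omega>) * (\<beta> \<omega> * \<sigma> \<omega>))"
  define g3 where "g3 = (\<lambda>\<omega>. u2 (Y \<omega>) * (\<sigma> \<omega>)\<^sup>2)"
  define g4 where "g4 = (\<lambda>\<omega>. u2 (Y \<omega>) * (\<beta> \<omega>)\<^sup>2)"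
  define g5 where "g5 = (\<lambda>\<omega>. u1 (Y \<omega>) * \<beta> \<omega>)"
  have gm: "g1 \<in> borel_measurable (F s)" "g2 \<in> borel_measurable (F s)" "g3 \<in> borel_measurable (F s)"
     "g4 \<in> borel_measurable (F s)" "g5 \<in> borel_measurable (F s)"
    unfolding g1_def g2_def g3_def g4_def g5_def by measurable
  have gb: "\<bar>g1 \<omega>\<bar> \<le> C * K" "\<bar>g2 \<omega>\<bar> \<le> C * K\<^sup>2" "\<bar>g3 \<omega>\<bar> \<le> C * K\<^sup>2" "\<bar>g4 \<omega>\<bar> \<le> C * K\<^sup>2" "\<bar>g5 \<omega>\<bar> \<le> C * K"
    if "\<omega> \<in> space M" for \<omega>
  proof -
    have m: "\<bar>v * w\<bar> \<le> C * B" if "\<bar>v\<bar> \<le> C" "\<bar>w\<bar> \<le> B" for v w B :: real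
      unfolding abs_mult using that C_nonneg by (intro mult_mono) auto
    have sq': "\<bar>(\<beta> \<omega>)\<^sup>2\<bar> \<le> K\<^sup>2" "\<bar>(\<sigma> \<omega>)\<^sup>2\<bar> \<le> K\<^sup>2" using sq[OF that] by simp_all
    show "\<bar>g1 \<omega>\<bar> \<le> C * K" "\<bar>g2 \<omega>\<bar> \<le> C * K\<^sup>2" "\<bar>g3 \<omega>\<bar> \<le> C * K\<^sup>2" "\<bar>g4 \<omega>\<bar> \<le> C * K\<^sup>2" "\<bar>g5 \<omega>\<bar> \<le> C * K"
      unfolding g1_def g2_def g3_def g4_def g5_def
      by (rule m[OF u1_bound \<sigma>K[OF that]], rule m[OF u2_bound sq(3)[OF that]], rule m[OF u2_bound sq'(2)],
          rule m[OF u2_bound sq'(1)], rule m[OF u1_bound \<beta>K[OF that]])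
  qed
  note m1 = mult[OF gm(1) gb(1)] and m2 = mult[OF gm(2) gb(2)] and m3 = mult[OF gm(3) gb(3)]
    and m4 = mult[OF gm(4) gb(4)] and m5 = mult[OF gm(5) gb(5)]
  define d where "d = (\<lambda>\<omega>. \<beta> \<omega> * h + \<sigma> \<omega> * \<Delta> \<omega>)"
  define R where "R = (\<lambda>\<omega>. u (Y \<omega> + d \<omega>) - u (Y \<omega>) - u1 (Y \<omega>) * d \<omega> - u2 (Y \<omega>) * (d \<omega>)\<^sup>2 / 2)"
  have [measurable]: "d \<in> borel_measurable M" "R \<in> borel_measurable M" unfolding d_def R_def by measurable
  \<comment> \<open>From \<open>(v + w)^2 \<le> 2 v^2 + 2 w^2\<close>, used once for
    \<open>d^2\<close> and twice for \<open>d^4\<close>. With \<open>h \<le> 1\<close> the constants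
    later become 2 + 2 = 4 and 8 + 3 * 8 = 32, the 3 being the Gaussian fourth moment.\<close>
  define Q where "Q = (\<lambda>\<omega>. \<epsilon> * (2 * K\<^sup>2 * h\<^sup>2 + 2 * K\<^sup>2 * (\<Delta> \<omega>)\<^sup>2) + C / \<rho>\<^sup>2 * (8 * K ^ 4 * h ^ 4 + 8 * K ^ 4 * \<Delta> \<omega> ^ 4))"
  have RQ: "\<bar>R \<omega>\<bar> \<le> Q \<omega>" if \<omega>: "\<omega> \<in> space M" for \<omega>
  proof -
    have "0 \<le> (\<beta> \<omega> * h - \<sigma> \<omega> * \<Delta> \<omega>)\<^sup>2" by simp
    then have "(d \<omega>)\<^sup>2 \<le> 2 * ((\<beta> \<omega>)\<^sup>2 * h\<^sup>2) + 2 * ((\<sigma> \<omega>)\<^sup>2 * (\<Delta> \<omega>)\<^sup>2)"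
      by (simp add: d_def power2_eq_square algebra_simps)
    also have "\<dots> \<le> 2 * (K\<^sup>2 * h\<^sup>2) + 2 * (K\<^sup>2 * (\<Delta> \<omega>)\<^sup>2)"
      using sq[OF \<omega>] by (intro add_mono mult_left_mono mult_right_mono) auto
    finally have d2: "(d \<omega>)\<^sup>2 \<le> 2 * K\<^sup>2 * h\<^sup>2 + 2 * K\<^sup>2 * (\<Delta> \<omega>)\<^sup>2" by simp
    have "d \<omega> ^ 4 = ((d \<omega>)\<^sup>2)\<^sup>2" by simp
    also have "\<dots> \<le> (2 * K\<^sup>2 * h\<^sup>2 + 2 * K\<^sup>2 * (\<Delta> \<omega>)\<^sup>2)\<^sup>2" using d2 by (intro power_mono) auto
    also have "\<dots> \<le> 2 * (2 * K\<^sup>2 * h\<^sup>2)\<^sup>2 + 2 * (2 * K\<^sup>2 * (\<Delta> \<omega>)\<^sup>2)\<^sup>2"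
      using zero_le_power2[of "2 * K\<^sup>2 * h\<^sup>2 - 2 * K\<^sup>2 * (\<Delta> \<omega>)\<^sup>2"] by (simp add: power2_eq_square algebra_simps)
    also have "\<dots> = 8 * K ^ 4 * h ^ 4 + 8 * K ^ 4 * \<Delta> \<omega> ^ 4" by (simp add: power_mult_distrib)
    finally have d4: "d \<omega> ^ 4 \<le> 8 * K ^ 4 * h ^ 4 + 8 * K ^ 4 * \<Delta> \<omega> ^ 4" .
    have "\<bar>R \<omega>\<bar> \<le> \<epsilon> * (d \<omega>)\<^sup>2 + C / \<rho>\<^sup>2 * d \<omega> ^ 4" unfolding R_def by (rule taylor_error[OF \<epsilon> \<rho> uc])
    also have "\<dots> \<le> Q \<omega>" unfolding Q_def using d2 d4 \<epsilon> C_nonneg by (intro add_mono mult_left_mono) auto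
    finally show ?thesis .
  qed
  have iQ: "integrable M Q" unfolding Q_def using i\<Delta> by auto
  have EQ: "expectation Q = \<epsilon> * (2 * K\<^sup>2 * h\<^sup>2 + 2 * K\<^sup>2 * h) + C / \<rho>\<^sup>2 * (8 * K ^ 4 * h ^ 4 + 8 * K ^ 4 * (3 * h\<^sup>2))"
    unfolding Q_def using i\<Delta>[of 2] i\<Delta>[of 4] E2 E4 by (simp add: prob_space)
  have iR: "integrable M R"
    by (rule Bochner_Integration.integrable_bound[OF iQ]) (use RQ in \<open>auto intro!: AE_I2 intro: order_trans[OF _ abs_ge_self]\<close>)
  have "\<bar>expectation R\<bar> \<le> expectation (\<lambda>\<omega>. \<bar>R \<omega>\<bar>)" by (rule integral_abs_bound)
  also have "\<dots> \<le> expectation Q" using iR iQ RQ by (intro integral_mono) auto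
  also have "\<dots> \<le> \<epsilon> * (4 * K\<^sup>2 * h) + C / \<rho>\<^sup>2 * (32 * K ^ 4 * h\<^sup>2)"
  proof -
    have h2: "h\<^sup>2 \<le> h" and h4: "h ^ 4 \<le> h\<^sup>2"
      using h power_decreasing[of 1 2 h] power_decreasing[of 2 4 h] by auto
    have "2 * K\<^sup>2 * h\<^sup>2 \<le> 2 * K\<^sup>2 * h" "8 * K ^ 4 * h ^ 4 \<le> 8 * K ^ 4 * h\<^sup>2"
      using h2 h4 by (auto intro!: mult_left_mono)
    then have "2 * K\<^sup>2 * h\<^sup>2 + 2 * K\<^sup>2 * h \<le> 4 * K\<^sup>2 * h"
      "8 * K ^ 4 * h ^ 4 + 8 * K ^ 4 * (3 * h\<^sup>2) \<le> 32 * K ^ 4 * h\<^sup>2" by linarith+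
    then show ?thesis unfolding EQ using \<epsilon> C_nonneg by (intro add_mono mult_left_mono) auto
  qed
  finally have ER: "\<bar>expectation R\<bar> \<le> \<epsilon> * (4 * K\<^sup>2 * h) + C / \<rho>\<^sup>2 * (32 * K ^ 4 * h\<^sup>2)" .
  have decomp: "u (Y \<omega> + d \<omega>) = u (Y \<omega>) + h * g5 \<omega> + g1 \<omega> * \<Delta> \<omega> + h\<^sup>2 / 2 * g4 \<omega> + h * (g2 \<omega> * \<Delta> \<omega>) + g3 \<omega> * (\<Delta> \<omega>)\<^sup>2 / 2 + R \<omega>" for \<omega>
    unfolding R_def g1_def g2_def g3_def g4_def g5_def d_def by (simp add: power2_eq_square field_simps)
  have iu: "integrable M (\<lambda>\<omega>. u (Y \<omega>))" by (rule bounded_integrable[where B=C]) (auto intro: u_bound)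
  have "expectation (\<lambda>\<omega>. u (Y \<omega> + d \<omega>)) = expectation (\<lambda>\<omega>. u (Y \<omega>)) + h * expectation g5 + h\<^sup>2 / 2 * expectation g4 + h * expectation g3 / 2 + expectation R"
    unfolding decomp using iu iR m1 m2 m3 m4 m5 by simp
  moreover have "h * expectation (\<lambda>\<omega>. u1 (Y \<omega>) * \<beta> \<omega> + u2 (Y \<omega>) * (\<sigma> \<omega>)\<^sup>2 / 2) = h * expectation g5 + h * expectation g3 / 2"
    using m5(5) m3(5) unfolding g5_def g3_def by (simp add: algebra_simps)
  moreover have "\<bar>h\<^sup>2 / 2 * expectation g4\<bar> \<le> h\<^sup>2 * (C * K\<^sup>2)"
  proof -
    have "\<bar>expectation g4\<bar> \<le> C * K\<^sup>2" by (rule bounded_expectation[OF F_measurable[OF s gm(4)] gb(4)])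
    then have "h\<^sup>2 * \<bar>expectation g4\<bar> \<le> h\<^sup>2 * (C * K\<^sup>2)" by (rule mult_left_mono) simp
    moreover have "\<bar>h\<^sup>2 / 2 * expectation g4\<bar> \<le> h\<^sup>2 * \<bar>expectation g4\<bar>"
      by (simp add: abs_mult mult_right_mono)
    ultimately show ?thesis by (rule order_trans[rotated])
  qed
  ultimately have "\<bar>expectation (\<lambda>\<omega>. u (Y \<omega> + d \<omega>)) - expectation (\<lambda>\<omega>. u (Y \<omega>))
     - h * expectation (\<lambda>\<omega>. u1 (Y \<omega>) * \<beta> \<omega> + u2 (Y \<omega>) * (\<sigma> \<omega>)\<^sup>2 / 2)\<bar>
    \<le> h\<^sup>2 * (C * K\<^sup>2) + (\<epsilon> * (4 * K\<^sup>2 * h) + C / \<rho>\<^sup>2 * (32 * K ^ 4 * h\<^sup>2))" using ER by linarith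
  also have "\<dots> = h * (4 * \<epsilon> * K\<^sup>2 + h * (32 * C / \<rho>\<^sup>2 * K ^ 4 + C * K\<^sup>2))"
    by (simp add: power2_eq_square algebra_simps)
  finally show ?thesis unfolding d_def \<Delta>_def .
qed

text \<open>The one-step errors carry a factor h, so N of them add up to T times a quantity that is
  small with \<epsilon> and h. The condition \<open>T \<le> real N\<close> says
  \<open>h \<le> 1\<close>.\<close>

lemma euler_sum:
  fixes x :: real
  assumes T: "0 < T" and N: "0 < N" "T \<le> real N"
    and \<beta>: "\<And>j. j < N \<Longrightarrow> \<beta> j \<in> borel_measurable (F (grid T N j))"
    and \<sigma>: "\<And>j. j < N \<Longrightarrow> \<sigma> j \<in> borel_measurable (F (grid T N j))"
    and \<beta>K: "\<And>j \<omega>. j < N \<Longrightarrow> \<omega> \<in> space M \<Longrightarrow> \<bar>\<beta> j \<omega>\<bar> \<le> K"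
    and \<sigma>K: "\<And>j \<omega>. j < N \<Longrightarrow> \<omega> \<in> space M \<Longrightarrow> \<bar>\<sigma> j \<omega>\<bar> \<le> K"
    and \<epsilon>: "0 \<le> \<epsilon>" and \<rho>: "0 < \<rho>" and uc: "\<And>y z. \<bar>y - z\<bar> < \<rho> \<Longrightarrow> \<bar>u2 y - u2 z\<bar> \<le> \<epsilon>"
  defines "h \<equiv> T / real N"
  defines "Y \<equiv> \<lambda>i \<omega>. x + (\<Sum>j<i. \<beta> j \<omega> * h + \<sigma> j \<omega> * (W (grid T N (Suc j)) \<omega> - W (grid T N j) \<omega>))"
  shows "\<bar>expectation (\<lambda>\<omega>. u (Y N \<omega>)) - u x - (\<Sum>i<N. h * expectation (\<lambda>\<omega>. u1 (Y i \<omega>) * \<beta> i \<omega> + u2 (Y i \<omega>) * (\<sigma> i \<omega>)\<^sup>2 / 2))\<bar>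
    \<le> T * (4 * \<epsilon> * K\<^sup>2 + h * (32 * C / \<rho>\<^sup>2 * K ^ 4 + C * K\<^sup>2))"
    and "i \<le> N \<Longrightarrow> Y i \<in> borel_measurable (F (grid T N i))"
proof -
  have h: "0 < h" "h \<le> 1" using T N by (auto simp: h_def)
  have Ym: "Y i \<in> borel_measurable (F (grid T N i))" if "i \<le> N" for i
    unfolding Y_def
  proof (intro borel_measurable_add borel_measurable_const borel_measurable_sum)
    fix j assume "j \<in> {..<i}"
    then have j: "j < N" "Suc j \<le> i" using that by auto
    have t: "0 \<le> grid T N j" "grid T N j \<le> grid T N i" "0 \<le> grid T N (Suc j)" "grid T N (Suc j) \<le> grid T N i"
      using grid_nonneg[OF T] grid_mono[OF T] j by auto
    have [measurable]: "\<beta> j \<in> borel_measurable (F (grid T N i))" "\<sigma> j \<in> borel_measurable (F (grid T N i))"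
      using F_measurable_mono[OF t(1,2) \<beta>] F_measurable_mono[OF t(1,2) \<sigma>] j by auto
    have [measurable]: "W (grid T N j) \<in> borel_measurable (F (grid T N i))" "W (grid T N (Suc j)) \<in> borel_measurable (F (grid T N i))"
      using W_F_measurable t by auto
    show "(\<lambda>\<omega>. \<beta> j \<omega> * h) \<in> borel_measurable (F (grid T N i))"
      "(\<lambda>\<omega>. \<sigma> j \<omega> * (W (grid T N (Suc j)) \<omega> - W (grid T N j) \<omega>)) \<in> borel_measurable (F (grid T N i))"
      by measurable
  qed
  then show "i \<le> N \<Longrightarrow> Y i \<in> borel_measurable (F (grid T N i))" .
  define G where "G = (\<lambda>i. h * expectation (\<lambda>\<omega>. u1 (Y i \<omega>) * \<beta> i \<omega> + u2 (Y i \<omega>) * (\<sigma> i \<omega>)\<^sup>2 / 2))"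
  define b where "b = 4 * \<epsilon> * K\<^sup>2 + h * (32 * C / \<rho>\<^sup>2 * K ^ 4 + C * K\<^sup>2)"
  have step: "\<bar>expectation (\<lambda>\<omega>. u (Y (Suc i) \<omega>)) - expectation (\<lambda>\<omega>. u (Y i \<omega>)) - G i\<bar> \<le> h * b" if i: "i < N" for i
  proof -
    have "Y (Suc i) = (\<lambda>\<omega>. Y i \<omega> + (\<beta> i \<omega> * h + \<sigma> i \<omega> * (W (grid T N i + h) \<omega> - W (grid T N i) \<omega>)))"
      by (simp add: Y_def grid_Suc h_def fun_eq_iff)
    then show ?thesis
      unfolding G_def b_def
      using euler_step[OF grid_nonneg[OF T] h Ym \<beta> \<sigma> \<beta>K \<sigma>K \<epsilon> \<rho> uc, of i] i by simp
  qed
  have "expectation (\<lambda>\<omega>. u (Y N \<omega>)) - u x - (\<Sum>i<N. G i)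
    = (\<Sum>i<N. expectation (\<lambda>\<omega>. u (Y (Suc i) \<omega>)) - expectation (\<lambda>\<omega>. u (Y i \<omega>)) - G i)"
  proof -
    have "Y 0 = (\<lambda>_. x)" by (simp add: Y_def)
    then have "expectation (\<lambda>\<omega>. u (Y 0 \<omega>)) = u x" by (simp add: prob_space)
    then show ?thesis
      using sum_lessThan_telescope[of "\<lambda>i. expectation (\<lambda>\<omega>. u (Y i \<omega>))" N] by (simp add: sum_subtractf)
  qed
  also have "\<bar>\<dots>\<bar> \<le> (\<Sum>i<N. h * b)"
    by (rule order_trans[OF sum_abs sum_mono]) (use step in auto)
  also have "\<dots> = T * b" using N by (simp add: h_def)
  finally show "\<bar>expectation (\<lambda>\<omega>. u (Y N \<omega>)) - u x - (\<Sum>i<N. h * expectation (\<lambda>\<omega>. u1 (Y i \<omega>) * \<beta> i \<omega> + u2 (Y i \<omega>) * (\<sigma> i \<omega>)\<^sup>2 / 2))\<bar>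
    \<le> T * (4 * \<epsilon> * K\<^sup>2 + h * (32 * C / \<rho>\<^sup>2 * K ^ 4 + C * K\<^sup>2))"
    unfolding G_def b_def .
qed

end

section \<open>Diffusions killed on leaving an interval\<close>

text \<open>\<open>P\<close> is a survival predicate: once false, it stays false. The sums are
  integrals of left-endpoint step functions, which converge at all times except possibly 0 and the
  time of death, and dominated convergence applies.\<close>

lemma riemann_sum_killed:
  fixes P :: "real \<Rightarrow> bool" and \<phi> :: "real \<Rightarrow> real"
  assumes T: "0 < T" and \<phi>: "continuous_on {0..T} \<phi>"
    and P: "\<And>r s. 0 \<le> r \<Longrightarrow> r \<le> s \<Longrightarrow> P s \<Longrightarrow> P r"
  shows "(\<lambda>N. \<Sum>i<N. T / real N * (of_bool (P (grid T N i)) * \<phi> (grid T N i)))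
    \<longlonglongrightarrow> (LBINT s:{0..T}. of_bool (P s) * \<phi> s)"
proof -
  \<comment> \<open>The one-point sample space makes the tools for simple processes available to a
    deterministic function.\<close>
  define s where "s = (\<lambda>N r. simple_value N (grid T N) (\<lambda>j _. of_bool (P (grid T N j)) * \<phi> (grid T N j)) r ())"
  have "compact (\<phi> ` {0..T})" by (intro compact_continuous_image \<phi>) auto
  then obtain B where B: "\<And>r. r \<in> {0..T} \<Longrightarrow> \<bar>\<phi> r\<bar> \<le> B"
    using compact_imp_bounded bounded_iff by (metis imageI real_norm_def)
  have B0: "0 \<le> B" using B[of 0] T by auto
  have [measurable]: "s N \<in> borel_measurable lborel" for N unfolding s_def simple_value_def by measurable
  have [measurable]: "{r \<in> {0..T}. P r} \<in> sets borel"
    using P by (intro real_interval_borel_measurable) (auto simp: is_interval_1)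
  have [measurable]: "(\<lambda>r. indicator {0..T} r * \<phi> r) \<in> borel_measurable borel"
    using borel_measurable_continuous_on_indicator[OF _ \<phi>] by simp
  have eqf: "indicator {0..T} r *\<^sub>R (of_bool (P r) * \<phi> r) = indicator {r \<in> {0..T}. P r} r * (indicator {0..T} r * \<phi> r)" for r
    by (auto simp: indicator_def)
  have int_s: "integral\<^sup>L lborel (s N) = (\<Sum>i<N. T / real N * (of_bool (P (grid T N i)) * \<phi> (grid T N i)))" if N: "0 < N" for N
  proof -
    have le: "grid T N i \<le> grid T N (Suc i)" for i using grid_less_Suc[OF T N] less_imp_le by blast
    have "integral\<^sup>L lborel (s N) = (\<Sum>i<N. (of_bool (P (grid T N i)) * \<phi> (grid T N i)) * (grid T N (Suc i) - grid T N i))"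
      unfolding s_def simple_value_def using le by (subst Bochner_Integration.integral_sum) auto
    then show ?thesis by (simp add: grid_Suc mult.commute)
  qed
  \<comment> \<open>The only dangerous r is one where \<open>P\<close> fails although it held at all
    earlier times: grid points approaching r from below still see \<open>P\<close> true. There is at
    most one such r.\<close>
  have "\<exists>\<tau>. \<forall>r. 0 < r \<and> \<not> P r \<and> (\<forall>q. 0 \<le> q \<longrightarrow> q < r \<longrightarrow> P q) \<longrightarrow> r = \<tau>"
  proof (cases "\<exists>r. 0 < r \<and> \<not> P r \<and> (\<forall>q. 0 \<le> q \<longrightarrow> q < r \<longrightarrow> P q)")
    case True
    then obtain \<tau> where "0 < \<tau>" "\<not> P \<tau>" "\<forall>q. 0 \<le> q \<longrightarrow> q < \<tau> \<longrightarrow> P q" by blast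
    then show ?thesis by (intro exI[of _ \<tau>]) (metis less_imp_le linorder_neqE_linordered_idom)
  qed blast
  then obtain \<tau> where \<tau>: "\<And>r. 0 < r \<Longrightarrow> \<not> P r \<Longrightarrow> r \<noteq> \<tau> \<Longrightarrow> \<exists>q. 0 \<le> q \<and> q < r \<and> \<not> P q" by blast
  have "(\<lambda>N. integral\<^sup>L lborel (s N)) \<longlonglongrightarrow> integral\<^sup>L lborel (\<lambda>r. indicator {0..T} r *\<^sub>R (of_bool (P r) * \<phi> r))"
  proof (rule integral_dominated_convergence[where w="\<lambda>r. B * indicator {0..T} r"])
    show "(\<lambda>r. indicator {0..T} r *\<^sub>R (of_bool (P r) * \<phi> r)) \<in> borel_measurable lborel"
      unfolding eqf by measurable
    show "s N \<in> borel_measurable lborel" for N by measurable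
    show "integrable lborel (\<lambda>r. B * indicator {0..T} r)" using T by (intro integrable_mult_right integrable_real_indicator) auto
    have out: "s N r = 0" if r: "r \<notin> {0<..T}" for N r
    proof (cases "N = 0")
      case False
      have "indicator {grid T N i<..grid T N (Suc i)} r = (0::real)" if "i < N" for i
        using r grid_nonneg[OF T, of N i] grid_le[OF T, of N "Suc i"] False that by (auto simp: indicator_def)
      then show ?thesis unfolding s_def simple_value_def by (intro sum.neutral ballI) simp
    qed (simp add: s_def simple_value_def)
    show "AE r in lborel. norm (s N r) \<le> B * indicator {0..T} r" for N
    proof (rule AE_I2)
      fix r :: real
      show "norm (s N r) \<le> B * indicator {0..T} r"
      proof (cases "r \<in> {0<..T} \<and> 0 < N")
        case True
        then obtain j where "j < N" "grid T N j < r" "r \<le> grid T N (Suc j)"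
          and j: "\<And>(\<xi> :: nat \<Rightarrow> unit \<Rightarrow> real) \<omega>. simple_value N (grid T N) \<xi> r \<omega> = \<xi> j \<omega>"
          using grid_cell[OF T, of N r] by (metis greaterThanAtMost_iff)
        then have "\<bar>\<phi> (grid T N j)\<bar> \<le> B" using B grid_nonneg[OF T] True by auto
        then show ?thesis using True B0 by (simp add: s_def j)
      next
        case False
        then show ?thesis using out[of r N] B0 by (auto simp: s_def simple_value_def)
      qed
    qed
    show "AE r in lborel. (\<lambda>N. s N r) \<longlonglongrightarrow> indicator {0..T} r *\<^sub>R (of_bool (P r) * \<phi> r)"
      using AE_lborel_singleton[of 0] AE_lborel_singleton[of \<tau>]
    proof eventually_elim
      fix r :: real assume r: "r \<noteq> 0" "r \<noteq> \<tau>"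
      show "(\<lambda>N. s N r) \<longlonglongrightarrow> indicator {0..T} r *\<^sub>R (of_bool (P r) * \<phi> r)"
      proof (cases "r \<in> {0<..T}")
        case False
        then have "r \<notin> {0..T}" using r by auto
        then show ?thesis using out[OF False] by simp
      next
        case True
        \<comment> \<open>\<open>g N\<close> stands for the left end of the grid cell that contains
          r; it tends to r from below.\<close>
        define g where "g = (\<lambda>N. SOME t. 0 \<le> t \<and> t < r \<and> r \<le> t + T / N \<and> s N r = of_bool (P t) * \<phi> t)"
        have g: "0 \<le> g N \<and> g N < r \<and> r \<le> g N + T / N \<and> s N r = of_bool (P (g N)) * \<phi> (g N)" if N: "0 < N" for N
        proof -
          obtain j where "j < N" "grid T N j < r" "r \<le> grid T N (Suc j)"
            and j: "\<And>(\<xi> :: nat \<Rightarrow> unit \<Rightarrow> real) \<omega>. simple_value N (grid T N) \<xi> r \<omega> = \<xi> j \<omega>"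
            using grid_cell[OF T N, of r] True by (metis greaterThanAtMost_iff)
          then have "0 \<le> grid T N j \<and> grid T N j < r \<and> r \<le> grid T N j + T / N \<and> s N r = of_bool (P (grid T N j)) * \<phi> (grid T N j)"
            using grid_nonneg[OF T] by (simp add: s_def grid_Suc)
          then show ?thesis unfolding g_def by (rule someI)
        qed
        have glim: "g \<longlonglongrightarrow> r"
        proof (rule tendsto_sandwich[of "\<lambda>N. r - T / real N" _ _ "\<lambda>_. r"])
          show "\<forall>\<^sub>F N in sequentially. r - T / real N \<le> g N"
            using eventually_gt_at_top[of 0] by eventually_elim (use g in \<open>auto simp: diff_le_eq\<close>)
          show "\<forall>\<^sub>F N in sequentially. g N \<le> r"
            using eventually_gt_at_top[of 0] by eventually_elim (use g in \<open>auto simp: less_imp_le\<close>)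
          have "(\<lambda>N. r - T * (1 / real N)) \<longlonglongrightarrow> r - T * 0" by (intro tendsto_intros lim_1_over_n)
          then show "(\<lambda>N. r - T / real N) \<longlonglongrightarrow> r" by simp
        qed simp
        have ev: "\<forall>\<^sub>F N in sequentially. g N \<in> {0..T}"
          using eventually_gt_at_top[of 0] by eventually_elim (use g True in \<open>auto intro: less_imp_le order_trans less_le_trans\<close>)
        have "(\<lambda>N. \<phi> (g N)) \<longlonglongrightarrow> \<phi> r"
          by (rule continuous_on_tendsto_compose[OF \<phi> glim _ ev]) (use True in auto)
        moreover have "\<forall>\<^sub>F N in sequentially. of_bool (P (g N)) = (of_bool (P r) :: real)"
        proof (cases "P r")
          case True
          show ?thesis using eventually_gt_at_top[of 0]
          proof eventually_elim
            case (elim N)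
            then have "P (g N)" using g[OF elim] P[of "g N" r] True by simp
            then show ?case using True by simp
          qed
        next
          case False
          then obtain q where q: "0 \<le> q" "q < r" "\<not> P q" using \<tau>[of r] r True by auto
          have "\<forall>\<^sub>F N in sequentially. q < g N" using order_tendstoD(1)[OF glim q(2)] .
          then show ?thesis
          proof eventually_elim
            case (elim N)
            then have "\<not> P (g N)" using P[of q "g N"] q by auto
            then show ?case using False by simp
          qed
        qed
        ultimately have "(\<lambda>N. of_bool (P (g N)) * \<phi> (g N)) \<longlonglongrightarrow> of_bool (P r) * \<phi> r"
          by (intro tendsto_mult[OF tendsto_eventually])
        moreover have "\<forall>\<^sub>F N in sequentially. of_bool (P (g N)) * \<phi> (g N) = s N r"
          using eventually_gt_at_top[of 0] by eventually_elim (use g in auto)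
        ultimately have "(\<lambda>N. s N r) \<longlonglongrightarrow> of_bool (P r) * \<phi> r" by (rule Lim_transform_eventually)
        then show ?thesis using True by simp
      qed
    qed
  qed
  then have "(\<lambda>N. integral\<^sup>L lborel (s N)) \<longlonglongrightarrow> (LBINT s:{0..T}. of_bool (P s) * \<phi> s)"
    by (simp add: set_lebesgue_integral_def)
  moreover have "\<forall>\<^sub>F N in sequentially. integral\<^sup>L lborel (s N) = (\<Sum>i<N. T / real N * (of_bool (P (grid T N i)) * \<phi> (grid T N i)))"
    using eventually_gt_at_top[of 0] by eventually_elim (rule int_s)
  ultimately show ?thesis by (rule Lim_transform_eventually)
qed

text \<open>Continuity is required for every outcome, so that survival can be decided at rational
  times without exceptional sets. \<open>continuous_version\<close> provides such a process.\<close>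

locale continuous_diffusion = wiener_process M F W
  for M :: "'a measure" and F W +
  fixes a b :: "real \<Rightarrow> real" and X I :: "real \<Rightarrow> 'a \<Rightarrow> real" and x :: real
  assumes X_adapted: "\<And>t. 0 \<le> t \<Longrightarrow> X t \<in> borel_measurable (F t)"
    and X_cont: "\<And>\<omega>. \<omega> \<in> space M \<Longrightarrow> continuous_on {0..} (\<lambda>t. X t \<omega>)"
    and a_cont: "continuous_on UNIV a" and b_cont: "continuous_on UNIV b"
    and ito: "is_ito_integral M F W (\<lambda>s \<omega>. a (X s \<omega>)) I"
    and X_eq: "AE \<omega> in M. \<forall>t\<ge>0. X t \<omega> = x + (LBINT s:{0..t}. b (X s \<omega>)) + I t \<omega>"
begin

lemma X_measurable: "0 \<le> t \<Longrightarrow> X t \<in> borel_measurable M"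
  by (rule F_measurable[OF _ X_adapted])

lemma X_joint: "(\<lambda>(t, \<omega>). X (max 0 t) \<omega>) \<in> borel_measurable (borel \<Otimes>\<^sub>M M)"
  by (rule joint_measurable[OF X_measurable X_cont])

text \<open>Survival in a closed interval takes the place of an exit time: closedness permits a test
  at countably many times, which puts the event into \<open>F t\<close> itself. For negative t the
  event is all of \<open>space M\<close>.\<close>

definition alive :: "real \<Rightarrow> real \<Rightarrow> real \<Rightarrow> 'a set" where
  "alive c d t = {\<omega>\<in>space M. \<forall>q\<in>{0..t}. X q \<omega> \<in> {c..d}}"

lemma alive_space: "alive c d t \<subseteq> space M"
  by (auto simp: alive_def)

lemma alive_mono: "r \<le> s \<Longrightarrow> \<omega> \<in> alive c d s \<Longrightarrow> \<omega> \<in> alive c d r"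
  by (auto simp: alive_def)

lemma alive_X: "0 \<le> t \<Longrightarrow> \<omega> \<in> alive c d t \<Longrightarrow> X t \<omega> \<in> {c..d}"
  by (auto simp: alive_def)

text \<open>Any q up to t is a limit of test times not exceeding q, and the path values there
  converge inside the closed interval.\<close>

lemma alive_iff:
  assumes "\<omega> \<in> space M"
  shows "\<omega> \<in> alive c d t \<longleftrightarrow> (\<forall>i n. real i / real (Suc n) \<le> t \<longrightarrow> X (real i / real (Suc n)) \<omega> \<in> {c..d})"
proof
  assume R: "\<forall>i n. real i / real (Suc n) \<le> t \<longrightarrow> X (real i / real (Suc n)) \<omega> \<in> {c..d}"
  have "X q \<omega> \<in> {c..d}" if q: "q \<in> {0..t}" for q
  proof -
    define s where "s = (\<lambda>n. real_of_int \<lfloor>real (Suc n) * q\<rfloor> / real (Suc n))"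
    have s: "s n = real (nat \<lfloor>real (Suc n) * q\<rfloor>) / real (Suc n)" for n using q by (simp add: s_def)
    have "s n \<le> t" for n using floor_approx_le[of n q] q by (simp add: s_def)
    then have "X (s n) \<omega> \<in> {c..d}" for n using R unfolding s by blast
    moreover have "(\<lambda>n. X (s n) \<omega>) \<longlonglongrightarrow> X q \<omega>"
      by (rule continuous_on_tendsto_compose[OF X_cont[OF assms]])
        (use q floor_approx_tendsto[of q] in \<open>auto simp: s_def\<close>)
    ultimately show ?thesis by (intro Lim_in_closed_set[of "{c..d}"]) auto
  qed
  then show "\<omega> \<in> alive c d t" using assms by (auto simp: alive_def)
qed (auto simp: alive_def)

lemma alive_sets_F:
  assumes t: "0 \<le> t"
  shows "alive c d t \<in> sets (F t)"
proof -
  have sp: "space (F t) = space M" using subalgebra_F[OF t] by (simp add: subalgebra_def)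
  have "alive c d t = {\<omega>\<in>space (F t). \<forall>i n. real i / real (Suc n) \<le> t \<longrightarrow> X (real i / real (Suc n)) \<omega> \<in> {c..d}}"
    unfolding sp using alive_iff alive_space by blast
  also have "\<dots> \<in> sets (F t)"
  proof (intro sets.sets_Collect_countable_All)
    fix i n
    show "{\<omega> \<in> space (F t). real i / real (Suc n) \<le> t \<longrightarrow> X (real i / real (Suc n)) \<omega> \<in> {c..d}} \<in> sets (F t)"
    proof (cases "real i / real (Suc n) \<le> t")
      case True
      have [measurable]: "X (real i / real (Suc n)) \<in> borel_measurable (F t)"
        by (rule F_measurable_mono[OF _ True X_adapted]) auto
      show ?thesis by measurable
    qed simp
  qed
  finally show ?thesis .
qed

lemma alive_sets: "0 \<le> t \<Longrightarrow> alive c d t \<in> sets M"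
  using alive_sets_F subalgebra_F unfolding subalgebra_def by blast

lemma alive_joint: "{z\<in>space (borel \<Otimes>\<^sub>M M). snd z \<in> alive c d (fst z)} \<in> sets (borel \<Otimes>\<^sub>M M)"
proof -
  have "{z\<in>space (borel \<Otimes>\<^sub>M M). snd z \<in> alive c d (fst z)} = {z\<in>space (borel \<Otimes>\<^sub>M M).
     \<forall>i n. real i / real (Suc n) \<le> fst z \<longrightarrow> X (real i / real (Suc n)) (snd z) \<in> {c..d}}"
    by (intro Collect_cong conj_cong refl alive_iff) (auto simp: space_pair_measure)
  also have "\<dots> \<in> sets (borel \<Otimes>\<^sub>M M)"
  proof -
    have [measurable]: "X (real i / real (Suc n)) \<in> borel_measurable M" for i n by (rule X_measurable) simp
    show ?thesis by measurable
  qed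
  finally show ?thesis .
qed

text \<open>At time 0 the equation reads \<open>X 0 = x + I 0\<close>. That \<open>I 0\<close>
  vanishes has to come from the approximation: all nodes are nonnegative, so every simple integral
  is 0 at time 0.\<close>

lemma X_0: "AE \<omega> in M. X 0 \<omega> = x"
proof -
  obtain n \<tau> \<xi> where sp: "\<And>k. simple_process M F (n k) (\<tau> k) (\<xi> k)"
    and v: "vanishes_in_prob M (\<lambda>k \<omega>. ennreal \<bar>simple_integral W (n k) (\<tau> k) (\<xi> k) 0 \<omega> - I 0 \<omega>\<bar>)"
    using ito unfolding is_ito_integral_def by blast
  have z: "simple_integral W (n k) (\<tau> k) (\<xi> k) 0 \<omega> = 0" for k \<omega>
    using simple_process_nonneg[OF sp] by (simp add: simple_integral_def min_absorb1)
  have [measurable]: "I 0 \<in> borel_measurable M"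
    using ito F_measurable[of 0 "I 0"] by (auto simp: is_ito_integral_def adapted_def)
  have P: "prob {\<omega>\<in>space M. e < \<bar>I 0 \<omega>\<bar>} = 0" if e: "0 < e" for e
  proof -
    have "(\<lambda>k::nat. prob {\<omega>\<in>space M. ennreal e < ennreal \<bar>I 0 \<omega>\<bar>}) \<longlonglongrightarrow> 0"
      using v e by (simp add: vanishes_in_prob_def z)
    then have "prob {\<omega>\<in>space M. ennreal e < ennreal \<bar>I 0 \<omega>\<bar>} = 0" by (simp add: LIMSEQ_const_iff)
    then show ?thesis using e by (simp add: ennreal_less_iff)
  qed
  have "AE \<omega> in M. \<forall>k. \<not> 1 / real (Suc k) < \<bar>I 0 \<omega>\<bar>"
  proof (intro AE_all_countable[THEN iffD2] allI)
    fix k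
    show "AE \<omega> in M. \<not> 1 / real (Suc k) < \<bar>I 0 \<omega>\<bar>"
      using P[of "1 / real (Suc k)"] by (subst AE_iff_measurable[OF _ refl]) (auto simp: emeasure_eq_measure)
  qed
  then have "AE \<omega> in M. I 0 \<omega> = 0"
  proof eventually_elim
    fix \<omega> assume 1: "\<forall>k. \<not> 1 / real (Suc k) < \<bar>I 0 \<omega>\<bar>"
    show "I 0 \<omega> = 0"
    proof (rule ccontr)
      assume "I 0 \<omega> \<noteq> 0"
      then obtain k where "1 / real (Suc k) < \<bar>I 0 \<omega>\<bar>" using nat_approx_posE[of "\<bar>I 0 \<omega>\<bar>"] by auto
      then show False using 1 by blast
    qed
  qed
  then show ?thesis using X_eq
  proof eventually_elim
    fix \<omega> assume 1: "I 0 \<omega> = 0" and 2: "\<forall>t\<ge>0. X t \<omega> = x + (LBINT s:{0..t}. b (X s \<omega>)) + I t \<omega>"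
    have "(LBINT s:{0..0}. b (X s \<omega>)) = 0"
      unfolding set_lebesgue_integral_def
      by (rule integral_eq_zero_AE) (use AE_lborel_singleton[of 0] in eventually_elim, auto)
    then show "X 0 \<omega> = x" using 1 2 by simp
  qed
qed

end

text \<open>Where \<open>Y\<close> and \<open>Z\<close> are \<rho>-close the integrands differ by at
  most e; elsewhere the trivial bound \<open>2 * B\<close> is paid.\<close>

lemma (in prob_space) expectation_diff_prob:
  fixes Y Z :: "'a \<Rightarrow> real"
  assumes [measurable]: "Y \<in> borel_measurable M" "Z \<in> borel_measurable M" "G \<in> borel_measurable M" "H \<in> borel_measurable M"
    and b: "\<And>\<omega>. \<omega> \<in> space M \<Longrightarrow> \<bar>G \<omega>\<bar> \<le> B" "\<And>\<omega>. \<omega> \<in> space M \<Longrightarrow> \<bar>H \<omega>\<bar> \<le> B"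
    and close: "AE \<omega> in M. \<bar>Y \<omega> - Z \<omega>\<bar> \<le> \<rho> \<longrightarrow> \<bar>G \<omega> - H \<omega>\<bar> \<le> e" and e: "0 \<le> e"
  shows "\<bar>expectation G - expectation H\<bar> \<le> e + 2 * B * prob {\<omega>\<in>space M. \<rho> < \<bar>Y \<omega> - Z \<omega>\<bar>}"
proof -
  let ?A = "{\<omega>\<in>space M. \<rho> < \<bar>Y \<omega> - Z \<omega>\<bar>}"
  have iA: "integrable M (indicator ?A :: 'a \<Rightarrow> real)" by (rule bounded_integrable[where B=1]) auto
  have iG: "integrable M G" and iH: "integrable M H" by (auto intro!: bounded_integrable[where B=B] b)
  have "\<bar>expectation G - expectation H\<bar> = \<bar>expectation (\<lambda>\<omega>. G \<omega> - H \<omega>)\<bar>" using iG iH by simp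
  also have "\<dots> \<le> expectation (\<lambda>\<omega>. \<bar>G \<omega> - H \<omega>\<bar>)" by (rule integral_abs_bound)
  also have "\<dots> \<le> expectation (\<lambda>\<omega>. e + 2 * B * indicator ?A \<omega>)"
  proof (rule integral_mono_AE)
    show "AE \<omega> in M. \<bar>G \<omega> - H \<omega>\<bar> \<le> e + 2 * B * indicator ?A \<omega>"
      using close AE_space
    proof eventually_elim
      case (elim \<omega>)
      have B: "\<bar>G \<omega> - H \<omega>\<bar> \<le> 2 * B" using b(1)[OF elim(2)] b(2)[OF elim(2)] by linarith
      show ?case
      proof (cases "\<rho> < \<bar>Y \<omega> - Z \<omega>\<bar>")
        case True
        then have *: "indicator ?A \<omega> = (1::real)" using elim(2) by simp
        show ?thesis unfolding * using B e by linarith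
      next
        case False
        then have *: "\<bar>G \<omega> - H \<omega>\<bar> \<le> e" "indicator ?A \<omega> = (0::real)" using elim by simp_all
        show ?thesis unfolding *(2) using *(1) by linarith
      qed
    qed
    show "integrable M (\<lambda>\<omega>. e + 2 * B * indicator ?A \<omega>)"
      by (rule Bochner_Integration.integrable_add[OF integrable_const integrable_mult_right[OF iA]])
  qed (use iG iH in auto)
  also have "\<dots> = e + 2 * B * prob ?A"
    by (subst Bochner_Integration.integral_add[OF integrable_const integrable_mult_right[OF iA]]) (auto simp: prob_space)
  finally show ?thesis .
qed

section \<open>The killed process and its Euler scheme\<close>

context continuous_diffusion begin

text \<open>The start is the constant \<open>x\<close> and not \<open>X 0\<close>, which equals
  \<open>x\<close> only almost surely; the Euler scheme below needs a deterministic start, and both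
  sums share it.\<close>

definition killed_sum :: "real \<Rightarrow> real \<Rightarrow> real \<Rightarrow> nat \<Rightarrow> nat \<Rightarrow> 'a \<Rightarrow> real" where
  "killed_sum c d T N i \<omega> = x + (\<Sum>j<i. indicator (alive c d (grid T N j)) \<omega> * (X (grid T N (Suc j)) \<omega> - X (grid T N j) \<omega>))"

definition killed_euler :: "real \<Rightarrow> real \<Rightarrow> real \<Rightarrow> nat \<Rightarrow> nat \<Rightarrow> 'a \<Rightarrow> real" where
  "killed_euler c d T N i \<omega> = x + (\<Sum>j<i. indicator (alive c d (grid T N j)) \<omega> * b (X (grid T N j) \<omega>) * (T / real N)
     + indicator (alive c d (grid T N j)) \<omega> * a (X (grid T N j) \<omega>) * (W (grid T N (Suc j)) \<omega> - W (grid T N j) \<omega>))"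

lemma killed_sum_alive:
  assumes T: "0 < T" and X0: "X 0 \<omega> = x" and al: "\<And>j. j < i \<Longrightarrow> \<omega> \<in> alive c d (grid T N j)"
  shows "killed_sum c d T N i \<omega> = X (grid T N i) \<omega>"
proof -
  have "(\<Sum>j<i. indicator (alive c d (grid T N j)) \<omega> * (X (grid T N (Suc j)) \<omega> - X (grid T N j) \<omega>))
    = (\<Sum>j<i. X (grid T N (Suc j)) \<omega> - X (grid T N j) \<omega>)"
    using al by (intro sum.cong refl) auto
  also have "\<dots> = X (grid T N i) \<omega> - X (grid T N 0) \<omega>" by (rule sum_lessThan_telescope)
  finally show ?thesis using X0 by (simp add: killed_sum_def grid_0)
qed

lemma killed_sum_measurable: "0 < T \<Longrightarrow> killed_sum c d T N i \<in> borel_measurable M"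
proof -
  assume T: "0 < T"
  have [measurable]: "X (grid T N j) \<in> borel_measurable M" "alive c d (grid T N j) \<in> sets M" for j
    using X_measurable alive_sets grid_nonneg[OF T] by auto
  show ?thesis unfolding killed_sum_def by measurable
qed

lemma killed_euler_measurable: "0 < T \<Longrightarrow> killed_euler c d T N i \<in> borel_measurable M"
proof -
  assume T: "0 < T"
  have [measurable]: "X (grid T N j) \<in> borel_measurable M" "alive c d (grid T N j) \<in> sets M" for j
    using X_measurable alive_sets grid_nonneg[OF T] by auto
  have [measurable]: "W (grid T N j) \<in> borel_measurable M" for j
    using F_measurable[OF _ W_F_measurable[OF _ order_refl]] grid_nonneg[OF T] by auto
  have [measurable]: "a \<in> borel_measurable borel" "b \<in> borel_measurable borel"
    using a_cont b_cont by (auto intro: borel_measurable_continuous_onI)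
  show ?thesis unfolding killed_euler_def by measurable
qed

text \<open>If the path leaves \<open>[c, d]\<close> before time \<open>T\<close>, the killed sum stops at the first grid point after
  the exit, which is within one grid step of a time at which the path is at \<open>c\<close> or \<open>d\<close>.\<close>

lemma killed_sum_tendsto:
  assumes T: "0 < T" and x: "x \<in> {c..d}" and \<omega>: "\<omega> \<in> space M" and X0: "X 0 \<omega> = x"
    and u: "\<And>y z. \<bar>u y - u z\<bar> \<le> C * \<bar>y - z\<bar>" "u c = 0" "u d = (0 :: real)" and C: "0 \<le> C"
  shows "(\<lambda>N. u (killed_sum c d T N N \<omega>)) \<longlonglongrightarrow> indicator (alive c d T) \<omega> * u (X T \<omega>)"
proof (cases "\<omega> \<in> alive c d T")
  case True
  have "\<forall>\<^sub>F N in sequentially. u (X T \<omega>) = u (killed_sum c d T N N \<omega>)"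
    using eventually_gt_at_top[of 0]
  proof eventually_elim
    case (elim N)
    have "\<omega> \<in> alive c d (grid T N j)" if "j < N" for j
      using alive_mono[OF grid_le[OF T elim] True] that by simp
    then show ?case using killed_sum_alive[OF T X0, of N c d N] grid_N[OF elim] by simp
  qed
  then show ?thesis using True by (simp add: Lim_transform_eventually[OF tendsto_const])
next
  case False
  have "(\<lambda>N. u (killed_sum c d T N N \<omega>)) \<longlonglongrightarrow> 0"
  proof (rule tendstoI)
    fix r :: real assume r: "0 < r"
    have "continuous_on {0..T} (\<lambda>t. X t \<omega>)" by (rule continuous_on_subset[OF X_cont[OF \<omega>]]) auto
    \<comment> \<open>\<open>C + 1\<close> because \<open>C\<close> may be 0.\<close>
    moreover have "0 < r / (C + 1)" using r C by simp
    ultimately have "\<forall>\<^sub>F N in sequentially. 0 < N \<and>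
      (\<forall>s\<in>{0..T}. \<forall>t\<in>{0..T}. \<bar>t - s\<bar> \<le> T / real N \<longrightarrow> \<bar>X t \<omega> - X s \<omega>\<bar> < r / (C + 1))"
      by (rule grid_oscillation[OF T])
    then show "\<forall>\<^sub>F N in sequentially. dist (u (killed_sum c d T N N \<omega>)) 0 < r"
    proof eventually_elim
      case (elim N)
      then have N0: "0 < N" and e: "\<And>s t. s \<in> {0..T} \<Longrightarrow> t \<in> {0..T} \<Longrightarrow> \<bar>t - s\<bar> \<le> T / real N \<Longrightarrow> \<bar>X t \<omega> - X s \<omega>\<bar> < r / (C + 1)"
        by auto
      \<comment> \<open>First dead grid index, with N as default. The default is dead too, since the
        N-th grid point is T, where the path is known not to be alive.\<close>
      define k where "k = (LEAST j. j = N \<or> \<omega> \<notin> alive c d (grid T N j))"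
      have kP: "k = N \<or> \<omega> \<notin> alive c d (grid T N k)"
        unfolding k_def by (rule LeastI[where k=N]) simp
      have kN: "k \<le> N" unfolding k_def by (rule Least_le) simp
      have kl: "\<omega> \<in> alive c d (grid T N j)" if "j < k" for j
        using not_less_Least[OF that[unfolded k_def]] by blast
      have dead: "\<omega> \<notin> alive c d (grid T N k)" using kP False grid_N[OF N0] by auto
      have k0: "k \<noteq> 0"
      proof
        assume "k = 0"
        then have "\<omega> \<notin> alive c d 0" using dead by (simp add: grid_0)
        then show False using \<omega> X0 x by (auto simp: alive_def)
      qed
      then obtain i where i: "k = Suc i" by (cases k) auto
      have ev: "indicator (alive c d (grid T N j)) \<omega> = (0::real)" if "j \<in> {k..<N}" for j
        using alive_mono[OF grid_mono[OF T], of k j \<omega> c d N] dead that by (auto simp: indicator_def)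
      have "killed_sum c d T N N \<omega> = killed_sum c d T N k \<omega>"
      proof -
        have "(\<Sum>j<N. indicator (alive c d (grid T N j)) \<omega> * (X (grid T N (Suc j)) \<omega> - X (grid T N j) \<omega>))
          = (\<Sum>j<k. indicator (alive c d (grid T N j)) \<omega> * (X (grid T N (Suc j)) \<omega> - X (grid T N j) \<omega>))"
          using kN ev by (intro sum.mono_neutral_right) auto
        then show ?thesis by (simp add: killed_sum_def)
      qed
      also have "\<dots> = X (grid T N k) \<omega>" by (rule killed_sum_alive[OF T X0 kl])
      finally have Z: "killed_sum c d T N N \<omega> = X (grid T N k) \<omega>" .
      have ai: "\<omega> \<in> alive c d (grid T N i)" using kl[of i] i by simp
      obtain q where q: "0 \<le> q" "q \<le> grid T N k" "X q \<omega> \<notin> {c..d}" using dead \<omega> by (auto simp: alive_def)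
      have qi: "grid T N i < q"
      proof (rule ccontr)
        assume "\<not> grid T N i < q"
        then have "X q \<omega> \<in> {c..d}" using ai q by (auto simp: alive_def)
        then show False using q by simp
      qed
      have t0: "0 \<le> grid T N i" using grid_nonneg[OF T] .
      have Xi: "X (grid T N i) \<omega> \<in> {c..d}" using alive_X[OF t0 ai] .
      have cont: "continuous_on {grid T N i..q} (\<lambda>t. X t \<omega>)"
        using t0 by (intro continuous_on_subset[OF X_cont[OF \<omega>]]) auto
      \<comment> \<open>Between the last living grid point and an outside time q the path passes
        through c or d, where \<open>u\<close> is 0. That time is at most one grid step away from
        \<open>grid T N k\<close>.\<close>
      have "\<exists>s. grid T N i \<le> s \<and> s \<le> q \<and> (X s \<omega> = c \<or> X s \<omega> = d)"
      proof (cases "X q \<omega> < c")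
        case True
        then show ?thesis using IVT2'[of "\<lambda>t. X t \<omega>" q c "grid T N i"] Xi qi cont by force
      next
        case False
        then have "d < X q \<omega>" using q by auto
        then show ?thesis using IVT'[of "\<lambda>t. X t \<omega>" "grid T N i" d q] Xi qi cont by force
      qed
      then obtain s where s: "grid T N i \<le> s" "s \<le> q" "X s \<omega> = c \<or> X s \<omega> = d" by blast
      have tk: "grid T N k \<le> T" using grid_le[OF T N0 kN] .
      have "\<bar>grid T N k - s\<bar> \<le> T / real N" using s q by (simp add: i grid_Suc)
      then have close: "\<bar>X (grid T N k) \<omega> - X s \<omega>\<bar> < r / (C + 1)"
        using e[of s "grid T N k"] s q tk t0 grid_nonneg[OF T, of N k] by auto
      have "\<bar>u (X (grid T N k) \<omega>)\<bar> = \<bar>u (X (grid T N k) \<omega>) - u (X s \<omega>)\<bar>" using s(3) u by auto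
      also have "\<dots> \<le> C * \<bar>X (grid T N k) \<omega> - X s \<omega>\<bar>" by (rule u)
      also have "\<dots> \<le> C * (r / (C + 1))"
        using close C by (intro mult_left_mono) auto
      also have "\<dots> < r" using r C by (simp add: field_simps)
      finally show ?case by (simp add: Z)
    qed
  qed
  then show ?thesis using False by simp
qed

lemma drift_integrable:
  assumes \<omega>: "\<omega> \<in> space M" and "0 \<le> s"
  shows "set_integrable lborel {s..t} (\<lambda>r. b (X r \<omega>))"
  by (rule borel_integrable_atLeastAtMost')
    (use assms in \<open>auto intro!: continuous_on_compose2[OF b_cont] continuous_on_subset[OF X_cont[OF \<omega>]]\<close>)

text \<open>The absolute values make one quantity dominate the drift part of every partial sum,
  whichever indicators are switched on.\<close>

definition drift_error :: "real \<Rightarrow> nat \<Rightarrow> 'a \<Rightarrow> real" where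
  "drift_error T N \<omega> = (\<Sum>j<N. \<bar>b (X (grid T N j) \<omega>) * (T / real N) - (LBINT r:{grid T N j..grid T N (Suc j)}. b (X r \<omega>))\<bar>)"

lemma drift_error_measurable:
  assumes T: "0 < T"
  shows "drift_error T N \<in> borel_measurable M"
proof -
  have [measurable]: "X (grid T N j) \<in> borel_measurable M" for j
    using X_measurable grid_nonneg[OF T] by auto
  have [measurable]: "b \<in> borel_measurable borel"
    using b_cont by (auto intro: borel_measurable_continuous_onI)
  have [measurable]: "(\<lambda>(\<omega>, s). X (max 0 s) \<omega>) \<in> borel_measurable (M \<Otimes>\<^sub>M lborel)"
    using measurable_compose[OF measurable_pair_swap' X_joint]
    by (simp add: case_prod_beta' cong: measurable_cong_sets)
  have eq: "(\<lambda>\<omega>. (LBINT r:{grid T N j..grid T N (Suc j)}. b (X r \<omega>)))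
    = (\<lambda>\<omega>. (LBINT r. indicator {grid T N j..grid T N (Suc j)} r *\<^sub>R b (X (max 0 r) \<omega>)))" for j
    unfolding set_lebesgue_integral_def using grid_nonneg[OF T, of N j]
    by (intro ext Bochner_Integration.integral_cong) (auto simp: indicator_def max_def)
  have [measurable]: "(\<lambda>\<omega>. (LBINT r:{grid T N j..grid T N (Suc j)}. b (X r \<omega>))) \<in> borel_measurable M" for j
    unfolding eq by measurable
  show ?thesis unfolding drift_error_def by measurable
qed

lemma drift_error_tendsto:
  assumes T: "0 < T" and \<omega>: "\<omega> \<in> space M"
  shows "(\<lambda>N. drift_error T N \<omega>) \<longlonglongrightarrow> 0"
proof (rule tendstoI)
  fix r :: real assume r: "0 < r"
  define \<phi> where "\<phi> = (\<lambda>t. b (X t \<omega>))"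
  have "continuous_on {0..T} \<phi>" unfolding \<phi>_def
    by (auto intro!: continuous_on_compose2[OF b_cont] continuous_on_subset[OF X_cont[OF \<omega>]])
  moreover have "0 < r / (2 * T)" using r T by simp
  ultimately have "\<forall>\<^sub>F N in sequentially. 0 < N \<and>
    (\<forall>s\<in>{0..T}. \<forall>t\<in>{0..T}. \<bar>t - s\<bar> \<le> T / real N \<longrightarrow> \<bar>\<phi> t - \<phi> s\<bar> < r / (2 * T))"
    by (rule grid_oscillation[OF T])
  then show "\<forall>\<^sub>F N in sequentially. dist (drift_error T N \<omega>) 0 < r"
  proof eventually_elim
    case (elim N)
    then have N0: "0 < N" and e: "\<And>s t. s \<in> {0..T} \<Longrightarrow> t \<in> {0..T} \<Longrightarrow> \<bar>t - s\<bar> \<le> T / real N \<Longrightarrow> \<bar>\<phi> t - \<phi> s\<bar> < r / (2 * T)"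
      by auto
    have "\<bar>\<phi> (grid T N j) * (T / real N) - (LBINT s:{grid T N j..grid T N (Suc j)}. \<phi> s)\<bar> \<le> T / real N * (r / (2 * T))"
      if j: "j < N" for j
    proof -
      let ?A = "{grid T N j..grid T N (Suc j)}"
      have A: "?A \<subseteq> {0..T}" using grid_nonneg[OF T, of N j] grid_le[OF T N0, of "Suc j"] j by auto
      have le: "grid T N j \<le> grid T N (Suc j)" using grid_less_Suc[OF T N0] less_imp_le by blast
      have i\<phi>: "set_integrable lborel ?A \<phi>" unfolding \<phi>_def using drift_integrable[OF \<omega> grid_nonneg[OF T]] .
      have ic: "set_integrable lborel ?A (\<lambda>_. k)" for k :: real
        by (rule borel_integrable_atLeastAtMost') simp
      have c: "(LBINT s:?A. k) = T / real N * k" for k :: real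
        using le by (simp add: set_lebesgue_integral_def grid_Suc)
      have "\<phi> (grid T N j) * (T / real N) - (LBINT s:?A. \<phi> s) = (LBINT s:?A. \<phi> (grid T N j) - \<phi> s)"
        using ic i\<phi> c by (simp add: set_integral_diff)
      also have "\<bar>\<dots>\<bar> \<le> (LBINT s:?A. \<bar>\<phi> (grid T N j) - \<phi> s\<bar>)"
        using set_integral_norm_bound[OF set_integral_diff(1)[OF ic[of "\<phi> (grid T N j)"] i\<phi>]] by simp
      also have "\<dots> \<le> (LBINT s:?A. r / (2 * T))"
      proof (rule set_integral_mono)
        show "set_integrable lborel ?A (\<lambda>s. \<bar>\<phi> (grid T N j) - \<phi> s\<bar>)"
          using set_integrable_norm[OF set_integral_diff(1)[OF ic[of "\<phi> (grid T N j)"] i\<phi>]] by simp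
        fix s assume s: "s \<in> ?A"
        then have "\<bar>grid T N j - s\<bar> \<le> T / real N" by (auto simp: grid_Suc)
        then show "\<bar>\<phi> (grid T N j) - \<phi> s\<bar> \<le> r / (2 * T)"
          using e[of s "grid T N j"] A s le by auto
      qed (rule ic)
      also have "\<dots> = T / real N * (r / (2 * T))" by (rule c)
      finally show ?thesis .
    qed
    then have "drift_error T N \<omega> \<le> (\<Sum>j<N. T / real N * (r / (2 * T)))"
      unfolding drift_error_def \<phi>_def by (intro sum_mono) auto
    also have "\<dots> = r / 2" using N0 T by simp
    finally have "drift_error T N \<omega> < r" using r by simp
    moreover have "0 \<le> drift_error T N \<omega>" unfolding drift_error_def by (intro sum_nonneg) auto
    ultimately show ?case by simp
  qed
qed

text \<open>The equation for \<open>X\<close> splits each increment into a drift integral and an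
  increment of \<open>I\<close>. Stopping at i is expressed through empty events for
  \<open>j \<ge> i\<close>, the form that \<open>ito_grid_sum_vanishes\<close> accepts.\<close>

lemma killed_euler_error:
  assumes T: "0 < T" and i: "i \<le> N"
  shows "AE \<omega> in M. \<bar>killed_euler c d T N i \<omega> - killed_sum c d T N i \<omega>\<bar> \<le> drift_error T N \<omega> +
    \<bar>\<Sum>j<N. indicator (if j < i then alive c d (grid T N j) else {}) \<omega> *
      (a (X (grid T N j) \<omega>) * (W (grid T N (Suc j)) \<omega> - W (grid T N j) \<omega>) - (I (grid T N (Suc j)) \<omega> - I (grid T N j) \<omega>))\<bar>"
  using X_eq AE_space
proof eventually_elim
  case (elim \<omega>)
  let ?t = "grid T N"
  let ?k = "\<lambda>j. indicator (alive c d (?t j)) \<omega> :: real"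
  let ?D = "\<lambda>j. b (X (?t j) \<omega>) * (T / real N) - (LBINT r:{?t j..?t (Suc j)}. b (X r \<omega>))"
  let ?S = "\<lambda>j. a (X (?t j) \<omega>) * (W (?t (Suc j)) \<omega> - W (?t j) \<omega>) - (I (?t (Suc j)) \<omega> - I (?t j) \<omega>)"
  have inc: "X (?t (Suc j)) \<omega> - X (?t j) \<omega> = (LBINT r:{?t j..?t (Suc j)}. b (X r \<omega>)) + (I (?t (Suc j)) \<omega> - I (?t j) \<omega>)" for j
  proof -
    have le: "0 \<le> ?t j" "?t j \<le> ?t (Suc j)" using grid_nonneg[OF T] grid_mono[OF T] by auto
    have "(LBINT r:{0..?t (Suc j)}. b (X r \<omega>)) = (LBINT r:{0..?t j}. b (X r \<omega>)) + (LBINT r:{?t j..?t (Suc j)}. b (X r \<omega>))"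
    proof -
      have "{0..?t (Suc j)} = {0..?t j} \<union> {?t j..?t (Suc j)}" using le by auto
      moreover have "AE r in lborel. \<not> (r \<in> {0..?t j} \<and> r \<in> {?t j..?t (Suc j)})"
        using AE_lborel_singleton[of "?t j"] by eventually_elim auto
      ultimately show ?thesis
        using set_integral_Un_AE[of "{0..?t j}" "{?t j..?t (Suc j)}" lborel "\<lambda>r. b (X r \<omega>)"] drift_integrable[OF elim(2)] le by auto
    qed
    then show ?thesis using elim(1)[rule_format, of "?t (Suc j)"] elim(1)[rule_format, of "?t j"] le by auto
  qed
  have "killed_euler c d T N i \<omega> - killed_sum c d T N i \<omega> = (\<Sum>j<i. ?k j * ?D j + ?k j * ?S j)"
    unfolding killed_euler_def killed_sum_def inc add_diff_cancel_left sum_subtractf[symmetric]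
    by (intro sum.cong refl) (simp add: algebra_simps)
  then have 1: "killed_euler c d T N i \<omega> - killed_sum c d T N i \<omega> = (\<Sum>j<i. ?k j * ?D j) + (\<Sum>j<i. ?k j * ?S j)"
    by (simp only: sum.distrib)
  have 2: "(\<Sum>j<i. ?k j * ?S j) = (\<Sum>j<N. indicator (if j < i then alive c d (?t j) else {}) \<omega> * ?S j)"
    using i by (intro sum.mono_neutral_cong_left) auto
  have "\<bar>\<Sum>j<i. ?k j * ?D j\<bar> \<le> (\<Sum>j<i. \<bar>?k j * ?D j\<bar>)" by (rule sum_abs)
  also have "\<dots> \<le> (\<Sum>j<i. \<bar>?D j\<bar>)" by (intro sum_mono) (auto simp: indicator_def)
  also have "\<dots> \<le> drift_error T N \<omega>" unfolding drift_error_def using i by (intro sum_mono2) auto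
  finally have 3: "\<bar>\<Sum>j<i. ?k j * ?D j\<bar> \<le> drift_error T N \<omega>" .
  show ?case unfolding 1 2[symmetric] by (rule order_trans[OF abs_triangle_ineq add_right_mono[OF 3]])
qed

text \<open>N must not depend on i, because Dynkin's formula sums over all grid times. The drift
  error dominates every partial sum, and the stochastic part is uniform in the events.\<close>

lemma killed_euler_tendsto:
  assumes T: "0 < T" and \<rho>: "0 < \<rho>" and \<eta>: "0 < \<eta>"
  shows "\<forall>\<^sub>F N in sequentially. \<forall>i\<le>N.
    prob {\<omega>\<in>space M. \<rho> < \<bar>killed_euler c d T N i \<omega> - killed_sum c d T N i \<omega>\<bar>} < \<eta>"
proof -
  have \<rho>2: "0 < \<rho> / 2" and \<eta>2: "0 < \<eta> / 2" using \<rho> \<eta> by auto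
  note [measurable] = killed_euler_measurable[OF T] killed_sum_measurable[OF T] drift_error_measurable[OF T]
  have aX: "(\<lambda>\<omega>. a (X t \<omega>)) \<in> borel_measurable (F t)" if "0 \<le> t" for t
    using X_adapted[OF that] a_cont borel_measurable_continuous_onI measurable_compose by blast
  have aXc: "continuous_on {0..} (\<lambda>t. a (X t \<omega>))" if "\<omega> \<in> space M" for \<omega>
    by (rule continuous_on_compose2[OF a_cont X_cont[OF that]]) auto
  have "(\<lambda>N. prob {\<omega>\<in>space M. ennreal (\<rho> / 2) < ennreal (drift_error T N \<omega>)}) \<longlonglongrightarrow> 0"
  proof (rule prob_tendsto_0[OF _ _ \<rho>2])
    fix \<omega> assume "\<omega> \<in> space M"
    from drift_error_tendsto[OF T this] show "(\<lambda>N. ennreal (drift_error T N \<omega>)) \<longlonglongrightarrow> 0"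
      using tendsto_ennrealI by force
  qed measurable
  then have "(\<lambda>N. prob {\<omega>\<in>space M. \<rho> / 2 < drift_error T N \<omega>}) \<longlonglongrightarrow> 0"
    using \<rho>2 by (simp add: ennreal_less_iff)
  then have ev1: "\<forall>\<^sub>F N in sequentially. prob {\<omega>\<in>space M. \<rho> / 2 < drift_error T N \<omega>} < \<eta> / 2"
    using \<eta>2 by (rule order_tendstoD)
  have ev2: "\<forall>\<^sub>F N in sequentially. \<forall>B. (\<forall>j<N. B j \<in> sets (F (grid T N j))) \<longrightarrow>
    prob {\<omega>\<in>space M. \<rho> / 2 < \<bar>\<Sum>j<N. indicator (B j) \<omega> *
      (a (X (grid T N j) \<omega>) * (W (grid T N (Suc j)) \<omega> - W (grid T N j) \<omega>)
        - (I (grid T N (Suc j)) \<omega> - I (grid T N j) \<omega>))\<bar>} < \<eta> / 2"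
    by (rule ito_grid_sum_vanishes[OF T aX aXc ito \<rho>2 \<eta>2])
  show ?thesis
    using ev1 ev2
  proof eventually_elim
    case (elim N)
    show ?case
    proof (intro allI impI)
      fix i assume i: "i \<le> N"
      define B where "B = (\<lambda>j. if j < i then alive c d (grid T N j) else {})"
      define S where "S = (\<lambda>\<omega>. \<Sum>j<N. indicator (B j) \<omega> *
        (a (X (grid T N j) \<omega>) * (W (grid T N (Suc j)) \<omega> - W (grid T N j) \<omega>) - (I (grid T N (Suc j)) \<omega> - I (grid T N j) \<omega>)))"
      have B: "B j \<in> sets (F (grid T N j))" for j using alive_sets_F grid_nonneg[OF T] by (simp add: B_def)
      then have S: "prob {\<omega>\<in>space M. \<rho> / 2 < \<bar>S \<omega>\<bar>} < \<eta> / 2" using elim(2) by (simp add: S_def)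
      have tn: "0 \<le> grid T N j" for j using grid_nonneg[OF T] .
      have [measurable]: "(\<lambda>\<omega>. a (X (grid T N j) \<omega>)) \<in> borel_measurable M" for j using F_measurable[OF tn aX[OF tn]] .
      have [measurable]: "W (grid T N j) \<in> borel_measurable M" for j
        using F_measurable[OF tn W_F_measurable[OF tn order_refl]] .
      have [measurable]: "I (grid T N j) \<in> borel_measurable M" for j
        using ito F_measurable[OF tn] tn by (auto simp: is_ito_integral_def adapted_def)
      have [measurable]: "B j \<in> sets M" for j using B subalgebra_F[OF tn] unfolding subalgebra_def by blast
      have [measurable]: "S \<in> borel_measurable M" unfolding S_def by measurable
      have "prob {\<omega>\<in>space M. \<rho> < \<bar>killed_euler c d T N i \<omega> - killed_sum c d T N i \<omega>\<bar>}
        \<le> prob ({\<omega>\<in>space M. \<rho> / 2 < drift_error T N \<omega>} \<union> {\<omega>\<in>space M. \<rho> / 2 < \<bar>S \<omega>\<bar>})"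
      proof (rule finite_measure_mono_AE)
        show "AE \<omega> in M. \<omega> \<in> {\<omega>\<in>space M. \<rho> < \<bar>killed_euler c d T N i \<omega> - killed_sum c d T N i \<omega>\<bar>} \<longrightarrow>
          \<omega> \<in> {\<omega>\<in>space M. \<rho> / 2 < drift_error T N \<omega>} \<union> {\<omega>\<in>space M. \<rho> / 2 < \<bar>S \<omega>\<bar>}"
        proof -
          have "AE \<omega> in M. \<bar>killed_euler c d T N i \<omega> - killed_sum c d T N i \<omega>\<bar> \<le> drift_error T N \<omega> + \<bar>S \<omega>\<bar>"
            unfolding S_def B_def by (rule killed_euler_error[OF T i])
          then show ?thesis by eventually_elim auto
        qed
      qed measurable
      also have "\<dots> \<le> prob {\<omega>\<in>space M. \<rho> / 2 < drift_error T N \<omega>} + prob {\<omega>\<in>space M. \<rho> / 2 < \<bar>S \<omega>\<bar>}"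
        by (rule measure_Un_le) measurable
      finally show "prob {\<omega>\<in>space M. \<rho> < \<bar>killed_euler c d T N i \<omega> - killed_sum c d T N i \<omega>\<bar>} < \<eta>"
        using S elim(1) by simp
    qed
  qed
qed

end

section \<open>Dynkin's formula for the killed diffusion\<close>

lemma tendsto_0_if_le_multiple:
  fixes f :: "nat \<Rightarrow> real"
  assumes "\<And>\<epsilon>. 0 < \<epsilon> \<Longrightarrow> \<forall>\<^sub>F n in sequentially. \<bar>f n\<bar> \<le> \<kappa> * \<epsilon>" "0 \<le> \<kappa>"
  shows "f \<longlonglongrightarrow> 0"
proof (rule tendstoI)
  fix e :: real assume e: "0 < e"
  have "0 < e / (\<kappa> + 1)" using e assms(2) by simp
  from assms(1)[OF this] show "\<forall>\<^sub>F n in sequentially. dist (f n) 0 < e"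
  proof eventually_elim
    case (elim n)
    also have "\<kappa> * (e / (\<kappa> + 1)) < e" using e assms(2) by (simp add: field_simps)
    finally show ?case by simp
  qed
qed

text \<open>The Euler estimate relates \<open>u (Y N N)\<close> to the generator sum
  \<open>S\<close> (\<open>e1\<close>). In both, the scheme \<open>Y\<close> is exchanged for the
  killed process \<open>Z\<close> (\<open>e2\<close>, \<open>e4\<close>), and then both sides
  converge (\<open>e3\<close>, \<open>e5\<close>). Only survivors remain on the left because the
  others are stopped close to c or d, where \<open>u\<close> vanishes.\<close>

lemma (in continuous_diffusion) dynkin:
  assumes T: "0 < T" and x: "x \<in> {c..d}" and tf: "test_function u u1 u2 C" and u0: "u c = 0" "u d = 0"
  defines "g \<equiv> \<lambda>y. u1 y * b y + u2 y * (a y)\<^sup>2 / 2"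
  shows "expectation (\<lambda>\<omega>. indicator (alive c d T) \<omega> * u (X T \<omega>))
    = u x + expectation (\<lambda>\<omega>. LBINT s:{0..T}. indicator (alive c d s) \<omega> * g (X s \<omega>))"
proof -
  interpret wiener_test M F W u u1 u2 C
    by (rule wiener_test.intro[OF wiener_process_axioms tf])
  have cu: "continuous_on UNIV u1" "continuous_on UNIV u2"
    using deriv1 DERIV_isCont continuous_at_imp_continuous_on uniformly_continuous_imp_continuous[OF u2_uniform] by blast+
  have g_cont: "continuous_on UNIV g" unfolding g_def by (intro continuous_intros cu a_cont b_cont) auto
  have [measurable]: "a \<in> borel_measurable borel" "b \<in> borel_measurable borel" "g \<in> borel_measurable borel"
    using a_cont b_cont g_cont by (auto intro: borel_measurable_continuous_onI)
  obtain K where K: "\<And>y. y \<in> {c..d} \<Longrightarrow> \<bar>a y\<bar> \<le> K" "\<And>y. y \<in> {c..d} \<Longrightarrow> \<bar>b y\<bar> \<le> K"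
  proof -
    have "bounded (a ` {c..d})" "bounded (b ` {c..d})"
      by (auto intro!: compact_imp_bounded compact_continuous_image continuous_on_subset[OF a_cont] continuous_on_subset[OF b_cont])
    then obtain K1 K2 where "\<And>y. y \<in> {c..d} \<Longrightarrow> \<bar>a y\<bar> \<le> K1" "\<And>y. y \<in> {c..d} \<Longrightarrow> \<bar>b y\<bar> \<le> K2"
      unfolding bounded_iff by (metis imageI real_norm_def)
    then show ?thesis by (intro that[of "max K1 K2"]) fastforce+
  qed
  have K0: "0 \<le> K" using K(1)[OF x] by linarith
  note C0 = C_nonneg
  let ?t = "grid T"
  let ?A = "\<lambda>N i. alive c d (grid T N i)"
  define h where "h = (\<lambda>N. T / real N)"
  define \<beta> where "\<beta> = (\<lambda>N j \<omega>. indicator (?A N j) \<omega> * b (X (?t N j) \<omega>))"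
  define \<sigma> where "\<sigma> = (\<lambda>N j \<omega>. indicator (?A N j) \<omega> * a (X (?t N j) \<omega>))"
  define Y where "Y = killed_euler c d T"
  define Z where "Z = killed_sum c d T"
  have tn: "0 \<le> ?t N j" for N j using grid_nonneg[OF T] .
  have \<beta>\<sigma>_F: "\<beta> N j \<in> borel_measurable (F (?t N j))" "\<sigma> N j \<in> borel_measurable (F (?t N j))" for N j
  proof -
    have [measurable]: "X (?t N j) \<in> borel_measurable (F (?t N j))" "?A N j \<in> sets (F (?t N j))"
      using X_adapted[OF tn] alive_sets_F[OF tn] .
    show "\<beta> N j \<in> borel_measurable (F (?t N j))" "\<sigma> N j \<in> borel_measurable (F (?t N j))"
      unfolding \<beta>_def \<sigma>_def by measurable
  qed
  have [measurable]: "\<beta> N j \<in> borel_measurable M" "\<sigma> N j \<in> borel_measurable M" for N j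
    by (rule F_measurable[OF tn \<beta>\<sigma>_F(1)], rule F_measurable[OF tn \<beta>\<sigma>_F(2)])
  have [measurable]: "X (?t N j) \<in> borel_measurable M" "?A N j \<in> sets M" for N j
    by (rule X_measurable[OF tn], rule alive_sets[OF tn])
  have [measurable]: "X T \<in> borel_measurable M" "alive c d T \<in> sets M"
    using X_measurable alive_sets T by auto
  have [measurable]: "Y N i \<in> borel_measurable M" "Z N i \<in> borel_measurable M" for N i
    unfolding Y_def Z_def by (rule killed_euler_measurable[OF T], rule killed_sum_measurable[OF T])
  have \<beta>K: "\<bar>\<beta> N j \<omega>\<bar> \<le> K" and \<sigma>K: "\<bar>\<sigma> N j \<omega>\<bar> \<le> K" for N j \<omega>
    using K K0 alive_X[OF tn, of \<omega> c d N j] by (auto simp: \<beta>_def \<sigma>_def indicator_def)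
  have Y: "(\<lambda>i \<omega>. x + (\<Sum>j<i. \<beta> N j \<omega> * (T / real N) + \<sigma> N j \<omega> * (W (?t N (Suc j)) \<omega> - W (?t N j) \<omega>))) = Y N" for N
    by (intro ext) (simp add: Y_def killed_euler_def \<beta>_def \<sigma>_def)
  define S where "S = (\<lambda>N. \<Sum>i<N. h N * expectation (\<lambda>\<omega>. u1 (Y N i \<omega>) * \<beta> N i \<omega> + u2 (Y N i \<omega>) * (\<sigma> N i \<omega>)\<^sup>2 / 2))"
  define S' where "S' = (\<lambda>N. \<Sum>i<N. h N * expectation (\<lambda>\<omega>. indicator (?A N i) \<omega> * g (X (?t N i) \<omega>)))"
  define B where "B = C * K + C * K\<^sup>2"
  have B0: "0 \<le> B" using C0 K0 by (simp add: B_def)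
  have hN: "0 \<le> h N" "real N * h N \<le> T" for N using T by (auto simp: h_def)
  have sq: "(\<sigma> N i \<omega>)\<^sup>2 / 2 \<le> K\<^sup>2" for N i \<omega>
    using abs_le_imp_sq_le[OF \<sigma>K, of N i \<omega>] zero_le_power2[of K] by linarith
  have G_bound: "\<bar>v1 * \<beta> N i \<omega> + v2 * (\<sigma> N i \<omega>)\<^sup>2 / 2\<bar> \<le> e1 * K + e2 * K\<^sup>2" if "\<bar>v1\<bar> \<le> e1" "\<bar>v2\<bar> \<le> e2" for v1 v2 e1 e2 N i \<omega>
  proof -
    have "\<bar>v1 * \<beta> N i \<omega>\<bar> \<le> e1 * K" unfolding abs_mult using that \<beta>K K0 by (intro mult_mono) auto
    moreover have "\<bar>v2 * ((\<sigma> N i \<omega>)\<^sup>2 / 2)\<bar> \<le> e2 * K\<^sup>2"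
    proof -
      have "\<bar>(\<sigma> N i \<omega>)\<^sup>2 / 2\<bar> \<le> K\<^sup>2" using sq[of N i \<omega>] by (subst abs_of_nonneg) auto
      then show ?thesis unfolding abs_mult[of v2] using that by (intro mult_mono) auto
    qed
    ultimately show ?thesis by (simp only: times_divide_eq_right[symmetric])
  qed
  \<comment> \<open>During survival the switched coefficients are those of \<open>X\<close>, and
    after death both sides are 0. So the generator sum along \<open>X\<close> has the same shape as
    the one along \<open>Y\<close>.\<close>
  have H_eq: "indicator (?A N i) \<omega> * g (X (?t N i) \<omega>) = u1 (X (?t N i) \<omega>) * \<beta> N i \<omega> + u2 (X (?t N i) \<omega>) * (\<sigma> N i \<omega>)\<^sup>2 / 2" for N i \<omega>
    by (auto simp: g_def \<beta>_def \<sigma>_def indicator_def)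
  have H_bound: "\<bar>indicator (?A N i) \<omega> * g (X (?t N i) \<omega>)\<bar> \<le> B" for N i \<omega>
    unfolding H_eq B_def by (rule G_bound[OF u1_bound u2_bound])

  have e1: "(\<lambda>N. expectation (\<lambda>\<omega>. u (Y N N \<omega>)) - u x - S N) \<longlonglongrightarrow> 0"
  proof (rule tendsto_0_if_le_multiple)
    show "0 \<le> T * (4 * K\<^sup>2 + 1)" using T by simp
    fix \<epsilon> :: real assume \<epsilon>: "0 < \<epsilon>"
    then obtain \<rho> where \<rho>: "0 < \<rho>" "\<And>y z. \<bar>y - z\<bar> < \<rho> \<Longrightarrow> \<bar>u2 y - u2 z\<bar> \<le> \<epsilon>"
      using u2_uniform unfolding uniformly_continuous_on_def dist_real_def by (meson UNIV_I less_imp_le)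
    define D where "D = 32 * C / \<rho>\<^sup>2 * K ^ 4 + C * K\<^sup>2"
    have "(\<lambda>N. T * D * (1 / real N)) \<longlonglongrightarrow> T * D * 0" by (intro tendsto_intros lim_1_over_n)
    then have ev: "\<forall>\<^sub>F N in sequentially. T * D * (1 / real N) < \<epsilon>" using \<epsilon> by (intro order_tendstoD) auto
    obtain n :: nat where n: "T < real n" using reals_Archimedean2 by blast
    show "\<forall>\<^sub>F N in sequentially. \<bar>expectation (\<lambda>\<omega>. u (Y N N \<omega>)) - u x - S N\<bar> \<le> T * (4 * K\<^sup>2 + 1) * \<epsilon>"
      using ev eventually_ge_at_top[of "Suc n"]
    proof eventually_elim
      case (elim N)
      have N: "0 < N" "T \<le> real N" using elim(2) n by auto
      have "\<bar>expectation (\<lambda>\<omega>. u (Y N N \<omega>)) - u x - S N\<bar> \<le> T * (4 * \<epsilon> * K\<^sup>2 + h N * D)"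
        unfolding S_def h_def D_def Y[symmetric]
        by (rule euler_sum(1)[where \<beta>="\<beta> N" and \<sigma>="\<sigma> N" and K=K and x=x, OF T N \<beta>\<sigma>_F \<beta>K \<sigma>K less_imp_le[OF \<epsilon>] \<rho>])
      also have "\<dots> \<le> T * (4 * \<epsilon> * K\<^sup>2 + \<epsilon>)"
        using elim(1) T by (intro mult_left_mono add_left_mono) (auto simp: h_def)
      finally show ?case by (simp add: algebra_simps)
    qed
  qed

  have e4: "(\<lambda>N. S N - S' N) \<longlonglongrightarrow> 0"
  proof (rule tendsto_0_if_le_multiple)
    show "0 \<le> T * (C * K + K\<^sup>2 + 2 * B)" using T C0 K0 B0 by simp
    fix \<epsilon> :: real assume \<epsilon>: "0 < \<epsilon>"
    then obtain \<delta> where \<delta>: "0 < \<delta>" "\<And>y z. \<bar>y - z\<bar> < \<delta> \<Longrightarrow> \<bar>u2 y - u2 z\<bar> \<le> \<epsilon>"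
      using u2_uniform unfolding uniformly_continuous_on_def dist_real_def by (meson UNIV_I less_imp_le)
    \<comment> \<open>Half of \<delta> serves the modulus of \<open>u2\<close>, which asks for a
      strict inequality; \<epsilon> serves the Lipschitz estimate of \<open>u1\<close>.\<close>
    define \<rho> where "\<rho> = min (\<delta> / 2) \<epsilon>"
    have \<rho>: "0 < \<rho>" "\<rho> < \<delta>" "\<rho> \<le> \<epsilon>" using \<delta>(1) \<epsilon> by (auto simp: \<rho>_def)
    show "\<forall>\<^sub>F N in sequentially. \<bar>S N - S' N\<bar> \<le> T * (C * K + K\<^sup>2 + 2 * B) * \<epsilon>"
      using killed_euler_tendsto[OF T \<rho>(1) \<epsilon>, of c d]
    proof eventually_elim
      case (elim N)
      have d: "\<bar>expectation (\<lambda>\<omega>. u1 (Y N i \<omega>) * \<beta> N i \<omega> + u2 (Y N i \<omega>) * (\<sigma> N i \<omega>)\<^sup>2 / 2)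
          - expectation (\<lambda>\<omega>. indicator (?A N i) \<omega> * g (X (?t N i) \<omega>))\<bar> \<le> (C * K + K\<^sup>2 + 2 * B) * \<epsilon>" if i: "i \<le> N" for i
      proof -
        have "\<bar>expectation (\<lambda>\<omega>. u1 (Y N i \<omega>) * \<beta> N i \<omega> + u2 (Y N i \<omega>) * (\<sigma> N i \<omega>)\<^sup>2 / 2)
          - expectation (\<lambda>\<omega>. indicator (?A N i) \<omega> * g (X (?t N i) \<omega>))\<bar>
          \<le> (C * \<epsilon> * K + \<epsilon> * K\<^sup>2) + 2 * B * prob {\<omega>\<in>space M. \<rho> < \<bar>Y N i \<omega> - Z N i \<omega>\<bar>}"
        proof (rule expectation_diff_prob)
          show "\<bar>u1 (Y N i \<omega>) * \<beta> N i \<omega> + u2 (Y N i \<omega>) * (\<sigma> N i \<omega>)\<^sup>2 / 2\<bar> \<le> B" for \<omega>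
            unfolding B_def by (rule G_bound[OF u1_bound u2_bound])
          show "\<bar>indicator (?A N i) \<omega> * g (X (?t N i) \<omega>)\<bar> \<le> B" for \<omega> by (rule H_bound)
          show "0 \<le> C * \<epsilon> * K + \<epsilon> * K\<^sup>2" using C0 K0 \<epsilon> by simp
          show "AE \<omega> in M. \<bar>Y N i \<omega> - Z N i \<omega>\<bar> \<le> \<rho> \<longrightarrow> \<bar>u1 (Y N i \<omega>) * \<beta> N i \<omega> + u2 (Y N i \<omega>) * (\<sigma> N i \<omega>)\<^sup>2 / 2
            - indicator (?A N i) \<omega> * g (X (?t N i) \<omega>)\<bar> \<le> C * \<epsilon> * K + \<epsilon> * K\<^sup>2"
            using X_0
          proof (eventually_elim, intro impI)
            fix \<omega> assume X0: "X 0 \<omega> = x" and yz: "\<bar>Y N i \<omega> - Z N i \<omega>\<bar> \<le> \<rho>"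
            show "\<bar>u1 (Y N i \<omega>) * \<beta> N i \<omega> + u2 (Y N i \<omega>) * (\<sigma> N i \<omega>)\<^sup>2 / 2
              - indicator (?A N i) \<omega> * g (X (?t N i) \<omega>)\<bar> \<le> C * \<epsilon> * K + \<epsilon> * K\<^sup>2"
            \<comment> \<open>For a living path the killed sum is \<open>X\<close> itself, so being
              close to \<open>Z\<close> is being close to \<open>X\<close>. After death both
              expressions are 0, wherever \<open>Y\<close> may be.\<close>
            proof (cases "\<omega> \<in> ?A N i")
              case True
              have "\<omega> \<in> ?A N j" if "j < i" for j
                using alive_mono[OF grid_mono[OF T] True, of j] that by simp
              then have Z: "Z N i \<omega> = X (?t N i) \<omega>" unfolding Z_def by (rule killed_sum_alive[OF T X0])
              have 1: "\<bar>u1 (Y N i \<omega>) - u1 (Z N i \<omega>)\<bar> \<le> C * \<epsilon>"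
                using Lipschitz(2)[of "Y N i \<omega>" "Z N i \<omega>"] yz \<rho>(3) C0
                by (meson mult_left_mono order_trans)
              have 2: "\<bar>u2 (Y N i \<omega>) - u2 (Z N i \<omega>)\<bar> \<le> \<epsilon>" using yz \<rho>(2) by (intro \<delta>(2)) simp
              have "u1 (Y N i \<omega>) * \<beta> N i \<omega> + u2 (Y N i \<omega>) * (\<sigma> N i \<omega>)\<^sup>2 / 2 - indicator (?A N i) \<omega> * g (X (?t N i) \<omega>)
                = (u1 (Y N i \<omega>) - u1 (Z N i \<omega>)) * \<beta> N i \<omega> + (u2 (Y N i \<omega>) - u2 (Z N i \<omega>)) * (\<sigma> N i \<omega>)\<^sup>2 / 2"
                unfolding H_eq Z by (simp add: algebra_simps diff_divide_distrib)
              then show ?thesis using G_bound[OF 1 2, of N i \<omega>] by simp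
            next
              case False
              then show ?thesis using C0 K0 \<epsilon> by (simp add: \<beta>_def \<sigma>_def)
            qed
          qed
        qed measurable
        also have "\<dots> \<le> (C * \<epsilon> * K + \<epsilon> * K\<^sup>2) + 2 * B * \<epsilon>"
          using elim[rule_format, OF i] B0 unfolding Y_def Z_def by (intro add_left_mono mult_left_mono) auto
        finally show ?thesis by (simp add: algebra_simps)
      qed
      have "\<bar>S N - S' N\<bar> \<le> (\<Sum>i<N. h N * ((C * K + K\<^sup>2 + 2 * B) * \<epsilon>))"
        unfolding S_def S'_def sum_subtractf[symmetric] right_diff_distrib[symmetric]
        by (rule order_trans[OF sum_abs sum_mono]) (use d hN in \<open>auto simp: abs_mult intro!: mult_left_mono\<close>)
      also have "\<dots> = real N * h N * ((C * K + K\<^sup>2 + 2 * B) * \<epsilon>)" by simp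
      also have "\<dots> \<le> T * ((C * K + K\<^sup>2 + 2 * B) * \<epsilon>)"
        using hN C0 K0 B0 \<epsilon> by (intro mult_right_mono) auto
      finally show ?case by (simp add: mult.assoc)
    qed
  qed

  have e2: "(\<lambda>N. expectation (\<lambda>\<omega>. u (Y N N \<omega>)) - expectation (\<lambda>\<omega>. u (Z N N \<omega>))) \<longlonglongrightarrow> 0"
  proof (rule tendsto_0_if_le_multiple)
    show "0 \<le> C + 2 * C" using C0 by simp
    fix \<epsilon> :: real assume \<epsilon>: "0 < \<epsilon>"
    show "\<forall>\<^sub>F N in sequentially. \<bar>expectation (\<lambda>\<omega>. u (Y N N \<omega>)) - expectation (\<lambda>\<omega>. u (Z N N \<omega>))\<bar> \<le> (C + 2 * C) * \<epsilon>"
      using killed_euler_tendsto[OF T \<epsilon> \<epsilon>, of c d]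
    proof eventually_elim
      case (elim N)
      have "\<bar>expectation (\<lambda>\<omega>. u (Y N N \<omega>)) - expectation (\<lambda>\<omega>. u (Z N N \<omega>))\<bar>
        \<le> C * \<epsilon> + 2 * C * prob {\<omega>\<in>space M. \<epsilon> < \<bar>Y N N \<omega> - Z N N \<omega>\<bar>}"
      proof (rule expectation_diff_prob)
        show "AE \<omega> in M. \<bar>Y N N \<omega> - Z N N \<omega>\<bar> \<le> \<epsilon> \<longrightarrow> \<bar>u (Y N N \<omega>) - u (Z N N \<omega>)\<bar> \<le> C * \<epsilon>"
          using Lipschitz(1) C0 by (intro AE_I2 impI) (meson mult_left_mono order_trans)
      qed (use u_bound C0 \<epsilon> in auto)
      also have "\<dots> \<le> C * \<epsilon> + 2 * C * \<epsilon>"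
        using elim[rule_format, OF order_refl] C0 unfolding Y_def Z_def by (intro add_left_mono mult_left_mono) auto
      finally show ?case by (simp add: algebra_simps)
    qed
  qed

  have e3: "(\<lambda>N. expectation (\<lambda>\<omega>. u (Z N N \<omega>))) \<longlonglongrightarrow> expectation (\<lambda>\<omega>. indicator (alive c d T) \<omega> * u (X T \<omega>))"
  proof (rule integral_dominated_convergence[where w="\<lambda>_. C"])
    show "AE \<omega> in M. (\<lambda>N. u (Z N N \<omega>)) \<longlonglongrightarrow> indicator (alive c d T) \<omega> * u (X T \<omega>)"
      using X_0 AE_space by eventually_elim (unfold Z_def, rule killed_sum_tendsto[OF T x _ _ Lipschitz(1) u0 C0])
  qed (use u_bound in auto)

  have e5: "S' \<longlonglongrightarrow> expectation (\<lambda>\<omega>. LBINT s:{0..T}. indicator (alive c d s) \<omega> * g (X s \<omega>))"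
  proof -
    define R where "R = (\<lambda>N \<omega>. \<Sum>i<N. T / real N * (indicator (?A N i) \<omega> * g (X (?t N i) \<omega>)))"
    have lim: "(\<lambda>N. R N \<omega>) \<longlonglongrightarrow> (LBINT s:{0..T}. indicator (alive c d s) \<omega> * g (X s \<omega>))" if \<omega>: "\<omega> \<in> space M" for \<omega>
    proof -
      have ci: "continuous_on {0..T} (\<lambda>s. g (X s \<omega>))"
        by (auto intro!: continuous_on_compose2[OF g_cont] continuous_on_subset[OF X_cont[OF \<omega>]])
      have ob: "of_bool (\<omega> \<in> alive c d s) = (indicator (alive c d s) \<omega> :: real)" for s by (simp add: indicator_def)
      show ?thesis
        using riemann_sum_killed[OF T ci, of "\<lambda>s. \<omega> \<in> alive c d s"] alive_mono unfolding R_def ob by blast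
    qed
    have [measurable]: "R N \<in> borel_measurable M" for N unfolding R_def by measurable
    have "(\<lambda>N. expectation (R N)) \<longlonglongrightarrow> expectation (\<lambda>\<omega>. LBINT s:{0..T}. indicator (alive c d s) \<omega> * g (X s \<omega>))"
    proof (rule integral_dominated_convergence[where w="\<lambda>_. T * B"])
      show "(\<lambda>\<omega>. LBINT s:{0..T}. indicator (alive c d s) \<omega> * g (X s \<omega>)) \<in> borel_measurable M"
        by (rule borel_measurable_LIMSEQ_real[OF lim]) auto
      show "AE \<omega> in M. norm (R N \<omega>) \<le> T * B" for N
      proof (rule AE_I2)
        fix \<omega>
        have "\<bar>R N \<omega>\<bar> \<le> (\<Sum>i<N. T / real N * B)"
          unfolding R_def
        proof (rule order_trans[OF sum_abs sum_mono])
          fix i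
          have "\<bar>T / real N\<bar> = T / real N" using T by simp
          then show "\<bar>T / real N * (indicator (?A N i) \<omega> * g (X (?t N i) \<omega>))\<bar> \<le> T / real N * B"
            unfolding abs_mult[of "T / real N"] using mult_left_mono[OF H_bound[of N i \<omega>], of "T / real N"] T by simp
        qed
        also have "\<dots> \<le> T * B" using T B0 by simp
        finally show "norm (R N \<omega>) \<le> T * B" by simp
      qed
    qed (use lim in \<open>auto\<close>)
    moreover have "expectation (R N) = S' N" for N
    proof -
      have "integrable M (\<lambda>\<omega>. indicator (?A N i) \<omega> * g (X (?t N i) \<omega>))" for i
        by (rule bounded_integrable[where B=B]) (use H_bound in auto)
      then show ?thesis unfolding R_def S'_def h_def by simp
    qed
    ultimately show ?thesis by simp
  qed

  \<comment> \<open>In this combination everything that contains \<open>Y\<close> or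
    \<open>S\<close> cancels.\<close>
  have "(\<lambda>N. (expectation (\<lambda>\<omega>. u (Y N N \<omega>)) - u x - S N)
      - (expectation (\<lambda>\<omega>. u (Y N N \<omega>)) - expectation (\<lambda>\<omega>. u (Z N N \<omega>))) + (S N - S' N))
    \<longlonglongrightarrow> 0 - 0 + 0"
    by (intro tendsto_add tendsto_diff e1 e2 e4)
  then have lim1: "(\<lambda>N. expectation (\<lambda>\<omega>. u (Z N N \<omega>)) - u x - S' N) \<longlonglongrightarrow> 0"
    by (simp add: algebra_simps)
  have lim2: "(\<lambda>N. expectation (\<lambda>\<omega>. u (Z N N \<omega>)) - u x - S' N)
    \<longlonglongrightarrow> expectation (\<lambda>\<omega>. indicator (alive c d T) \<omega> * u (X T \<omega>)) - u x
      - expectation (\<lambda>\<omega>. LBINT s:{0..T}. indicator (alive c d s) \<omega> * g (X s \<omega>))"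
    by (intro tendsto_diff e3 e5 tendsto_const)
  from LIMSEQ_unique[OF lim2 lim1] show ?thesis by simp
qed

section \<open>Scale function and Green function\<close>

lemma uniformly_continuous_mult_bounded:
  fixes f g :: "real \<Rightarrow> real"
  assumes f: "uniformly_continuous_on UNIV f" "\<And>y. \<bar>f y\<bar> \<le> B"
    and g: "uniformly_continuous_on UNIV g" "\<And>y. \<bar>g y\<bar> \<le> B"
  shows "uniformly_continuous_on UNIV (\<lambda>y. f y * g y)"
  unfolding uniformly_continuous_on_def
proof (intro allI impI)
  fix e :: real assume e: "0 < e"
  have B: "0 \<le> B" using f(2)[of 0] by linarith
  define e' where "e' = e / (2 * B + 1)"
  have e': "0 < e'" using e B by (simp add: e'_def)
  obtain d1 where d1: "0 < d1" "\<And>y z. dist z y < d1 \<Longrightarrow> dist (f z) (f y) < e'"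
    using f(1) e' unfolding uniformly_continuous_on_def by (metis UNIV_I)
  obtain d2 where d2: "0 < d2" "\<And>y z. dist z y < d2 \<Longrightarrow> dist (g z) (g y) < e'"
    using g(1) e' unfolding uniformly_continuous_on_def by (metis UNIV_I)
  show "\<exists>d>0. \<forall>y\<in>UNIV. \<forall>z\<in>UNIV. dist z y < d \<longrightarrow> dist (f z * g z) (f y * g y) < e"
  proof (intro exI[of _ "min d1 d2"] conjI ballI impI)
    fix y z :: real assume yz: "dist z y < min d1 d2"
    have "\<bar>f z * g z - f y * g y\<bar> = \<bar>f z * (g z - g y) + g y * (f z - f y)\<bar>" by (simp add: algebra_simps)
    also have "\<dots> \<le> \<bar>f z\<bar> * \<bar>g z - g y\<bar> + \<bar>g y\<bar> * \<bar>f z - f y\<bar>"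
      using abs_triangle_ineq[of "f z * (g z - g y)" "g y * (f z - f y)"] by (simp add: abs_mult)
    also have "\<dots> \<le> B * e' + B * e'"
      using d1(2)[of z y] d2(2)[of z y] yz f(2) g(2) B by (intro add_mono mult_mono) (auto simp: dist_real_def)
    also have "\<dots> < (2 * B + 1) * e'" using e' by (simp add: algebra_simps)
    also have "\<dots> = e" using B by (simp add: e'_def)
    finally show "dist (f z * g z) (f y * g y) < e" by (simp add: dist_real_def)
  qed (use d1 d2 in auto)
qed

lemma has_real_derivative_three_pieces:
  fixes v :: "real \<Rightarrow> real"
  assumes cd: "c < d"
    and 1: "y \<le> c \<Longrightarrow> (v has_real_derivative D) (at y within {..c})"
    and 2: "c \<le> y \<Longrightarrow> y \<le> d \<Longrightarrow> (v has_real_derivative D) (at y within {c..d})"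
    and 3: "d \<le> y \<Longrightarrow> (v has_real_derivative D) (at y within {d..})"
  shows "(v has_real_derivative D) (at y)"
proof -
  have "(v has_real_derivative D) (at y within S)"
    if "closed S" "y \<in> S \<Longrightarrow> (v has_real_derivative D) (at y within S)" for S
  proof (cases "y \<in> S")
    case False
    \<comment> \<open>Off a closed set the filter is trivial, so a piece that misses y imposes
      nothing.\<close>
    then have "at y within S = bot" using that(1) not_in_closure_trivial_limitI[of y S] by simp
    then show ?thesis by (simp add: has_field_derivative_iff)
  qed (use that in simp)
  from this[of "{..c}"] this[of "{c..d}"] this[of "{d..}"]
  have "(v has_real_derivative D) (at y within {..c})" "(v has_real_derivative D) (at y within {c..d})"
    "(v has_real_derivative D) (at y within {d..})" using 1 2 3 by auto
  then have "(v has_real_derivative D) (at y within ({..c} \<union> {c..d}) \<union> {d..})"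
    unfolding has_field_derivative_iff by (intro Lim_Un)
  moreover have "({..c} \<union> {c..d}) \<union> {d..} = UNIV" using cd by auto
  ultimately show ?thesis by simp
qed

lemma has_real_derivative_cong_on:
  fixes v g :: "real \<Rightarrow> real"
  assumes "y \<in> S" "\<And>z. z \<in> S \<Longrightarrow> v z = g z" "(g has_real_derivative D) (at y within S)"
  shows "(v has_real_derivative D) (at y within S)"
  using has_derivative_transform[of y S v g "(*) D"] assms by (simp add: has_field_derivative_def)

text \<open>Outside \<open>[c, d]\<close> the function is continued by a combination of \<open>1\<close>, \<open>sin\<close> and \<open>cos\<close> with
  matching two-jet at the endpoint.\<close>

lemma test_function_extension:
  fixes u u1 u2 :: "real \<Rightarrow> real"
  assumes cd: "c < d" and du: "\<And>y. (u has_real_derivative u1 y) (at y)"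
    and du1: "\<And>y. (u1 has_real_derivative u2 y) (at y)" and cu2: "continuous_on UNIV u2"
  obtains v v1 v2 C where "test_function v v1 v2 C"
    "\<And>y. y \<in> {c..d} \<Longrightarrow> v y = u y \<and> v1 y = u1 y \<and> v2 y = u2 y"
proof -
  \<comment> \<open>\<open>r\<close> projects onto \<open>{c..d}\<close> and \<open>e\<close> is the
    signed overshoot, zero inside, so one formula covers all three pieces. The four terms of
    \<open>v\<close> account for the bound \<open>4 * B\<close>.\<close>
  define r where "r = (\<lambda>y. max c (min d y))"
  define e where "e = (\<lambda>y. y - r y)"
  have rcd: "r y \<in> {c..d}" for y using cd by (auto simp: r_def)
  define v where "v = (\<lambda>y. u (r y) + u2 (r y) + u1 (r y) * sin (e y) - u2 (r y) * cos (e y))"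
  define v1 where "v1 = (\<lambda>y. u1 (r y) * cos (e y) + u2 (r y) * sin (e y))"
  define v2 where "v2 = (\<lambda>y. u2 (r y) * cos (e y) - u1 (r y) * sin (e y))"
  have lo: "r y = c" "e y = y - c" if "y \<le> c" for y using that cd by (auto simp: r_def e_def)
  have mid: "r y = y" "e y = 0" if "c \<le> y" "y \<le> d" for y using that by (auto simp: r_def e_def)
  have hi: "r y = d" "e y = y - d" if "d \<le> y" for y using that cd by (auto simp: r_def e_def)
  have agree: "v y = u y \<and> v1 y = u1 y \<and> v2 y = u2 y" if "y \<in> {c..d}" for y
    using that mid by (simp add: v_def v1_def v2_def)
  have "continuous_on UNIV u" "continuous_on UNIV u1"
    using du du1 by (meson DERIV_isCont continuous_at_imp_continuous_on)+
  then have cont: "continuous_on {c..d} u" "continuous_on {c..d} u1" "continuous_on {c..d} u2"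
    using cu2 continuous_on_subset by blast+
  then have "bounded (u ` {c..d} \<union> u1 ` {c..d} \<union> u2 ` {c..d})"
    by (auto intro!: compact_imp_bounded compact_continuous_image)
  then obtain B where "\<And>z. z \<in> u ` {c..d} \<union> u1 ` {c..d} \<union> u2 ` {c..d} \<Longrightarrow> \<bar>z\<bar> \<le> B"
    unfolding bounded_iff real_norm_def by blast
  then have B: "\<bar>u (r y)\<bar> \<le> B" "\<bar>u1 (r y)\<bar> \<le> B" "\<bar>u2 (r y)\<bar> \<le> B" for y using rcd by auto
  have B0: "0 \<le> B" using B(1)[of 0] by linarith
  have trig: "\<bar>w * sin t\<bar> \<le> B" "\<bar>w * cos t\<bar> \<le> B" if "\<bar>w\<bar> \<le> B" for w t
    using mult_mono[OF that abs_sin_le_one[of t]] mult_mono[OF that abs_cos_le_one[of t]] B0 by (auto simp: abs_mult)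
  have r_lip: "\<bar>r y - r z\<bar> \<le> \<bar>y - z\<bar>" for y z unfolding r_def by (auto simp: max_def min_def)
  have r_uc: "uniformly_continuous_on UNIV r"
    unfolding uniformly_continuous_on_def dist_real_def using r_lip by (meson le_less_trans)
  have comp: "uniformly_continuous_on UNIV (\<lambda>y. w (r y))" if "continuous_on {c..d} w" for w :: "real \<Rightarrow> real"
  proof (rule uniformly_continuous_on_compose[OF r_uc])
    show "uniformly_continuous_on (range r) w"
      using compact_uniformly_continuous[OF that] rcd unfolding uniformly_continuous_on_def
      by (metis compact_Icc rangeE)
  qed
  have e_uc: "uniformly_continuous_on UNIV e"
    unfolding e_def by (intro uniformly_continuous_on_diff uniformly_continuous_on_id r_uc)
  have sc: "uniformly_continuous_on A sin" "uniformly_continuous_on A cos" for A :: "real set"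
  proof -
    have "\<bar>sin x - sin y\<bar> \<le> 1 * \<bar>x - y\<bar>" "\<bar>cos x - cos y\<bar> \<le> 1 * \<bar>x - y\<bar>" for x y :: real
      using field_differentiable_bound[of UNIV sin cos 1 x y] field_differentiable_bound[of UNIV cos "\<lambda>x. - sin x" 1 x y]
      by (auto intro!: derivative_eq_intros)
    then show "uniformly_continuous_on A sin" "uniformly_continuous_on A cos"
      unfolding uniformly_continuous_on_def dist_real_def by (metis le_less_trans mult_1)+
  qed
  have "uniformly_continuous_on UNIV (\<lambda>y. u2 (r y) * cos (e y))" "uniformly_continuous_on UNIV (\<lambda>y. u1 (r y) * sin (e y))"
    using B B0 abs_sin_le_one abs_cos_le_one
    by (auto intro!: uniformly_continuous_mult_bounded[where B="max B 1"] comp cont uniformly_continuous_on_compose[OF e_uc] sc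
        simp: le_max_iff_disj)
  then have v2_uc: "uniformly_continuous_on UNIV v2" unfolding v2_def by (rule uniformly_continuous_on_diff)
  have dv: "(v has_real_derivative v1 y) (at y)" for y
  proof (rule has_real_derivative_three_pieces[OF cd])
    show "(v has_real_derivative v1 y) (at y within {..c})" if "y \<le> c"
      by (rule has_real_derivative_cong_on[where g="\<lambda>y. u c + u2 c + u1 c * sin (y - c) - u2 c * cos (y - c)"])
        (use that in \<open>auto simp: v_def v1_def lo intro!: derivative_eq_intros\<close>)
    show "(v has_real_derivative v1 y) (at y within {d..})" if "d \<le> y"
      by (rule has_real_derivative_cong_on[where g="\<lambda>y. u d + u2 d + u1 d * sin (y - d) - u2 d * cos (y - d)"])
        (use that in \<open>auto simp: v_def v1_def hi intro!: derivative_eq_intros\<close>)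
    show "(v has_real_derivative v1 y) (at y within {c..d})" if "c \<le> y" "y \<le> d"
      by (rule has_real_derivative_cong_on[where g=u])
        (use that agree du in \<open>auto simp: has_field_derivative_at_within\<close>)
  qed
  have dv1: "(v1 has_real_derivative v2 y) (at y)" for y
  proof (rule has_real_derivative_three_pieces[OF cd])
    show "(v1 has_real_derivative v2 y) (at y within {..c})" if "y \<le> c"
      by (rule has_real_derivative_cong_on[where g="\<lambda>y. u1 c * cos (y - c) + u2 c * sin (y - c)"])
        (use that in \<open>auto simp: v1_def v2_def lo intro!: derivative_eq_intros\<close>)
    show "(v1 has_real_derivative v2 y) (at y within {d..})" if "d \<le> y"
      by (rule has_real_derivative_cong_on[where g="\<lambda>y. u1 d * cos (y - d) + u2 d * sin (y - d)"])
        (use that in \<open>auto simp: v1_def v2_def hi intro!: derivative_eq_intros\<close>)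
    show "(v1 has_real_derivative v2 y) (at y within {c..d})" if "c \<le> y" "y \<le> d"
      by (rule has_real_derivative_cong_on[where g=u1])
        (use that agree du1 in \<open>auto simp: has_field_derivative_at_within\<close>)
  qed
  have "test_function v v1 v2 (4 * B)"
  proof
    fix y
    note t = trig[OF B(2), of y "e y"] trig[OF B(3), of y "e y"]
    show "\<bar>v y\<bar> \<le> 4 * B" unfolding v_def using t(1,4) B(1)[of y] B(3)[of y] by linarith
    show "\<bar>v1 y\<bar> \<le> 4 * B" unfolding v1_def using t B0 by linarith
    show "\<bar>v2 y\<bar> \<le> 4 * B" unfolding v2_def using t B0 by linarith
  qed (use dv dv1 v2_uc in auto)
  then show ?thesis using agree that by blast
qed

section \<open>The scale function: antiderivatives, monotone limits, change of base point\<close>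

lemma antiderivative:
  assumes g: "continuous_on UNIV (g :: real \<Rightarrow> real)"
  shows "((\<lambda>y. LBINT t=ereal w..ereal y. g t) has_real_derivative g y) (at y)"
proof -
  define l where "l = min w y - 1"
  define m where "m = max w y + 1"
  have "((\<lambda>y. LBINT t=ereal w..ereal y. g t) has_vector_derivative g y) (at y within {l..m})"
    by (rule interval_integral_FTC2) (auto simp: l_def m_def intro: continuous_on_subset[OF g])
  moreover have "at y within {l..m} = at y" by (rule at_within_Icc_at) (auto simp: l_def m_def)
  ultimately show ?thesis by (simp add: has_real_derivative_iff_has_vector_derivative)
qed

lemma LBINT_antiderivative:
  assumes g: "continuous_on UNIV (g :: real \<Rightarrow> real)" and G: "\<And>y. (G has_real_derivative g y) (at y)"
  shows "(LBINT t=ereal v..ereal w. g t) = G w - G v"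
  by (rule interval_integral_FTC_finite)
    (use G in \<open>auto intro: continuous_on_subset[OF g] simp: has_real_derivative_iff_has_vector_derivative has_vector_derivative_at_within\<close>)

lemma mono_tendsto_Sup:
  fixes f :: "real \<Rightarrow> ereal"
  assumes "mono f"
  shows "(f \<longlongrightarrow> (SUP y. f y)) at_top"
proof (rule order_tendstoI)
  fix l assume "l < (SUP y. f y)"
  then obtain y where "l < f y" by (auto simp: less_SUP_iff)
  then show "\<forall>\<^sub>F y in at_top. l < f y"
    using assms by (intro eventually_at_top_linorderI[of y]) (auto dest: monoD intro: less_le_trans)
qed (auto intro!: always_eventually intro: le_less_trans[OF SUP_upper])

lemma mono_tendsto_Inf:
  fixes f :: "real \<Rightarrow> ereal"
  assumes "mono f"
  shows "(f \<longlongrightarrow> (INF y. f y)) at_bot"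
proof (rule order_tendstoI)
  fix l assume "(INF y. f y) < l"
  then obtain y where y: "f y < l" by (auto simp: INF_less_iff)
  show "\<forall>\<^sub>F y in at_bot. f y < l"
    unfolding eventually_at_bot_linorder using y assms by (intro exI[of _ y]) (auto dest: monoD intro: le_less_trans)
qed (auto intro!: always_eventually intro: less_le_trans[OF _ INF_lower])

locale diffusion_scale =
  fixes a b :: "real \<Rightarrow> real"
  assumes a_continuous: "continuous_on UNIV a" and b_continuous: "continuous_on UNIV b" and a_nonzero: "\<And>y. a y \<noteq> 0"
begin

definition p :: "real \<Rightarrow> real" where "p = phi a b 0"
definition s :: "real \<Rightarrow> real" where "s = Phi a b 0"

lemma ratio_continuous: "continuous_on UNIV (\<lambda>u. b u / (a u)\<^sup>2)"
  using a_continuous b_continuous a_nonzero by (intro continuous_intros) auto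

lemma p_pos: "0 < p y"
  by (simp add: p_def phi_def)

lemma p_deriv: "(p has_real_derivative (- 2 * (b y / (a y)\<^sup>2) * p y)) (at y)"
  unfolding p_def phi_def using antiderivative[OF ratio_continuous, of 0 y]
  by (auto intro!: derivative_eq_intros)

lemma p_continuous: "continuous_on A p"
  using p_deriv by (meson DERIV_isCont continuous_at_imp_continuous_on)

text \<open>The exponent is additive in its integration range. Hence every base point reduces to 0,
  and \<open>phi\<close> and \<open>Phi\<close> can be expressed by \<open>p\<close> and
  \<open>s\<close>.\<close>

lemma phi_eq: "phi a b v w = p w / p v"
proof -
  have "(LBINT u=ereal v..ereal w. b u / (a u)\<^sup>2)
    = (LBINT u=ereal 0..ereal w. b u / (a u)\<^sup>2) - (LBINT u=ereal 0..ereal v. b u / (a u)\<^sup>2)"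
    by (rule LBINT_antiderivative[OF ratio_continuous antiderivative[OF ratio_continuous]])
  then show ?thesis unfolding p_def phi_def by (simp add: exp_diff[symmetric])
qed

lemma s_deriv: "(s has_real_derivative p y) (at y)"
  unfolding s_def Phi_def p_def[symmetric] by (rule antiderivative[OF p_continuous])

lemma s_continuous: "continuous_on A s"
  using s_deriv by (meson DERIV_isCont continuous_at_imp_continuous_on)

lemma Phi_eq: "Phi a b v w = (s w - s v) / p v"
proof -
  have "Phi a b v w = (LBINT z=ereal v..ereal w. p z / p v)" by (simp add: Phi_def phi_eq)
  also have "\<dots> = s w / p v - s v / p v"
    by (rule LBINT_antiderivative) (auto intro!: continuous_intros p_continuous derivative_eq_intros s_deriv simp: p_pos less_imp_neq[symmetric])
  finally show ?thesis by (simp add: diff_divide_distrib)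
qed

lemma s_less: "v < w \<Longrightarrow> s v < s w"
  by (rule DERIV_pos_imp_increasing) (use s_deriv p_pos in blast)+

lemma s_le: "v \<le> w \<Longrightarrow> s v \<le> s w"
  using s_less[of v w] by (cases "v = w") auto

lemma s_mono: "mono (\<lambda>y. ereal (s y))"
  by (rule monoI) (simp add: s_le)

text \<open>\<open>Phi_pinf\<close> is a \<open>Lim\<close> and carries information only once a
  limit exists; monotonicity of \<open>s\<close> provides it. The supremum lies between
  \<open>s 0\<close> and infinity, so it is a real number S, and S yields \<open>Phi_pinf\<close> at
  every base point.\<close>

lemma s_tendsto_at_top:
  assumes "Phi_pinf a b 0 < \<infinity>"
  obtains S where "(s \<longlongrightarrow> S) at_top" "\<forall>y. s y < S" "\<forall>y. Phi_pinf a b y = ereal ((S - s y) / p y)"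
proof -
  have lim: "((\<lambda>y. ereal (s y)) \<longlongrightarrow> (SUP y. ereal (s y))) at_top" by (rule mono_tendsto_Sup[OF s_mono])
  have "Phi_pinf a b 0 = (SUP y. ereal (s y))"
    unfolding Phi_pinf_def s_def[symmetric] by (rule tendsto_Lim[OF _ lim]) simp
  then have "(SUP y. ereal (s y)) < \<infinity>" using assms by simp
  moreover have "ereal (s 0) \<le> (SUP y. ereal (s y))" by (rule SUP_upper) simp
  ultimately obtain S where S: "(SUP y. ereal (s y)) = ereal S"
    by (cases "SUP y. ereal (s y)") auto
  then have sS: "(s \<longlongrightarrow> S) at_top" using lim by simp
  show ?thesis
  proof (rule that[OF sS]; intro allI)
    fix y
    have "ereal (s (y + 1)) \<le> (SUP y. ereal (s y))" by (rule SUP_upper) simp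
    then show "s y < S" using s_less[of y "y + 1"] S by simp
    have "((\<lambda>w. ereal (Phi a b y w)) \<longlongrightarrow> ereal ((S - s y) / p y)) at_top"
      unfolding Phi_eq lim_ereal using p_pos[of y] by (intro tendsto_intros sS) auto
    then show "Phi_pinf a b y = ereal ((S - s y) / p y)"
      unfolding Phi_pinf_def by (rule tendsto_Lim[rotated]) simp
  qed
qed

lemma s_at_bot:
  assumes "Phi_minf a b 0 = - \<infinity>"
  shows "LIM y at_bot. s y :> at_bot"
proof -
  have lim: "((\<lambda>y. ereal (s y)) \<longlongrightarrow> (INF y. ereal (s y))) at_bot" by (rule mono_tendsto_Inf[OF s_mono])
  have "Phi_minf a b 0 = (INF y. ereal (s y))"
    unfolding Phi_minf_def s_def[symmetric] by (rule tendsto_Lim[OF _ lim]) simp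
  then have "((\<lambda>y. ereal (s y)) \<longlongrightarrow> - \<infinity>) at_bot" using lim assms by simp
  then have "\<forall>\<^sub>F y in at_bot. s y < Z" for Z
    using order_tendstoD(2)[of "\<lambda>y. ereal (s y)" "- \<infinity>" at_bot "ereal Z"] by simp
  then show ?thesis by (simp add: filterlim_at_bot_dense)
qed

text \<open>The factor \<open>2 / ((a y)^2 * p y)\<close> is the speed density, which makes this a
  density with respect to Lebesgue measure; inside the interval, the remaining kernel is symmetric
  in x and y.\<close>

definition green :: "real \<Rightarrow> real \<Rightarrow> real \<Rightarrow> real \<Rightarrow> real" where
  "green c d x y = indicator {c..d} y * (2 * (s (min x y) - s c) * (s d - s (max x y)) / ((s d - s c) * ((a y)\<^sup>2 * p y)))"

lemma green_nonneg: "c \<le> x \<Longrightarrow> x \<le> d \<Longrightarrow> 0 \<le> green c d x y"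
  unfolding green_def using s_le p_pos[of y] s_le[of c d]
  by (auto simp: indicator_def intro!: divide_nonneg_nonneg mult_nonneg_nonneg less_imp_le[OF p_pos])

lemma green_measurable [measurable]: "green c d x \<in> borel_measurable borel"
proof -
  have [measurable]: "s \<in> borel_measurable borel" "p \<in> borel_measurable borel" "a \<in> borel_measurable borel"
    using s_continuous p_continuous a_continuous by (auto intro: borel_measurable_continuous_onI)
  show ?thesis unfolding green_def by measurable
qed

text \<open>Variation of parameters with the two harmonic functions \<open>s - s c\<close> and
  \<open>s d - s\<close>, each vanishing at one endpoint. Continuity of \<open>f\<close> makes the
  solution twice continuously differentiable, so that it can be extended to a test function.\<close>

lemma green_solution:
  assumes cd: "c < d" and f: "continuous_on UNIV f" "\<And>y. 0 \<le> f y"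
  obtains u u1 u2 C where "test_function u u1 u2 C" "u c = 0" "u d = 0"
    "\<forall>y\<in>{c..d}. u1 y * b y + u2 y * (a y)\<^sup>2 / 2 = - f y" "\<forall>y\<in>{c..d}. 0 \<le> u y"
    "\<forall>y\<in>{c..d}. (\<integral>\<^sup>+z. ennreal (f z * green c d y z) \<partial>lborel) = ennreal (u y)"
proof -
  define m where "m = (\<lambda>y. 2 * f y / ((a y)\<^sup>2 * p y))"
  have m_cont: "continuous_on UNIV m"
    unfolding m_def using a_nonzero p_pos
    by (intro continuous_intros f a_continuous p_continuous) (auto simp: less_imp_neq[symmetric])
  have m0: "0 \<le> m y" for y unfolding m_def using f(2) p_pos[of y] by simp
  define m1 where "m1 = (\<lambda>y. (s y - s c) * m y)"
  define m2 where "m2 = (\<lambda>y. (s d - s y) * m y)"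
  have m12_cont: "continuous_on UNIV m1" "continuous_on UNIV m2"
    unfolding m1_def m2_def by (intro continuous_intros s_continuous m_cont)+
  then have [measurable]: "m1 \<in> borel_measurable borel" "m2 \<in> borel_measurable borel"
    by (auto intro: borel_measurable_continuous_onI)
  define P1 where "P1 = (\<lambda>y. LBINT t=ereal c..ereal y. m1 t)"
  \<comment> \<open>Integrated from d, so \<open>P2\<close> is nonpositive on the interval; this
    explains the minus signs in front of it below.\<close>
  define P2 where "P2 = (\<lambda>y. LBINT t=ereal d..ereal y. m2 t)"
  have dP: "(P1 has_real_derivative m1 y) (at y)" "(P2 has_real_derivative m2 y) (at y)" for y
    unfolding P1_def P2_def by (rule antiderivative, rule m12_cont)+
  have P0: "P1 c = 0" "P2 d = 0"
    using LBINT_antiderivative[OF m12_cont(1) dP(1), of c c] LBINT_antiderivative[OF m12_cont(2) dP(2), of d d]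
    by (simp_all add: P1_def P2_def)
  define \<Delta> where "\<Delta> = s d - s c"
  have \<Delta>: "0 < \<Delta>" using s_less[OF cd] by (simp add: \<Delta>_def)
  define u where "u = (\<lambda>y. ((s d - s y) * P1 y - (s y - s c) * P2 y) / \<Delta>)"
  define u1 where "u1 = (\<lambda>y. - p y * (P1 y + P2 y) / \<Delta>)"
  define u2 where "u2 = (\<lambda>y. 2 * (b y / (a y)\<^sup>2) * p y * (P1 y + P2 y) / \<Delta> - p y * m y)"
  have du: "(u has_real_derivative u1 y) (at y)" for y
  proof -
    have "(u has_real_derivative ((0 - p y) * P1 y + m1 y * (s d - s y) - ((p y - 0) * P2 y + m2 y * (s y - s c))) / \<Delta>) (at y)"
      unfolding u_def by (intro DERIV_cdivide DERIV_diff DERIV_mult DERIV_const s_deriv dP)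
    \<comment> \<open>The terms with \<open>m1\<close> and \<open>m2\<close> cancel: both are
      \<open>(s y - s c) * (s d - s y) * m y\<close>.\<close>
    moreover have "((0 - p y) * P1 y + m1 y * (s d - s y) - ((p y - 0) * P2 y + m2 y * (s y - s c))) / \<Delta> = u1 y"
      unfolding u1_def m1_def m2_def by (simp add: algebra_simps)
    ultimately show ?thesis by simp
  qed
  have du1: "(u1 has_real_derivative u2 y) (at y)" for y
  proof -
    have "(u1 has_real_derivative (- (- 2 * (b y / (a y)\<^sup>2) * p y) * (P1 y + P2 y) + (m1 y + m2 y) * (- p y)) / \<Delta>) (at y)"
      unfolding u1_def by (intro DERIV_cdivide DERIV_add DERIV_mult DERIV_minus p_deriv dP)
    moreover have "(- (- 2 * (b y / (a y)\<^sup>2) * p y) * (P1 y + P2 y) + (m1 y + m2 y) * (- p y)) / \<Delta> = u2 y"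
    proof -
      \<comment> \<open>Divided by \<Delta> this sum is \<open>m y\<close>, the origin of the source
        term \<open>- p y * m y\<close> in \<open>u2\<close>.\<close>
      have "m1 y + m2 y = \<Delta> * m y" by (simp add: m1_def m2_def \<Delta>_def algebra_simps)
      then show ?thesis using \<Delta> by (simp add: u2_def diff_divide_distrib)
    qed
    ultimately show ?thesis by simp
  qed
  have P_cont: "continuous_on UNIV P1" "continuous_on UNIV P2"
    using dP by (meson DERIV_isCont continuous_at_imp_continuous_on)+
  have cu2: "continuous_on UNIV u2"
    unfolding u2_def using \<Delta> by (intro continuous_intros ratio_continuous p_continuous P_cont m_cont) auto
  have eq: "u1 y * b y + u2 y * (a y)\<^sup>2 / 2 = - f y" for y
    unfolding u1_def u2_def m_def using a_nonzero[of y] p_pos[of y] \<Delta> by (simp add: field_simps power2_eq_square)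
  have m1_nonneg: "0 \<le> m1 z" if "c \<le> z" for z unfolding m1_def using s_le[OF that] m0 by simp
  have m2_nonneg: "0 \<le> m2 z" if "z \<le> d" for z unfolding m2_def using s_le[OF that] m0 by simp
  have P1_nn: "(\<integral>\<^sup>+z. ennreal (m1 z) * indicator {c..y} z \<partial>lborel) = ennreal (P1 y)" if "c \<le> y" for y
    using nn_integral_FTC_Icc[of m1 c y P1] that dP P0 m1_nonneg by simp
  have P2_nn: "(\<integral>\<^sup>+z. ennreal (m2 z) * indicator {y..d} z \<partial>lborel) = ennreal (- P2 y)" if "y \<le> d" for y
    using nn_integral_FTC_Icc[of m2 y d P2] that dP P0 m2_nonneg by simp
  have P1_ge: "0 \<le> P1 y" if "c \<le> y" for y
    using DERIV_nonneg_imp_nondecreasing[OF that, of P1] dP(1) P0 m1_nonneg by fastforce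
  have P2_le: "P2 y \<le> 0" if "y \<le> d" for y
    using DERIV_nonneg_imp_nondecreasing[OF that, of P2] dP(2) P0 m2_nonneg by fastforce
  have u_eq: "u y = (s d - s y) / \<Delta> * P1 y + (s y - s c) / \<Delta> * (- P2 y)" for y
    using \<Delta> by (simp add: u_def field_simps)
  have coef: "0 \<le> (s d - s y) / \<Delta>" "0 \<le> (s y - s c) / \<Delta>" if "y \<in> {c..d}" for y
    using that s_le \<Delta> by auto
  have u0: "0 \<le> u y" if "y \<in> {c..d}" for y
    unfolding u_eq using coef[OF that] P1_ge P2_le that by (intro add_nonneg_nonneg mult_nonneg_nonneg) auto
  have int: "(\<integral>\<^sup>+z. ennreal (f z * green c d y z) \<partial>lborel) = ennreal (u y)" if y: "y \<in> {c..d}" for y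
  proof -
    have "(\<integral>\<^sup>+z. ennreal (f z * green c d y z) \<partial>lborel)
      = (\<integral>\<^sup>+z. ennreal ((s d - s y) / \<Delta>) * (ennreal (m1 z) * indicator {c..y} z)
         + ennreal ((s y - s c) / \<Delta>) * (ennreal (m2 z) * indicator {y..d} z) \<partial>lborel)"
    proof (rule nn_integral_cong_AE)
      show "AE z in lborel. ennreal (f z * green c d y z) = ennreal ((s d - s y) / \<Delta>) * (ennreal (m1 z) * indicator {c..y} z)
         + ennreal ((s y - s c) / \<Delta>) * (ennreal (m2 z) * indicator {y..d} z)"
        \<comment> \<open>The two integration ranges share the point y.\<close>
        using AE_lborel_singleton[of y]
      proof eventually_elim
        fix z assume zy: "z \<noteq> y"
        consider "z \<notin> {c..d}" | "c \<le> z" "z < y" | "y < z" "z \<le> d" using zy y by fastforce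
        then show "ennreal (f z * green c d y z) = ennreal ((s d - s y) / \<Delta>) * (ennreal (m1 z) * indicator {c..y} z)
         + ennreal ((s y - s c) / \<Delta>) * (ennreal (m2 z) * indicator {y..d} z)"
        proof cases
          case 1
          then show ?thesis using y by (auto simp: green_def indicator_def)
        next
          case 2
          have "f z * green c d y z = (s d - s y) / \<Delta> * m1 z"
            using 2 y by (simp add: green_def m1_def m_def \<Delta>_def min_absorb2 max_absorb1)
          then have "ennreal (f z * green c d y z) = ennreal ((s d - s y) / \<Delta>) * ennreal (m1 z)"
            by (simp only: ennreal_mult'[OF coef(1)[OF y]])
          then show ?thesis using 2 y by simp
        next
          case 3
          have "f z * green c d y z = (s y - s c) / \<Delta> * m2 z"
            using 3 y by (simp add: green_def m2_def m_def \<Delta>_def min_absorb1 max_absorb2) (simp add: algebra_simps)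
          then have "ennreal (f z * green c d y z) = ennreal ((s y - s c) / \<Delta>) * ennreal (m2 z)"
            by (simp only: ennreal_mult'[OF coef(2)[OF y]])
          then show ?thesis using 3 y by simp
        qed
      qed
    qed
    also have "\<dots> = ennreal ((s d - s y) / \<Delta>) * ennreal (P1 y) + ennreal ((s y - s c) / \<Delta>) * ennreal (- P2 y)"
      using y P1_nn[of y] P2_nn[of y] by (subst nn_integral_add) (auto simp: nn_integral_cmult)
    also have "\<dots> = ennreal (u y)"
    proof -
      have "0 \<le> P1 y" "0 \<le> - P2 y" using P1_ge[of y] P2_le[of y] y by auto
      note t = mult_nonneg_nonneg[OF coef(1)[OF y] this(1)] mult_nonneg_nonneg[OF coef(2)[OF y] this(2)]
      show ?thesis
        unfolding u_eq ennreal_plus[OF t] ennreal_mult'[OF coef(1)[OF y]] ennreal_mult'[OF coef(2)[OF y]] ..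
    qed
    finally show ?thesis .
  qed
  obtain v v1 v2 C where v: "test_function v v1 v2 C" "\<And>y. y \<in> {c..d} \<Longrightarrow> v y = u y \<and> v1 y = u1 y \<and> v2 y = u2 y"
    using test_function_extension[OF cd du du1 cu2] by blast
  show ?thesis
    by (rule that[OF v(1)]) (use v(2) cd P0 eq u0 int in \<open>auto simp: u_def\<close>)
qed

end

section \<open>Occupation measures\<close>

locale transient_diffusion = continuous_diffusion M F W a b X I x + diffusion_scale a b
  for M :: "'a measure" and F W a b X I x
begin

sublocale time: pair_sigma_finite lborel M
  by (intro pair_sigma_finite.intro sigma_finite_lborel sigma_finite_measure_axioms)

lemma X_joint_fst_snd [measurable]: "(\<lambda>z. X (max 0 (fst z)) (snd z)) \<in> borel_measurable (borel \<Otimes>\<^sub>M M)"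
  using X_joint by (simp add: case_prod_beta')

lemma alive_pred [measurable]: "Measurable.pred (borel \<Otimes>\<^sub>M M) (\<lambda>z. snd z \<in> alive c d (fst z))"
  using alive_joint[of c d] by (simp add: pred_def)

text \<open>Negative times are excluded explicitly, since \<open>alive\<close> is trivially
  satisfied there; \<open>max 0\<close> is the form in which \<open>X\<close> is jointly
  measurable.\<close>

definition killed_value :: "real \<Rightarrow> real \<Rightarrow> (real \<Rightarrow> real) \<Rightarrow> real \<times> 'a \<Rightarrow> real" where
  "killed_value c d f z = of_bool (0 \<le> fst z \<and> snd z \<in> alive c d (fst z)) * f (X (max 0 (fst z)) (snd z))"

lemma killed_value_measurable [measurable]:
  assumes [measurable]: "f \<in> borel_measurable borel"
  shows "killed_value c d f \<in> borel_measurable (lborel \<Otimes>\<^sub>M M)"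
  unfolding killed_value_def by measurable

lemma killed_value_eq: "0 \<le> t \<Longrightarrow> killed_value c d f (t, \<omega>) = indicator (alive c d t) \<omega> * f (X t \<omega>)"
  by (simp add: killed_value_def max_absorb2 indicator_def)

lemma killed_value_nonneg: "(\<And>y. 0 \<le> f y) \<Longrightarrow> 0 \<le> killed_value c d f z"
  by (simp add: killed_value_def)

lemma killed_value_le:
  assumes "\<And>y. y \<in> {c..d} \<Longrightarrow> f y \<le> B" "0 \<le> B"
  shows "killed_value c d f z \<le> B"
  using assms alive_X[of "fst z" "snd z" c d] by (auto simp: killed_value_def max_absorb2)

text \<open>The continuous \<open>f\<close> is bounded on \<open>{c..d}\<close>, so nothing diverges
  up to a finite time, and the nonnegative integral suited to limits agrees with the expectation in
  Dynkin's formula.\<close>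

lemma killed_occupation_finite:
  assumes T: "0 < T" and f: "continuous_on UNIV f" "\<And>y. 0 \<le> f y"
  shows "(\<integral>\<^sup>+\<omega>. \<integral>\<^sup>+t. ennreal (killed_value c d f (t, \<omega>)) * indicator {0..T} t \<partial>lborel \<partial>M)
    = ennreal (expectation (\<lambda>\<omega>. LBINT t:{0..T}. indicator (alive c d t) \<omega> * f (X t \<omega>)))"
    and "integrable M (\<lambda>\<omega>. LBINT t:{0..T}. indicator (alive c d t) \<omega> * f (X t \<omega>))"
    and "\<And>\<omega>. set_integrable lborel {0..T} (\<lambda>t. killed_value c d f (t, \<omega>))"
proof -
  have "compact (f ` {c..d})" by (intro compact_continuous_image continuous_on_subset[OF f(1)]) auto
  then obtain B0 where B0: "\<And>y. y \<in> {c..d} \<Longrightarrow> \<bar>f y\<bar> \<le> B0"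
    using compact_imp_bounded bounded_iff by (metis imageI real_norm_def)
  define B where "B = max B0 0"
  have B: "0 \<le> B" "\<And>y. y \<in> {c..d} \<Longrightarrow> f y \<le> B" using B0 by (force simp: B_def)+
  have [measurable]: "f \<in> borel_measurable borel" using f by (auto intro: borel_measurable_continuous_onI)
  have bd: "0 \<le> killed_value c d f z" "killed_value c d f z \<le> B" for z
    using killed_value_nonneg[OF f(2)] killed_value_le[OF B(2,1)] by auto
  have eq: "(LBINT t:{0..T}. indicator (alive c d t) \<omega> * f (X t \<omega>)) = (LBINT t. indicator {0..T} t * killed_value c d f (t, \<omega>))" for \<omega>
    unfolding set_lebesgue_integral_def
    by (intro Bochner_Integration.integral_cong) (auto simp: killed_value_eq indicator_def)
  have alt: "\<omega> \<notin> space M \<Longrightarrow> killed_value c d f (t, \<omega>) = 0" for \<omega> t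
    using alive_space[of c d t] by (auto simp: killed_value_def)
  have sec[measurable]: "(\<lambda>t. killed_value c d f (t, \<omega>)) \<in> borel_measurable lborel" for \<omega>
  proof (cases "\<omega> \<in> space M")
    case True
    show ?thesis by (rule measurable_compose[OF measurable_Pair2'[OF True] killed_value_measurable]) measurable
  qed (simp add: alt)
  have swap[measurable]: "(\<lambda>(\<omega>, t). killed_value c d f (t, \<omega>)) \<in> borel_measurable (M \<Otimes>\<^sub>M lborel)"
    using measurable_compose[OF measurable_pair_swap' killed_value_measurable[of f c d]] by (simp add: case_prod_beta')
  have intc: "integrable lborel (\<lambda>t. B * indicator {0..T} t)" using T by (intro integrable_mult_right integrable_real_indicator) auto
  have int1: "integrable lborel (\<lambda>t. indicator {0..T} t * killed_value c d f (t, \<omega>))" for \<omega>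
    by (rule Bochner_Integration.integrable_bound[OF intc]) (use bd B(1) in \<open>auto simp: indicator_def abs_of_nonneg\<close>)
  then show "set_integrable lborel {0..T} (\<lambda>t. killed_value c d f (t, \<omega>))" for \<omega>
    by (simp add: set_integrable_def)
  have le: "(LBINT t. indicator {0..T} t * killed_value c d f (t, \<omega>)) \<le> T * B" for \<omega>
  proof -
    have "(LBINT t. indicator {0..T} t * killed_value c d f (t, \<omega>)) \<le> (LBINT t. B * indicator {0..T} t)"
      by (rule integral_mono[OF int1 intc]) (use bd in \<open>auto simp: indicator_def\<close>)
    then show ?thesis using T by (simp add: mult.commute)
  qed
  have ge: "0 \<le> (LBINT t. indicator {0..T} t * killed_value c d f (t, \<omega>))" for \<omega>
    using bd by (intro Bochner_Integration.integral_nonneg) (auto simp: indicator_def)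
  have int2: "integrable M (\<lambda>\<omega>. LBINT t. indicator {0..T} t * killed_value c d f (t, \<omega>))"
    by (rule bounded_integrable[where B="T * B"]) (use le ge in \<open>auto intro!: lborel.borel_measurable_lebesgue_integral\<close>)
  then show "integrable M (\<lambda>\<omega>. LBINT t:{0..T}. indicator (alive c d t) \<omega> * f (X t \<omega>))" by (simp add: eq)
  have "(\<integral>\<^sup>+t. ennreal (killed_value c d f (t, \<omega>)) * indicator {0..T} t \<partial>lborel)
    = ennreal (LBINT t. indicator {0..T} t * killed_value c d f (t, \<omega>))" for \<omega>
  proof -
    have "(\<integral>\<^sup>+t. ennreal (killed_value c d f (t, \<omega>)) * indicator {0..T} t \<partial>lborel)
      = (\<integral>\<^sup>+t. ennreal (indicator {0..T} t * killed_value c d f (t, \<omega>)) \<partial>lborel)"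
      by (intro nn_integral_cong) (auto simp: indicator_def)
    also have "\<dots> = ennreal (LBINT t. indicator {0..T} t * killed_value c d f (t, \<omega>))"
      using bd by (intro nn_integral_eq_integral int1) (auto simp: indicator_def)
    finally show ?thesis .
  qed
  then show "(\<integral>\<^sup>+\<omega>. \<integral>\<^sup>+t. ennreal (killed_value c d f (t, \<omega>)) * indicator {0..T} t \<partial>lborel \<partial>M)
    = ennreal (expectation (\<lambda>\<omega>. LBINT t:{0..T}. indicator (alive c d t) \<omega> * f (X t \<omega>)))"
    using nn_integral_eq_integral[OF int2] ge by (simp add: eq)
qed

text \<open>A living path stays in \<open>{c..d}\<close>, so the differential equation is needed
  only there; that is all that survives the extension of the solution.\<close>

lemma killed_dynkin:
  assumes T: "0 < T" and x: "x \<in> {c..d}" and tf: "test_function u u1 u2 C" "u c = 0" "u d = 0"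
    and f: "\<forall>y\<in>{c..d}. u1 y * b y + u2 y * (a y)\<^sup>2 / 2 = - f y"
  shows "expectation (\<lambda>\<omega>. LBINT t:{0..T}. indicator (alive c d t) \<omega> * f (X t \<omega>))
    = u x - expectation (\<lambda>\<omega>. indicator (alive c d T) \<omega> * u (X T \<omega>))"
proof -
  have "(LBINT t:{0..T}. indicator (alive c d t) \<omega> * (u1 (X t \<omega>) * b (X t \<omega>) + u2 (X t \<omega>) * (a (X t \<omega>))\<^sup>2 / 2))
    = - (LBINT t:{0..T}. indicator (alive c d t) \<omega> * f (X t \<omega>))" for \<omega>
  proof -
    have "(LBINT t:{0..T}. indicator (alive c d t) \<omega> * (u1 (X t \<omega>) * b (X t \<omega>) + u2 (X t \<omega>) * (a (X t \<omega>))\<^sup>2 / 2))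
      = (LBINT t:{0..T}. - (indicator (alive c d t) \<omega> * f (X t \<omega>)))"
      unfolding set_lebesgue_integral_def
    proof (intro Bochner_Integration.integral_cong refl)
      fix t :: real
      show "indicator {0..T} t *\<^sub>R (indicator (alive c d t) \<omega> * (u1 (X t \<omega>) * b (X t \<omega>) + u2 (X t \<omega>) * (a (X t \<omega>))\<^sup>2 / 2))
        = indicator {0..T} t *\<^sub>R - (indicator (alive c d t) \<omega> * f (X t \<omega>))"
        using f[rule_format, OF alive_X, of t \<omega>] by (auto simp: indicator_def)
    qed
    also have "\<dots> = - (LBINT t:{0..T}. indicator (alive c d t) \<omega> * f (X t \<omega>))"
      unfolding set_lebesgue_integral_def by simp
    finally show ?thesis .
  qed
  then show ?thesis using dynkin[OF T x tf] by simp
qed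

text \<open>Take the source 1. A path alive at T contributes T to the expected lifetime up to T,
  which Dynkin's formula bounds by \<open>u x\<close>; so the survival probability is at most
  \<open>u x / T\<close>.\<close>

lemma alive_prob_tendsto_0:
  assumes cd: "c < d" and x: "x \<in> {c..d}"
  shows "(\<lambda>n. prob (alive c d (real (Suc n)))) \<longlonglongrightarrow> 0"
proof -
  obtain u u1 u2 C where u: "test_function u u1 u2 C" "u c = 0" "u d = 0"
    "\<forall>y\<in>{c..d}. u1 y * b y + u2 y * (a y)\<^sup>2 / 2 = - 1" "\<forall>y\<in>{c..d}. 0 \<le> u y"
    "\<forall>y\<in>{c..d}. (\<integral>\<^sup>+z. ennreal (1 * green c d y z) \<partial>lborel) = ennreal (u y)"
    by (rule green_solution[where f="\<lambda>_. 1", OF cd continuous_on_const zero_le_one])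
  have bound: "T * prob (alive c d T) \<le> u x" if T: "0 < T" for T
  proof -
    note fin = killed_occupation_finite[OF T, of "\<lambda>_. 1" c d]
    have "T * indicator (alive c d T) \<omega> \<le> (LBINT t:{0..T}. indicator (alive c d t) \<omega> * 1)" for \<omega>
    proof -
      have i: "set_integrable lborel {0..T} (\<lambda>t. indicator (alive c d t) \<omega> :: real)"
      proof -
        have "set_integrable lborel {0..T} (\<lambda>t. killed_value c d (\<lambda>_. 1) (t, \<omega>))" by (rule fin(3)) auto
        moreover have "set_integrable lborel {0..T} (\<lambda>t. killed_value c d (\<lambda>_. 1) (t, \<omega>))
          \<longleftrightarrow> set_integrable lborel {0..T} (\<lambda>t. indicator (alive c d t) \<omega> :: real)"
          unfolding set_integrable_def
          by (intro Bochner_Integration.integrable_cong refl) (auto simp: killed_value_eq indicator_def)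
        ultimately show ?thesis by simp
      qed
      have "T * indicator (alive c d T) \<omega> = (LBINT t:{0..T}. indicator (alive c d T) \<omega>)"
        using T by (simp add: set_lebesgue_integral_def)
      also have "\<dots> \<le> (LBINT t:{0..T}. indicator (alive c d t) \<omega>)"
      proof (rule set_integral_mono[OF _ i])
        show "set_integrable lborel {0..T} (\<lambda>t. indicator (alive c d T) \<omega> :: real)"
          by (rule borel_integrable_atLeastAtMost') simp
        show "indicator (alive c d T) \<omega> \<le> (indicator (alive c d t) \<omega> :: real)" if "t \<in> {0..T}" for t
          using alive_mono[of t T \<omega> c d] that by (auto simp: indicator_def)
      qed
      finally show ?thesis by simp
    qed
    moreover have "integrable M (\<lambda>\<omega>. T * indicator (alive c d T) \<omega>)"
      using T alive_sets[of T c d] by (intro bounded_integrable[where B=T]) (auto simp: indicator_def)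
    moreover have "integrable M (\<lambda>\<omega>. LBINT t:{0..T}. indicator (alive c d t) \<omega> * (1::real))" by (rule fin(2)) auto
    ultimately have "expectation (\<lambda>\<omega>. T * indicator (alive c d T) \<omega>) \<le> expectation (\<lambda>\<omega>. LBINT t:{0..T}. indicator (alive c d t) \<omega> * 1)"
      by (intro integral_mono)
    also have "\<dots> = u x - expectation (\<lambda>\<omega>. indicator (alive c d T) \<omega> * u (X T \<omega>))"
      by (rule killed_dynkin[where f="\<lambda>_. 1", OF T x u(1-4)])
    also have "\<dots> \<le> u x"
    proof -
      have "0 \<le> indicator (alive c d T) \<omega> * u (X T \<omega>)" for \<omega>
        using u(5)[rule_format, OF alive_X, of T \<omega>] T by (auto simp: indicator_def)
      then have "0 \<le> expectation (\<lambda>\<omega>. indicator (alive c d T) \<omega> * u (X T \<omega>))"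
        by (intro Bochner_Integration.integral_nonneg) auto
      then show ?thesis by simp
    qed
    finally show ?thesis using alive_sets[of T c d] T by simp
  qed
  show ?thesis
  proof (rule tendsto_sandwich[of "\<lambda>_. 0" _ _ "\<lambda>n. u x * (1 / real (Suc n))"])
    show "\<forall>\<^sub>F n in sequentially. prob (alive c d (real (Suc n))) \<le> u x * (1 / real (Suc n))"
      using bound[of "real (Suc n)" for n] by (intro always_eventually allI) (simp add: field_simps)
    have "(\<lambda>n. u x * (1 / real (Suc n))) \<longlonglongrightarrow> u x * 0" by (intro tendsto_intros LIMSEQ_Suc[OF lim_1_over_n])
    then show "(\<lambda>n. u x * (1 / real (Suc n))) \<longlonglongrightarrow> 0" by simp
  qed auto
qed

text \<open>As T grows, the boundary term in Dynkin's formula is at most \<open>C\<close> times the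
  survival probability and disappears, while the occupation integral increases to its value over all
  times.\<close>

lemma killed_occupation:
  assumes cd: "c < d" and x: "x \<in> {c..d}" and f: "continuous_on UNIV f" "\<And>y. 0 \<le> f y"
  shows "(\<integral>\<^sup>+z. ennreal (killed_value c d f z) \<partial>(lborel \<Otimes>\<^sub>M M)) = (\<integral>\<^sup>+y. ennreal (f y * green c d x y) \<partial>lborel)"
    and "(\<integral>\<^sup>+y. ennreal (f y * green c d x y) \<partial>lborel) < \<infinity>"
proof -
  obtain u u1 u2 C where u: "test_function u u1 u2 C" "u c = 0" "u d = 0"
    "\<forall>y\<in>{c..d}. u1 y * b y + u2 y * (a y)\<^sup>2 / 2 = - f y" "\<forall>y\<in>{c..d}. 0 \<le> u y"
    "\<forall>y\<in>{c..d}. (\<integral>\<^sup>+z. ennreal (f z * green c d y z) \<partial>lborel) = ennreal (u y)"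
    by (rule green_solution[OF cd f])
  show "(\<integral>\<^sup>+y. ennreal (f y * green c d x y) \<partial>lborel) < \<infinity>" using bspec[OF u(6) x] by simp
  interpret test_function u u1 u2 C by (rule u(1))
  have [measurable]: "f \<in> borel_measurable borel" using f by (auto intro: borel_measurable_continuous_onI)
  define occ where "occ = (\<lambda>n. expectation (\<lambda>\<omega>. LBINT t:{0..real (Suc n)}. indicator (alive c d t) \<omega> * f (X t \<omega>)))"
  have occ: "occ n = u x - expectation (\<lambda>\<omega>. indicator (alive c d (real (Suc n))) \<omega> * u (X (real (Suc n)) \<omega>))" for n
    unfolding occ_def by (rule killed_dynkin[OF _ x u(1-4)]) simp
  have "(\<lambda>n. expectation (\<lambda>\<omega>. indicator (alive c d (real (Suc n))) \<omega> * u (X (real (Suc n)) \<omega>))) \<longlonglongrightarrow> 0"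
  proof (rule Lim_null_comparison)
    have "(\<lambda>n. C * prob (alive c d (real (Suc n)))) \<longlonglongrightarrow> C * 0"
      by (intro tendsto_intros alive_prob_tendsto_0 cd x)
    then show "(\<lambda>n. C * prob (alive c d (real (Suc n)))) \<longlonglongrightarrow> 0" by simp
    show "\<forall>\<^sub>F n in sequentially. norm (expectation (\<lambda>\<omega>. indicator (alive c d (real (Suc n))) \<omega> * u (X (real (Suc n)) \<omega>)))
      \<le> C * prob (alive c d (real (Suc n)))"
    proof (rule always_eventually, rule allI)
      fix n
      define T where "T = real (Suc n)"
      have T: "0 \<le> T" by (simp add: T_def)
      have [measurable]: "alive c d T \<in> sets M" "X T \<in> borel_measurable M"
        using alive_sets[OF T] X_measurable[OF T] .
      have b: "\<bar>indicator (alive c d T) \<omega> * u (X T \<omega>)\<bar> \<le> C * indicator (alive c d T) \<omega>" for \<omega>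
        using u_bound by (simp add: indicator_def)
      have "\<bar>expectation (\<lambda>\<omega>. indicator (alive c d T) \<omega> * u (X T \<omega>))\<bar>
        \<le> expectation (\<lambda>\<omega>. \<bar>indicator (alive c d T) \<omega> * u (X T \<omega>)\<bar>)" by (rule integral_abs_bound)
      also have "\<dots> \<le> expectation (\<lambda>\<omega>. C * indicator (alive c d T) \<omega>)"
        using C_nonneg u_bound by (intro integral_mono b bounded_integrable[where B=C]) (auto simp: indicator_def)
      finally show "norm (expectation (\<lambda>\<omega>. indicator (alive c d (real (Suc n))) \<omega> * u (X (real (Suc n)) \<omega>)))
        \<le> C * prob (alive c d (real (Suc n)))" unfolding T_def[symmetric] by simp
    qed
  qed
  then have "(\<lambda>n. u x - expectation (\<lambda>\<omega>. indicator (alive c d (real (Suc n))) \<omega> * u (X (real (Suc n)) \<omega>))) \<longlonglongrightarrow> u x - 0"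
    by (intro tendsto_intros)
  then have lim1: "(\<lambda>n. ennreal (occ n)) \<longlonglongrightarrow> ennreal (u x)"
    unfolding occ by (intro tendsto_ennrealI) simp
  define g where "g = (\<lambda>n z. ennreal (killed_value c d f z) * indicator {0..real (Suc n)} (fst z))"
  have gm[measurable]: "g n \<in> borel_measurable (lborel \<Otimes>\<^sub>M M)" for n unfolding g_def by measurable
  have "(\<lambda>n. \<integral>\<^sup>+z. g n z \<partial>(lborel \<Otimes>\<^sub>M M)) \<longlonglongrightarrow> (\<integral>\<^sup>+z. ennreal (killed_value c d f z) \<partial>(lborel \<Otimes>\<^sub>M M))"
  proof (rule nn_integral_LIMSEQ)
    show "incseq g"
      unfolding incseq_def le_fun_def g_def by (auto intro!: mult_left_mono simp: indicator_def)
    show "g n \<in> borel_measurable (lborel \<Otimes>\<^sub>M M)" for n by measurable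
    fix z :: "real \<times> 'a"
    obtain n0 :: nat where n0: "fst z \<le> real n0" using real_arch_simple by blast
    have "\<forall>\<^sub>F n in sequentially. g n z = ennreal (killed_value c d f z)"
      using eventually_ge_at_top[of n0]
    proof eventually_elim
      case (elim n)
      then have "fst z \<le> real (Suc n)" using n0 by simp
      then show ?case by (cases "0 \<le> fst z") (auto simp: g_def killed_value_def)
    qed
    then show "(\<lambda>n. g n z) \<longlonglongrightarrow> ennreal (killed_value c d f z)" by (rule tendsto_eventually)
  qed
  moreover have "(\<integral>\<^sup>+z. g n z \<partial>(lborel \<Otimes>\<^sub>M M)) = ennreal (occ n)" for n
  proof -
    have "(\<integral>\<^sup>+z. g n z \<partial>(lborel \<Otimes>\<^sub>M M)) = (\<integral>\<^sup>+\<omega>. \<integral>\<^sup>+t. g n (t, \<omega>) \<partial>lborel \<partial>M)"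
      by (rule time.nn_integral_snd[symmetric]) measurable
    then show ?thesis
      using killed_occupation_finite(1)[of "real (Suc n)" f c d] f by (simp add: g_def occ_def)
  qed
  ultimately have "(\<integral>\<^sup>+z. ennreal (killed_value c d f z) \<partial>(lborel \<Otimes>\<^sub>M M)) = ennreal (u x)"
    using lim1 LIMSEQ_unique by simp
  then show "(\<integral>\<^sup>+z. ennreal (killed_value c d f z) \<partial>(lborel \<Otimes>\<^sub>M M)) = (\<integral>\<^sup>+y. ennreal (f y * green c d x y) \<partial>lborel)"
    using bspec[OF u(6) x] by simp
qed

text \<open>Expected time spent in a set, counting only the pairs of time and outcome that satisfy
  P. The killed and the full process differ only in P.\<close>

definition occupation :: "(real \<times> 'a \<Rightarrow> bool) \<Rightarrow> real measure" where
  "occupation P = distr (density (lborel \<Otimes>\<^sub>M M) (\<lambda>z. of_bool (0 \<le> fst z \<and> P z))) borel (\<lambda>z. X (max 0 (fst z)) (snd z))"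

lemma nn_integral_occupation:
  assumes [measurable]: "Measurable.pred (lborel \<Otimes>\<^sub>M M) P" "g \<in> borel_measurable borel"
  shows "(\<integral>\<^sup>+y. g y \<partial>occupation P) = (\<integral>\<^sup>+z. of_bool (0 \<le> fst z \<and> P z) * g (X (max 0 (fst z)) (snd z)) \<partial>(lborel \<Otimes>\<^sub>M M))"
  unfolding occupation_def by (simp add: nn_integral_distr nn_integral_density)

lemma sets_occupation [measurable_cong]: "sets (occupation P) = sets borel"
  by (simp add: occupation_def)

text \<open>Both measures integrate continuous nonnegative functions alike. Their total mass is
  finite, by the source 1, so agreement on the rays \<open>{l<..}\<close> determines them.\<close>

lemma killed_occupation_density:
  assumes cd: "c < d" and x: "x \<in> {c..d}"
  shows "occupation (\<lambda>z. snd z \<in> alive c d (fst z)) = density lborel (\<lambda>y. ennreal (green c d x y))"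
proof -
  let ?\<mu> = "occupation (\<lambda>z. snd z \<in> alive c d (fst z))"
  have eq: "(\<integral>\<^sup>+y. ennreal (f y) \<partial>?\<mu>) = (\<integral>\<^sup>+y. ennreal (f y) * ennreal (green c d x y) \<partial>lborel)"
    "(\<integral>\<^sup>+y. ennreal (f y) \<partial>?\<mu>) < \<infinity>"
    if f: "continuous_on UNIV f" "\<And>y. 0 \<le> f y" for f
  proof -
    have [measurable]: "f \<in> borel_measurable borel" using f by (auto intro: borel_measurable_continuous_onI)
    have "(\<integral>\<^sup>+y. ennreal (f y) \<partial>?\<mu>) = (\<integral>\<^sup>+z. ennreal (killed_value c d f z) \<partial>(lborel \<Otimes>\<^sub>M M))"
      by (subst nn_integral_occupation) (auto intro!: nn_integral_cong simp: killed_value_def)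
    then show "(\<integral>\<^sup>+y. ennreal (f y) \<partial>?\<mu>) = (\<integral>\<^sup>+y. ennreal (f y) * ennreal (green c d x y) \<partial>lborel)"
      "(\<integral>\<^sup>+y. ennreal (f y) \<partial>?\<mu>) < \<infinity>"
      using killed_occupation[OF cd x f] f(2) by (simp_all add: ennreal_mult')
  qed
  have UNIV: "emeasure ?\<mu> UNIV < \<infinity>"
    using eq(2)[of "\<lambda>_. 1"] sets_eq_imp_space_eq[OF sets_occupation] by simp
  show ?thesis
  proof (rule measure_eqI_lessThan)
    fix l :: real
    show "emeasure ?\<mu> {l<..} < \<infinity>"
      using le_less_trans[OF emeasure_mono[of "{l<..}" UNIV ?\<mu>] UNIV] by (simp add: sets_occupation)
    \<comment> \<open>Continuous ramps that increase to the indicator of the open ray.\<close>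
    define f where "f = (\<lambda>n y. min 1 (real n * max 0 (y - l)))"
    have fc: "continuous_on UNIV (f n)" for n unfolding f_def by (intro continuous_intros)
    have f0: "0 \<le> f n y" for n y by (simp add: f_def)
    have [measurable]: "f n \<in> borel_measurable borel" for n using fc by (auto intro: borel_measurable_continuous_onI)
    have finc: "f n y \<le> f m y" if "n \<le> m" for n m y
      unfolding f_def using that by (intro min.mono mult_right_mono) auto
    have flim: "(\<lambda>n. ennreal (f n y)) \<longlonglongrightarrow> indicator {l<..} y" for y
    proof (cases "l < y")
      case True
      obtain n0 :: nat where n0: "1 / (y - l) \<le> real n0" using real_arch_simple by blast
      have "\<forall>\<^sub>F n in sequentially. ennreal (f n y) = indicator {l<..} y"
        using eventually_ge_at_top[of n0]
      proof eventually_elim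
        case (elim n)
        then have "1 / (y - l) \<le> real n" using n0 by (meson of_nat_mono order_trans)
        then have "1 \<le> real n * (y - l)" using True by (simp add: field_simps)
        then show ?case using True by (simp add: f_def)
      qed
      then show ?thesis by (rule tendsto_eventually)
    qed (simp add: f_def)
    have "(\<lambda>n. \<integral>\<^sup>+y. ennreal (f n y) \<partial>?\<mu>) \<longlonglongrightarrow> (\<integral>\<^sup>+y. indicator {l<..} y \<partial>?\<mu>)"
      using finc flim by (intro nn_integral_LIMSEQ) (auto simp: incseq_def le_fun_def intro!: ennreal_leI)
    moreover have "(\<lambda>n. \<integral>\<^sup>+y. ennreal (f n y) * ennreal (green c d x y) \<partial>lborel)
      \<longlonglongrightarrow> (\<integral>\<^sup>+y. indicator {l<..} y * ennreal (green c d x y) \<partial>lborel)"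
    proof (rule nn_integral_LIMSEQ)
      show "incseq (\<lambda>n y. ennreal (f n y) * ennreal (green c d x y))"
        using finc by (auto simp: incseq_def le_fun_def intro!: mult_right_mono ennreal_leI)
      show "(\<lambda>n. ennreal (f n y) * ennreal (green c d x y)) \<longlonglongrightarrow> indicator {l<..} y * ennreal (green c d x y)" for y
        by (intro tendsto_mult_ennreal flim tendsto_const) (simp add: indicator_def)
    qed measurable
    ultimately have "(\<integral>\<^sup>+y. indicator {l<..} y \<partial>?\<mu>) = (\<integral>\<^sup>+y. indicator {l<..} y * ennreal (green c d x y) \<partial>lborel)"
      using eq(1)[OF fc f0] LIMSEQ_unique by simp
    then show "emeasure ?\<mu> {l<..} = emeasure (density lborel (\<lambda>y. ennreal (green c d x y))) {l<..}"
      by (simp add: emeasure_density mult.commute sets_occupation)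
  qed (simp_all add: sets_occupation)
qed

end

context transient_diffusion begin

text \<open>A path is bounded on each finite time span, hence alive in every large interval, so the
  killed occupation measures increase to the full one. On the density side the bound by
  \<open>G\<close> gives one inequality and Fatou's lemma with pointwise convergence the other,
  which avoids proving that the densities increase.\<close>

lemma occupation_density:
  assumes S: "(s \<longlongrightarrow> S) at_top" "\<And>y. s y < S" and bot: "LIM y at_bot. s y :> at_bot"
  shows "occupation (\<lambda>_. True) = density lborel (\<lambda>y. ennreal (2 * (S - s (max x y)) / ((a y)\<^sup>2 * p y)))"
proof (rule measure_eqI)
  define G where "G = (\<lambda>y. 2 * (S - s (max x y)) / ((a y)\<^sup>2 * p y))"
  \<comment> \<open>Ensures that the interval is nondegenerate and contains x for every n.\<close>
  define r where "r = (\<lambda>n. \<bar>x\<bar> + 1 + real n)"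
  have r: "- r n < r n" "x \<in> {- r n..r n}" for n by (auto simp: r_def)
  have r_lim: "filterlim r at_top sequentially"
    unfolding r_def by (intro filterlim_tendsto_add_at_top[OF tendsto_const] filterlim_real_sequentially)
  let ?g = "\<lambda>n. green (- r n) (r n) x"
  have [measurable]: "s \<in> borel_measurable borel" "p \<in> borel_measurable borel" "a \<in> borel_measurable borel"
    using s_continuous p_continuous a_continuous by (auto intro: borel_measurable_continuous_onI)
  have Gm[measurable]: "G \<in> borel_measurable borel" unfolding G_def by measurable
  have G0: "0 \<le> G y" for y unfolding G_def using S(2)[of "max x y"] p_pos[of y] by (intro divide_nonneg_nonneg) auto
  have den: "0 < (a y)\<^sup>2 * p y" for y using a_nonzero p_pos[of y] by simp
  have ratio: "?g n y = (s (min x y) - s (- r n)) / (s (r n) - s (- r n)) * (2 * (s (r n) - s (max x y)) / ((a y)\<^sup>2 * p y))"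
    if "y \<in> {- r n..r n}" for n y
    using that by (simp add: green_def) (simp add: algebra_simps)
  have le: "?g n y \<le> G y" for n y
  proof (cases "y \<in> {- r n..r n}")
    case True
    have "(s (min x y) - s (- r n)) / (s (r n) - s (- r n)) \<le> 1"
    proof -
      have "s (min x y) \<le> s (r n)" using True by (intro s_le) auto
      then show ?thesis using s_less[OF r(1)[of n]] by simp
    qed
    moreover have "0 \<le> 2 * (s (r n) - s (max x y)) / ((a y)\<^sup>2 * p y)"
      using s_le[of "max x y" "r n"] True r(2)[of n] den[of y] by (intro divide_nonneg_nonneg) auto
    ultimately have "?g n y \<le> 1 * (2 * (s (r n) - s (max x y)) / ((a y)\<^sup>2 * p y))"
      unfolding ratio[OF True] by (rule mult_right_mono)
    also have "\<dots> \<le> G y"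
      unfolding G_def mult_1 using S(2)[of "r n"] den[of y] by (intro divide_right_mono mult_left_mono) auto
    finally show ?thesis .
  next
    case False
    then show ?thesis using G0 by (simp add: green_def)
  qed
  have lim: "(\<lambda>n. ?g n y) \<longlonglongrightarrow> G y" for y
  proof -
    have top: "(\<lambda>n. s (r n)) \<longlonglongrightarrow> S" by (rule filterlim_compose[OF S(1) r_lim])
    have "filterlim (\<lambda>n. - r n) at_bot sequentially" using r_lim by (simp add: filterlim_uminus_at_top)
    from filterlim_compose[OF bot this] have lb: "filterlim (\<lambda>n. s (- r n)) at_bot sequentially" .
    \<comment> \<open>The quotient in \<open>ratio\<close> is 1 plus this one. Here the numerator
      converges and the denominator tends to infinity, because \<open>s\<close> is unbounded
      below.\<close>
    have inv: "(\<lambda>n. (s (min x y) - s (r n)) / (s (r n) - s (- r n))) \<longlonglongrightarrow> 0"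
    proof (rule tendsto_divide_0)
      show "(\<lambda>n. s (min x y) - s (r n)) \<longlonglongrightarrow> s (min x y) - S" by (intro tendsto_intros top)
      have "filterlim (\<lambda>n. - s (- r n)) at_top sequentially" using lb by (simp add: filterlim_uminus_at_bot)
      then have "filterlim (\<lambda>n. s (r n) + - s (- r n)) at_top sequentially"
        by (rule filterlim_tendsto_add_at_top[OF top])
      then show "filterlim (\<lambda>n. s (r n) - s (- r n)) at_infinity sequentially"
        by (simp add: filterlim_at_top_imp_at_infinity)
    qed
    have "(\<lambda>n. (1 + (s (min x y) - s (r n)) / (s (r n) - s (- r n))) * (2 * (s (r n) - s (max x y)) / ((a y)\<^sup>2 * p y)))
      \<longlonglongrightarrow> (1 + 0) * (2 * (S - s (max x y)) / ((a y)\<^sup>2 * p y))"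
      using den[of y] by (intro tendsto_intros inv top) auto
    moreover have "\<forall>\<^sub>F n in sequentially. (1 + (s (min x y) - s (r n)) / (s (r n) - s (- r n))) * (2 * (s (r n) - s (max x y)) / ((a y)\<^sup>2 * p y)) = ?g n y"
    proof -
      obtain n0 :: nat where n0: "\<bar>y\<bar> \<le> real n0" using real_arch_simple by blast
      show ?thesis
        using eventually_ge_at_top[of n0]
      proof eventually_elim
        case (elim n)
        then have "\<bar>y\<bar> \<le> real n" using n0 by simp
        then have y: "y \<in> {- r n..r n}" by (auto simp: r_def)
        have "1 + (s (min x y) - s (r n)) / (s (r n) - s (- r n)) = (s (min x y) - s (- r n)) / (s (r n) - s (- r n))"
          using s_less[OF r(1)[of n]] by (simp add: field_simps)
        then show ?case unfolding ratio[OF y] by simp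
      qed
    qed
    ultimately show ?thesis unfolding G_def by (simp add: Lim_transform_eventually)
  qed
  show "sets (occupation (\<lambda>_. True)) = sets (density lborel (\<lambda>y. ennreal (G y)))" by (simp add: sets_occupation)
  fix A assume "A \<in> sets (occupation (\<lambda>_. True))"
  then have A[measurable]: "A \<in> sets borel" by (simp add: sets_occupation)
  define k where "k = (\<lambda>n z. of_bool (0 \<le> fst z \<and> snd z \<in> alive (- r n) (r n) (fst z)) * indicator A (X (max 0 (fst z)) (snd z)) :: ennreal)"
  have [measurable]: "k n \<in> borel_measurable (lborel \<Otimes>\<^sub>M M)" for n unfolding k_def by measurable
  have em: "emeasure (occupation P) A = (\<integral>\<^sup>+z. of_bool (0 \<le> fst z \<and> P z) * indicator A (X (max 0 (fst z)) (snd z)) \<partial>(lborel \<Otimes>\<^sub>M M))"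
    if "Measurable.pred (lborel \<Otimes>\<^sub>M M) P" for P
    using nn_integral_occupation[OF that, of "indicator A"] by (simp add: sets_occupation)
  have killed: "(\<integral>\<^sup>+z. k n z \<partial>(lborel \<Otimes>\<^sub>M M)) = (\<integral>\<^sup>+y. ennreal (?g n y) * indicator A y \<partial>lborel)" for n
  proof -
    have "(\<integral>\<^sup>+z. k n z \<partial>(lborel \<Otimes>\<^sub>M M)) = emeasure (occupation (\<lambda>z. snd z \<in> alive (- r n) (r n) (fst z))) A"
      unfolding k_def by (rule em[symmetric]) measurable
    also have "\<dots> = (\<integral>\<^sup>+y. ennreal (?g n y) * indicator A y \<partial>lborel)"
      unfolding killed_occupation_density[OF r] by (simp add: emeasure_density)
    finally show ?thesis .
  qed
  have full: "(\<lambda>n. \<integral>\<^sup>+z. k n z \<partial>(lborel \<Otimes>\<^sub>M M)) \<longlonglongrightarrow> emeasure (occupation (\<lambda>_. True)) A"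
    unfolding em[of "\<lambda>_. True", simplified]
  proof -
    \<comment> \<open>Convergence is asked at every z, also outside the space, where nothing is
      alive; hence the factor \<open>snd z \<in> space M\<close>.\<close>
    have "(\<lambda>n. \<integral>\<^sup>+z. k n z \<partial>(lborel \<Otimes>\<^sub>M M))
      \<longlonglongrightarrow> (\<integral>\<^sup>+z. of_bool (0 \<le> fst z \<and> snd z \<in> space M) * indicator A (X (max 0 (fst z)) (snd z)) \<partial>(lborel \<Otimes>\<^sub>M M))"
    proof (rule nn_integral_LIMSEQ)
      have "alive (- r n) (r n) t \<subseteq> alive (- r m) (r m) t" if "n \<le> m" for n m t
        using that by (force simp: alive_def r_def)
      then show "incseq k" unfolding incseq_def le_fun_def k_def
        by (auto intro!: mult_right_mono simp: of_bool_def)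
      show "k n \<in> borel_measurable (lborel \<Otimes>\<^sub>M M)" for n by measurable
      fix z :: "real \<times> 'a"
      show "(\<lambda>n. k n z) \<longlonglongrightarrow> of_bool (0 \<le> fst z \<and> snd z \<in> space M) * indicator A (X (max 0 (fst z)) (snd z))"
      proof (cases "snd z \<in> space M")
        case True
        have "compact ((\<lambda>t. X t (snd z)) ` {0..fst z})"
          by (intro compact_continuous_image continuous_on_subset[OF X_cont[OF True]]) auto
        then obtain B where B: "\<And>t. t \<in> {0..fst z} \<Longrightarrow> \<bar>X t (snd z)\<bar> \<le> B"
          using compact_imp_bounded bounded_iff by (metis imageI real_norm_def)
        obtain n0 :: nat where n0: "B \<le> real n0" using real_arch_simple by blast
        have "\<forall>\<^sub>F n in sequentially. k n z = of_bool (0 \<le> fst z \<and> snd z \<in> space M) * indicator A (X (max 0 (fst z)) (snd z))"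
          using eventually_ge_at_top[of n0]
        proof eventually_elim
          case (elim n)
          have "X t (snd z) \<in> {- r n..r n}" if "t \<in> {0..fst z}" for t
          proof -
            have "\<bar>X t (snd z)\<bar> \<le> real n" using B[OF that] n0 elim by linarith
            then show ?thesis by (auto simp: r_def)
          qed
          then have "snd z \<in> alive (- r n) (r n) (fst z)" using True unfolding alive_def by blast
          then show ?case using True by (simp add: k_def)
        qed
        then show ?thesis by (rule tendsto_eventually)
      next
        case False
        then have "k n z = 0" for n using alive_space[of "- r n" "r n" "fst z"] by (auto simp: k_def)
        then show ?thesis using False by simp
      qed
    qed
    also have "(\<integral>\<^sup>+z. of_bool (0 \<le> fst z \<and> snd z \<in> space M) * indicator A (X (max 0 (fst z)) (snd z)) \<partial>(lborel \<Otimes>\<^sub>M M))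
      = (\<integral>\<^sup>+z. of_bool (0 \<le> fst z) * indicator A (X (max 0 (fst z)) (snd z)) \<partial>(lborel \<Otimes>\<^sub>M M))"
      by (intro nn_integral_cong) (auto simp: space_pair_measure)
    finally show "(\<lambda>n. \<integral>\<^sup>+z. k n z \<partial>(lborel \<Otimes>\<^sub>M M))
      \<longlonglongrightarrow> (\<integral>\<^sup>+z. of_bool (0 \<le> fst z) * indicator A (X (max 0 (fst z)) (snd z)) \<partial>(lborel \<Otimes>\<^sub>M M))" .
  qed
  have dens: "emeasure (density lborel (\<lambda>y. ennreal (G y))) A = (\<integral>\<^sup>+y. ennreal (G y) * indicator A y \<partial>lborel)"
    by (simp add: emeasure_density)
  show "emeasure (occupation (\<lambda>_. True)) A = emeasure (density lborel (\<lambda>y. ennreal (G y))) A"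
    unfolding dens
  proof (rule antisym)
    show "emeasure (occupation (\<lambda>_. True)) A \<le> (\<integral>\<^sup>+y. ennreal (G y) * indicator A y \<partial>lborel)"
    proof (rule LIMSEQ_le_const2[OF full], intro exI allI impI)
      fix n
      show "(\<integral>\<^sup>+z. k n z \<partial>(lborel \<Otimes>\<^sub>M M)) \<le> (\<integral>\<^sup>+y. ennreal (G y) * indicator A y \<partial>lborel)"
        unfolding killed by (intro nn_integral_mono mult_right_mono ennreal_leI le) auto
    qed
    have "(\<integral>\<^sup>+y. ennreal (G y) * indicator A y \<partial>lborel) = (\<integral>\<^sup>+y. liminf (\<lambda>n. ennreal (?g n y) * indicator A y) \<partial>lborel)"
    proof (rule nn_integral_cong)
      fix y
      have "(\<lambda>n. ennreal (?g n y) * indicator A y) \<longlonglongrightarrow> ennreal (G y) * indicator A y"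
        by (intro tendsto_mult_ennreal tendsto_ennrealI lim tendsto_const) (simp add: indicator_def)
      then show "ennreal (G y) * indicator A y = liminf (\<lambda>n. ennreal (?g n y) * indicator A y)"
        by (simp add: lim_imp_Liminf)
    qed
    also have "\<dots> \<le> liminf (\<lambda>n. \<integral>\<^sup>+y. ennreal (?g n y) * indicator A y \<partial>lborel)"
      by (rule nn_integral_liminf) measurable
    also have "\<dots> = emeasure (occupation (\<lambda>_. True)) A"
      using lim_imp_Liminf[OF _ full] by (simp add: killed)
    finally show "(\<integral>\<^sup>+y. ennreal (G y) * indicator A y \<partial>lborel) \<le> emeasure (occupation (\<lambda>_. True)) A" .
  qed
qed

text \<open>Integrability against the density is integrability of \<open>f\<close> under the
  occupation measure, hence of \<open>f (X t)\<close> over time and outcomes jointly. Fubini's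
  theorem then yields the pathwise integrals and their mean, for \<open>f\<close> of either
  sign.\<close>

lemma expectation_occupation:
  assumes S: "(s \<longlongrightarrow> S) at_top" "\<And>y. s y < S" and bot: "LIM y at_bot. s y :> at_bot"
    and f[measurable]: "f \<in> borel_measurable borel"
  defines "G \<equiv> \<lambda>y. 2 * (S - s (max x y)) / ((a y)\<^sup>2 * p y)"
  assumes int: "integrable lborel (\<lambda>y. G y * f y)"
  shows "AE \<omega> in M. set_integrable lborel {0..} (\<lambda>t. f (X t \<omega>))"
    and "integrable M (\<lambda>\<omega>. LBINT t:{0..}. f (X t \<omega>))"
    and "expectation (\<lambda>\<omega>. LBINT t:{0..}. f (X t \<omega>)) = (LBINT y. G y * f y)"
proof -
  have [measurable]: "s \<in> borel_measurable borel" "p \<in> borel_measurable borel" "a \<in> borel_measurable borel"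
    using s_continuous p_continuous a_continuous by (auto intro: borel_measurable_continuous_onI)
  have Gm[measurable]: "G \<in> borel_measurable borel" unfolding G_def by measurable
  have G0: "0 \<le> G y" for y unfolding G_def using S(2)[of "max x y"] p_pos[of y] by (intro divide_nonneg_nonneg) auto
  have occ: "occupation (\<lambda>_. True) = density lborel (\<lambda>y. ennreal (G y))"
    unfolding G_def by (rule occupation_density[OF S bot])
  define F where "F = (\<lambda>t \<omega>. indicator {0..} t * f (X (max 0 t) \<omega>))"
  have of_b: "of_bool (0 \<le> t) = ennreal (indicator {0..} t)" for t :: real by (simp add: indicator_def)
  have Fm[measurable]: "case_prod F \<in> borel_measurable (lborel \<Otimes>\<^sub>M M)"
    unfolding F_def case_prod_beta' by measurable
  have intG: "integrable (density lborel (\<lambda>y. ennreal (G y))) f"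
    using int G0 by (subst integrable_density) auto
  have iF: "integrable (lborel \<Otimes>\<^sub>M M) (case_prod F)"
  proof -
    have "integrable (density (lborel \<Otimes>\<^sub>M M) (\<lambda>z. ennreal (indicator {0..} (fst z)))) (\<lambda>z. f (X (max 0 (fst z)) (snd z)))"
      using intG unfolding occ[symmetric] occupation_def
      by (subst (asm) integrable_distr_eq) (auto simp: of_b)
    then show ?thesis by (subst (asm) integrable_density) (auto simp: F_def case_prod_beta')
  qed
  have "(LBINT y. G y * f y) = (\<integral>y. f y \<partial>density lborel (\<lambda>y. ennreal (G y)))"
    using G0 by (subst integral_density) auto
  also have "\<dots> = (\<integral>z. f (X (max 0 (fst z)) (snd z)) \<partial>density (lborel \<Otimes>\<^sub>M M) (\<lambda>z. ennreal (indicator {0..} (fst z))))"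
    unfolding occ[symmetric] occupation_def by (subst integral_distr) (auto simp: of_b)
  also have "\<dots> = (\<integral>z. case_prod F z \<partial>(lborel \<Otimes>\<^sub>M M))"
    by (subst integral_density) (auto simp: F_def case_prod_beta')
  also have "\<dots> = expectation (\<lambda>\<omega>. LBINT t. F t \<omega>)" by (rule time.integral_snd[OF iF, symmetric])
  finally have E: "(LBINT y. G y * f y) = expectation (\<lambda>\<omega>. LBINT t. F t \<omega>)" .
  have Feq: "F t \<omega> = indicator {0..} t *\<^sub>R f (X t \<omega>)" for t \<omega> by (auto simp: F_def indicator_def max_absorb2)
  show "AE \<omega> in M. set_integrable lborel {0..} (\<lambda>t. f (X t \<omega>))"
    using time.AE_integrable_snd[OF iF] by (simp add: set_integrable_def Feq)
  show "integrable M (\<lambda>\<omega>. LBINT t:{0..}. f (X t \<omega>))"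
    using time.integrable_snd[OF iF] by (simp add: set_lebesgue_integral_def Feq)
  show "expectation (\<lambda>\<omega>. LBINT t:{0..}. f (X t \<omega>)) = (LBINT y. G y * f y)"
    using E by (simp add: set_lebesgue_integral_def Feq)
qed

end

section \<open>The expectation formula\<close>

text \<open>The two preimages differ only inside a null set, all of whose subsets are measurable by
  completeness.\<close>

lemma (in complete_measure) borel_measurable_AE_eq:
  fixes f g :: "'a \<Rightarrow> 'b::topological_space"
  assumes f: "f \<in> borel_measurable M" and eq: "AE \<omega> in M. f \<omega> = g \<omega>"
  shows "g \<in> borel_measurable M"
proof (rule measurableI)
  obtain N where N: "{\<omega>\<in>space M. f \<omega> \<noteq> g \<omega>} \<subseteq> N" "N \<in> null_sets M"
    using eq unfolding eventually_ae_filter by auto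
  fix A :: "'b set" assume A: "A \<in> sets borel"
  have "g -` A \<inter> space M = ((f -` A \<inter> space M) - N) \<union> (g -` A \<inter> space M \<inter> N)" using N(1) by auto
  moreover have "g -` A \<inter> space M \<inter> N \<in> sets M" by (rule complete[OF _ N(2)]) auto
  moreover have "f -` A \<inter> space M \<in> sets M" using measurable_sets[OF f A] .
  ultimately show "g -` A \<inter> space M \<in> sets M" using null_setsD2[OF N(2)] by (metis sets.Un sets.Diff)
qed simp

text \<open>Lets the approximation of the stochastic integral survive a change of paths on a null
  set; completeness supplies the measurability that \<open>vanishes_in_prob\<close> demands.\<close>

lemma (in complete_filtered_prob_space) vanishes_in_prob_AE_eq:
  assumes Z: "vanishes_in_prob M Z" and eq: "AE \<omega> in M. \<forall>k. Z k \<omega> = Z' k \<omega>"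
  shows "vanishes_in_prob M Z'"
proof -
  have Zm[measurable]: "Z k \<in> borel_measurable M" for k using Z by (simp add: vanishes_in_prob_def)
  have [measurable]: "Z' k \<in> borel_measurable M" for k
    by (rule borel_measurable_AE_eq[OF Zm]) (use eq in auto)
  have "prob {\<omega>\<in>space M. ennreal \<epsilon> < Z' k \<omega>} = prob {\<omega>\<in>space M. ennreal \<epsilon> < Z k \<omega>}" for \<epsilon> k
    by (rule finite_measure_eq_AE) (use eq in auto)
  then show ?thesis using Z by (simp add: vanishes_in_prob_def)
qed

text \<open>Paths are made continuous everywhere by changing them on a null set, which belongs to \<open>F 0\<close>.\<close>

lemma (in wiener_process) continuous_version:
  assumes a: "continuous_on UNIV a" and b: "continuous_on UNIV b" and X: "diffusion M F W a b x X"
  obtains X' I where "continuous_diffusion M F W a b X' I x" "AE \<omega> in M. \<forall>t. X' t \<omega> = X t \<omega>"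
proof -
  obtain I where I: "is_ito_integral M F W (\<lambda>s \<omega>. a (X s \<omega>)) I"
    and eq: "AE \<omega> in M. \<forall>t\<ge>0. X t \<omega> = x + (LBINT s:{0..t}. b (X s \<omega>)) + I t \<omega>"
    and ad: "adapted F X" and co: "continuous_paths M X"
    using X unfolding diffusion_def by blast
  obtain N where N: "{\<omega>\<in>space M. \<not> continuous_on {0..} (\<lambda>t. X t \<omega>)} \<subseteq> N" "N \<in> null_sets M"
    using co unfolding continuous_paths_def eventually_ae_filter by auto
  \<comment> \<open>On the exceptional null set the path is replaced by 0, which is continuous; the
    equation may fail there.\<close>
  define X' where "X' = (\<lambda>t \<omega>. indicator (space M - N) \<omega> * X t \<omega>)"
  have AE: "AE \<omega> in M. \<forall>t. X' t \<omega> = X t \<omega>"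
    using AE_not_in[OF N(2)] AE_space by eventually_elim (simp add: X'_def)
  have "continuous_diffusion M F W a b X' I x"
  proof
    show "continuous_on UNIV a" "continuous_on UNIV b" by fact+
    fix t :: real assume t: "0 \<le> t"
    have [measurable]: "X t \<in> borel_measurable (F t)" using ad t by (simp add: adapted_def)
    have "N \<in> sets (F t)" using F_null F_mono[of 0 t] N(2) t by blast
    moreover have "space (F t) = space M" using subalgebra_F[OF t] by (simp add: subalgebra_def)
    ultimately have [measurable]: "space M - N \<in> sets (F t)" by (metis sets.compl_sets)
    show "X' t \<in> borel_measurable (F t)" unfolding X'_def by measurable
  next
    fix \<omega> assume \<omega>: "\<omega> \<in> space M"
    show "continuous_on {0..} (\<lambda>t. X' t \<omega>)"
      using N(1) \<omega> unfolding X'_def by (cases "\<omega> \<in> N") auto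
  next
    show "is_ito_integral M F W (\<lambda>s \<omega>. a (X' s \<omega>)) I"
    proof -
      obtain n \<tau> \<xi> where sp: "\<forall>k. simple_process M F (n k) (\<tau> k) (\<xi> k)"
        and v1: "\<forall>T\<ge>0. vanishes_in_prob M (\<lambda>k \<omega>.
           \<integral>\<^sup>+s\<in>{0..T}. ennreal ((simple_value (n k) (\<tau> k) (\<xi> k) s \<omega> - a (X s \<omega>))\<^sup>2) \<partial>lborel)"
        and v2: "\<forall>t\<ge>0. vanishes_in_prob M (\<lambda>k \<omega>. ennreal \<bar>simple_integral W (n k) (\<tau> k) (\<xi> k) t \<omega> - I t \<omega>\<bar>)"
        and I': "adapted F I" "continuous_paths M I"
        using I unfolding is_ito_integral_def by blast
      have "vanishes_in_prob M (\<lambda>k \<omega>.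
         \<integral>\<^sup>+s\<in>{0..T}. ennreal ((simple_value (n k) (\<tau> k) (\<xi> k) s \<omega> - a (X' s \<omega>))\<^sup>2) \<partial>lborel)" if "0 \<le> T" for T
        by (rule vanishes_in_prob_AE_eq[OF v1[rule_format, OF that]]) (use AE in eventually_elim, simp)
      then show ?thesis unfolding is_ito_integral_def using sp v2 I' by blast
    qed
    show "AE \<omega> in M. \<forall>t\<ge>0. X' t \<omega> = x + (LBINT s:{0..t}. b (X' s \<omega>)) + I t \<omega>"
      using AE eq by eventually_elim simp
  qed
  then show ?thesis using that AE by blast
qed

section \<open>The limit density integrated against \<open>f\<close>\<close>

context diffusion_scale begin

text \<open>The maximum in \<open>G\<close> splits the integral at x. To the right of x,
  \<open>G y\<close> is twice \<open>Phi_pinf\<close> at y over \<open>a^2\<close>; to the left the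
  numerator is frozen at x, and \<open>p x / p y\<close> is \<open>phi\<close> from y to x.\<close>

lemma green_integrable:
  assumes S: "\<And>y. s y < S" "\<And>y. Phi_pinf a b y = ereal ((S - s y) / p y)"
    and f[measurable]: "f \<in> borel_measurable borel" and loc: "locally_integrable (\<lambda>y. f y / (a y)\<^sup>2)"
    and pos: "(\<integral>\<^sup>+y\<in>{0..}. ennreal (\<bar>f y\<bar> / (a y)\<^sup>2 * real_of_ereal (Phi_pinf a b y)) \<partial>lborel) < \<infinity>"
    and neg: "(\<integral>\<^sup>+u\<in>{..x}. ennreal (\<bar>f u\<bar> / (a u)\<^sup>2 * phi a b u x) \<partial>lborel) < \<infinity>"
  defines "G \<equiv> \<lambda>y. 2 * (S - s (max x y)) / ((a y)\<^sup>2 * p y)"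
  shows "integrable lborel (\<lambda>y. G y * f y)"
    and "(LBINT y. G y * f y) = 2 * (LBINT u:{x..}. f u / (a u)\<^sup>2 * real_of_ereal (Phi_pinf a b u)) +
      2 * real_of_ereal (Phi_pinf a b x) * (LBINT u:{..x}. f u / (a u)\<^sup>2 * phi a b u x)"
proof -
  have [measurable]: "s \<in> borel_measurable borel" "p \<in> borel_measurable borel" "a \<in> borel_measurable borel"
    using s_continuous p_continuous a_continuous by (auto intro: borel_measurable_continuous_onI)
  define q where "q = (\<lambda>y. (S - s y) / p y)"
  have q: "real_of_ereal (Phi_pinf a b y) = q y" for y by (simp add: S(2) q_def)
  have q0: "0 \<le> q y" for y using S(1)[of y] p_pos[of y] by (simp add: q_def)
  have [measurable]: "q \<in> borel_measurable borel" unfolding q_def by measurable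
  have q_cont: "continuous_on A q" for A
    unfolding q_def using p_pos by (intro continuous_intros s_continuous p_continuous) (auto simp: less_imp_neq[symmetric])
  have sq: "\<bar>v\<^sup>2\<bar> = v\<^sup>2" for v :: real by simp
  have iL: "set_integrable lborel {..x} (\<lambda>u. f u / (a u)\<^sup>2 * phi a b u x)"
    unfolding set_integrable_def
  proof (rule integrableI_bounded)
    show "(\<lambda>u. indicator {..x} u *\<^sub>R (f u / (a u)\<^sup>2 * phi a b u x)) \<in> borel_measurable lborel"
      unfolding phi_eq by measurable
    have "(\<integral>\<^sup>+u. ennreal (norm (indicator {..x} u *\<^sub>R (f u / (a u)\<^sup>2 * phi a b u x))) \<partial>lborel)
      = (\<integral>\<^sup>+u\<in>{..x}. ennreal (\<bar>f u\<bar> / (a u)\<^sup>2 * phi a b u x) \<partial>lborel)"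
      by (intro nn_integral_cong) (auto simp: indicator_def abs_mult abs_divide sq phi_def)
    then show "(\<integral>\<^sup>+u. ennreal (norm (indicator {..x} u *\<^sub>R (f u / (a u)\<^sup>2 * phi a b u x))) \<partial>lborel) < \<infinity>" using neg by simp
  qed
  have i0: "set_integrable lborel {0..} (\<lambda>u. f u / (a u)\<^sup>2 * q u)"
    unfolding set_integrable_def
  proof (rule integrableI_bounded)
    show "(\<lambda>u. indicator {0..} u *\<^sub>R (f u / (a u)\<^sup>2 * q u)) \<in> borel_measurable lborel" by measurable
    have "(\<integral>\<^sup>+u. ennreal (norm (indicator {0..} u *\<^sub>R (f u / (a u)\<^sup>2 * q u))) \<partial>lborel)
      = (\<integral>\<^sup>+y\<in>{0..}. ennreal (\<bar>f y\<bar> / (a y)\<^sup>2 * real_of_ereal (Phi_pinf a b y)) \<partial>lborel)"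
      using q0 by (intro nn_integral_cong) (auto simp: indicator_def abs_mult abs_divide sq q)
    then show "(\<integral>\<^sup>+u. ennreal (norm (indicator {0..} u *\<^sub>R (f u / (a u)\<^sup>2 * q u))) \<partial>lborel) < \<infinity>" using pos by simp
  qed
  \<comment> \<open>The hypothesis at infinity starts at 0. If x is negative, the stretch from x to
    0 is covered by local integrability, \<open>q\<close> being continuous and so bounded
    there.\<close>
  have ic: "set_integrable lborel {min x 0..0} (\<lambda>u. f u / (a u)\<^sup>2 * q u)"
  proof -
    let ?K = "{min x 0..0}"
    have "compact (q ` ?K)" by (intro compact_continuous_image q_cont) auto
    then obtain B where B: "\<And>y. y \<in> ?K \<Longrightarrow> \<bar>q y\<bar> \<le> B"
      using compact_imp_bounded bounded_iff by (metis imageI real_norm_def)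
    have B0: "0 \<le> B" using B[of 0] by auto
    have "integrable lborel (\<lambda>u. indicator ?K u *\<^sub>R (f u / (a u)\<^sup>2))"
      using loc unfolding locally_integrable_def set_integrable_def by blast
    then have "integrable lborel (\<lambda>u. B * (indicator ?K u *\<^sub>R (f u / (a u)\<^sup>2)))" by (rule integrable_mult_right)
    then show ?thesis unfolding set_integrable_def
    proof (rule Bochner_Integration.integrable_bound)
      show "(\<lambda>u. indicator ?K u *\<^sub>R (f u / (a u)\<^sup>2 * q u)) \<in> borel_measurable lborel" by measurable
      show "AE u in lborel. norm (indicator ?K u *\<^sub>R (f u / (a u)\<^sup>2 * q u)) \<le> norm (B * (indicator ?K u *\<^sub>R (f u / (a u)\<^sup>2)))"
      proof (rule AE_I2)
        fix u
        show "norm (indicator ?K u *\<^sub>R (f u / (a u)\<^sup>2 * q u)) \<le> norm (B * (indicator ?K u *\<^sub>R (f u / (a u)\<^sup>2)))"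
        proof (cases "u \<in> ?K")
          case True
          have "\<bar>f u / (a u)\<^sup>2\<bar> * \<bar>q u\<bar> \<le> \<bar>f u / (a u)\<^sup>2\<bar> * B" by (rule mult_left_mono[OF B[OF True]]) simp
          then show ?thesis using True B0 by (simp add: abs_mult mult.commute)
        qed simp
      qed
    qed
  qed
  have iR: "set_integrable lborel {x..} (\<lambda>u. f u / (a u)\<^sup>2 * q u)"
    by (rule set_integrable_subset[OF set_integrable_Un[OF ic i0]]) auto
  define L where "L = (\<lambda>u. 2 * q x * (indicator {..x} u *\<^sub>R (f u / (a u)\<^sup>2 * phi a b u x)))"
  define R where "R = (\<lambda>u. 2 * (indicator {x..} u *\<^sub>R (f u / (a u)\<^sup>2 * q u)))"
  have LR: "integrable lborel L" "integrable lborel R"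
    unfolding L_def R_def
    by (rule integrable_mult_right[OF iL[unfolded set_integrable_def]], rule integrable_mult_right[OF iR[unfolded set_integrable_def]])
  have [measurable]: "L \<in> borel_measurable lborel" "R \<in> borel_measurable lborel" using LR by auto
  have Gf[measurable]: "(\<lambda>y. G y * f y) \<in> borel_measurable lborel" unfolding G_def by measurable
  have ae: "AE y in lborel. G y * f y = L y + R y"
    using AE_lborel_singleton[of x]
  proof eventually_elim
    case (elim y)
    show ?case
    proof (cases "y < x")
      case True
      \<comment> \<open>The factor \<open>p x\<close> of \<open>phi\<close> cancels the denominator
        of \<open>q x\<close>.\<close>
      then have "L y + R y = 2 * q x * (f y / (a y)\<^sup>2 * (p x / p y))" by (simp add: L_def R_def phi_eq)
      also have "\<dots> = G y * f y"
        using True p_pos[of x] p_pos[of y] by (simp add: G_def q_def max_absorb1)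
      finally show ?thesis by simp
    next
      case False
      then have "L y + R y = 2 * (f y / (a y)\<^sup>2 * q y)" using elim by (simp add: L_def R_def)
      also have "\<dots> = G y * f y" using False by (simp add: G_def q_def max_absorb2)
      finally show ?thesis by simp
    qed
  qed
  show "integrable lborel (\<lambda>y. G y * f y)"
    using LR by (subst integrable_cong_AE[OF _ _ ae]) auto
  have "(LBINT y. G y * f y) = (LBINT y. L y + R y)" by (rule integral_cong_AE[OF _ _ ae]) auto
  also have "\<dots> = (LBINT y. L y) + (LBINT y. R y)" using LR by simp
  also have "(LBINT y. L y) = 2 * q x * (LBINT u:{..x}. f u / (a u)\<^sup>2 * phi a b u x)"
    unfolding L_def set_lebesgue_integral_def by (rule integral_mult_right_zero)
  also have "(LBINT y. R y) = 2 * (LBINT u:{x..}. f u / (a u)\<^sup>2 * q u)"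
    unfolding R_def set_lebesgue_integral_def by (rule integral_mult_right_zero)
  finally show "(LBINT y. G y * f y) = 2 * (LBINT u:{x..}. f u / (a u)\<^sup>2 * real_of_ereal (Phi_pinf a b u)) +
      2 * real_of_ereal (Phi_pinf a b x) * (LBINT u:{..x}. f u / (a u)\<^sup>2 * phi a b u x)"
    unfolding q by (simp only: add.commute)
qed

end

text \<open>Integrability along almost every path and over outcomes is part of the conclusion
  because a Bochner integral that does not exist is 0 by convention. \<open>Phi_pinf\<close> is
  finite at every base point once it is finite at 0, so \<open>real_of_ereal\<close> loses
  nothing.\<close>

theorem theorem3:
  fixes M :: "'a measure" and F :: "real \<Rightarrow> 'a measure" and W :: "real \<Rightarrow> 'a \<Rightarrow> real"
    and a b f :: "real \<Rightarrow> real" and X :: "real \<Rightarrow> real \<Rightarrow> 'a \<Rightarrow> real" and x :: real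
  assumes "wiener_process M F W"
    and "continuous_on UNIV a" and "continuous_on UNIV b" and "\<And>y. a y \<noteq> 0"
    and "\<And>y. diffusion M F W a b y (X y)"
    and "Phi_pinf a b 0 < \<infinity>" and "Phi_minf a b 0 = - \<infinity>"
    and "f \<in> borel_measurable borel"
    and "locally_integrable f" and "locally_integrable (\<lambda>y. f y / (a y)\<^sup>2)"
    and "(\<integral>\<^sup>+y\<in>{0..}. ennreal (\<bar>f y\<bar> / (a y)\<^sup>2 * real_of_ereal (Phi_pinf a b y)) \<partial>lborel) < \<infinity>"
    and "(\<integral>\<^sup>+u\<in>{..x}. ennreal (\<bar>f u\<bar> / (a u)\<^sup>2 * phi a b u x) \<partial>lborel) < \<infinity>"
  shows "(AE \<omega> in M. set_integrable lborel {0..} (\<lambda>s. f (X x s \<omega>))) \<and>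
    integrable M (J_inf (X x) f) \<and>
    prob_space.expectation M (J_inf (X x) f) =
      2 * (LBINT u:{x..}. f u / (a u)\<^sup>2 * real_of_ereal (Phi_pinf a b u)) +
      2 * real_of_ereal (Phi_pinf a b x) * (LBINT u:{..x}. f u / (a u)\<^sup>2 * phi a b u x)"
proof -
  interpret wiener_process M F W by fact
  obtain Y I where Y: "continuous_diffusion M F W a b Y I x" and YX: "AE \<omega> in M. \<forall>t. Y t \<omega> = X x t \<omega>"
    by (rule continuous_version[OF assms(2,3) assms(5)[of x]])
  interpret transient_diffusion M F W a b Y I x
    by (intro transient_diffusion.intro Y diffusion_scale.intro assms(2-4))
  obtain S where S: "(s \<longlongrightarrow> S) at_top" "\<forall>y. s y < S" "\<forall>y. Phi_pinf a b y = ereal ((S - s y) / p y)"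
    by (rule s_tendsto_at_top[OF assms(6)])
  note g = green_integrable[OF S(2,3)[rule_format] assms(8,10-12)]
  note e = expectation_occupation[OF S(1) S(2)[rule_format] s_at_bot[OF assms(7)] assms(8) g(1)]
  \<comment> \<open>The integral along \<open>Y\<close> is measurable; the one along
    \<open>X x\<close> inherits this through completeness of \<open>M\<close>.\<close>
  have J: "AE \<omega> in M. (LBINT t:{0..}. f (Y t \<omega>)) = J_inf (X x) f \<omega>"
    using YX by eventually_elim (simp add: J_inf_def)
  have m: "(\<lambda>\<omega>. LBINT t:{0..}. f (Y t \<omega>)) \<in> borel_measurable M" using e(2) by auto
  have m': "J_inf (X x) f \<in> borel_measurable M" by (rule borel_measurable_AE_eq[OF m J])
  have "AE \<omega> in M. set_integrable lborel {0..} (\<lambda>s. f (X x s \<omega>))"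
    using e(1) YX by eventually_elim simp
  moreover have "integrable M (J_inf (X x) f)"
    using integrable_cong_AE[OF m m' J] e(2) by simp
  moreover have "expectation (J_inf (X x) f) = (LBINT y. 2 * (S - s (max x y)) / ((a y)\<^sup>2 * p y) * f y)"
    using integral_cong_AE[OF m m' J] e(3) by simp
  ultimately show ?thesis using g(2) by simp
qed

end
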